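(* Let $\varphi=\Phi I\in H^\infty$, where $I$ is inner and $\Phi$ is outer, and suppose there exists $0<\delta<1$ such that (i) $|\varphi|$ is an apical Helson--Szegő weight at level $\delta$, and (ii) the interior of $L_\Phi^-(\delta)$ is nonempty and contains $\sigma(I)$. Then $\varphi$ is not saturated.
   Context: $\mathbb{T}$ is the unit circle with normalized Lebesgue measure; $H^p$ ($1\le p\le\infty$) is the subspace of $L^p(\mathbb{T})$ of functions with Fourier coefficients supported on $\{0,1,2,\dots\}$, and $H^\infty_0$ is the subspace of $H^\infty$ of functions vanishing at the origin. A function $\varphi\in H^\infty$ is saturated if $\|\varphi\|_\infty = \inf_{f\in H^\infty_0}\|\varphi-\overline{f}\|_\infty$. Every $\varphi \in H^\infty$ factors as $\varphi=\Phi I$ with $I$ inner ($|I|=1$ a.e.) and $\Phi$ outer. For a bounded function $\psi$ and $0\le\delta\le1$, $L_\psi^+(\delta)=\{e^{i\theta}\in\mathbb{T}: |\psi(e^{i\theta})|\ge\|\psi\|_\infty\delta\}$ and $L_\psi^-(\delta)=\{e^{i\theta}\in\mathbb{T}: |\psi(e^{i\theta})|<\|\psi\|_\infty\delta\}$. Writing $I=BS$ with $B$ Blaschke and $S$ singular inner, $\sigma(I)$ is the union of the accumulation points of the zeros of $B$ and the support of the singular measure of $S$. For real $v\in L^1(\mathbb{T})$, $\tilde v$ denotes its conjugate function. A bounded positive function $w$ on $\mathbb{T}$ is an apical Helson--Szegő weight at level $\delta$ (with $0<\delta<1$) if $w=\exp(u+v)$ where $u\in L^\infty(\mathbb{T})$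 and $v\in L^1(\mathbb{T})$ are real-valued and $\operatorname{ess\,sup}_{L_w^+(\delta)}|\tilde v|<\pi/2$. *)

theory Defs
  imports "HOL-Analysis.Analysis"
begin

text \<open>The unit circle T is represented as the set sphere 0 1 of complex numbers.
  Functions on T are functions complex to complex (or real); only their values on
  sphere 0 1 matter.\<close>

definition circ :: "complex measure" where
  "circ = distr (uniform_measure lborel {0..<2*pi}) (restrict_space borel (sphere 0 1)) cis"

definition linf_norm :: "(complex \<Rightarrow> 'b::real_normed_vector) \<Rightarrow> real" where
  "linf_norm f = Inf {C. 0 \<le> C \<and> (AE z in circ. norm (f z) \<le> C)}"

definition Linf :: "(complex \<Rightarrow> 'b::{real_normed_vector, second_countable_topology}) set" where
  "Linf = {f. f \<in> borel_measurable circ \<and> (\<exists>C. AE z in circ. norm (f z) \<le> C)}"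

definition fourier :: "(complex \<Rightarrow> complex) \<Rightarrow> int \<Rightarrow> complex" where
  "fourier f n = (\<integral>z. f z * z powi (- n) \<partial>circ)"

definition H1 :: "(complex \<Rightarrow> complex) set" where
  "H1 = {f. integrable circ f \<and> (\<forall>n::int. n < 0 \<longrightarrow> fourier f n = 0)}"

definition Hinf :: "(complex \<Rightarrow> complex) set" where
  "Hinf = {f. f \<in> Linf \<and> (\<forall>n::int. n < 0 \<longrightarrow> fourier f n = 0)}"

text \<open>Functions of H-infinity vanishing at the origin (value at 0 of the analytic
  extension = 0th Fourier coefficient).\<close>
definition Hinf0 :: "(complex \<Rightarrow> complex) set" where
  "Hinf0 = {f. f \<in> Hinf \<and> fourier f 0 = 0}"

definition saturated :: "(complex \<Rightarrow> complex) \<Rightarrow> bool" where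
  "saturated \<phi> \<longleftrightarrow>
     linf_norm \<phi> = Inf {linf_norm (\<lambda>z. \<phi> z - cnj (f z)) | f. f \<in> Hinf0}"

definition ext :: "(complex \<Rightarrow> complex) \<Rightarrow> complex \<Rightarrow> complex" where
  "ext f z = (\<Sum>n. fourier f (int n) * z ^ n)"

definition inner_fun :: "(complex \<Rightarrow> complex) \<Rightarrow> bool" where
  "inner_fun I \<longleftrightarrow> I \<in> Hinf \<and> (AE z in circ. norm (I z) = 1)"

definition outer_fun :: "(complex \<Rightarrow> complex) \<Rightarrow> bool" where
  "outer_fun F \<longleftrightarrow> F \<in> H1 \<and> integrable circ (\<lambda>z. ln (norm (F z))) \<and>
     (\<exists>c. norm c = 1 \<and> (\<forall>w\<in>ball 0 1.
        ext F w = c * exp (\<integral>z. ((z + w) / (z - w)) * of_real (ln (norm (F z))) \<partial>circ)))"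

definition blaschke :: "(complex \<Rightarrow> complex) \<Rightarrow> bool" where
  "blaschke B \<longleftrightarrow> inner_fun B \<and>
     (\<exists>c (m::nat) (a::nat \<Rightarrow> complex) (K::nat set).
        norm c = 1 \<and> (\<forall>n\<in>K. a n \<in> ball 0 1 \<and> a n \<noteq> 0) \<and>
        summable (\<lambda>n. if n \<in> K then 1 - norm (a n) else 0) \<and>
        (\<forall>w\<in>ball 0 1. ext B w = c * w ^ m *
           (\<Prod>n. if n \<in> K then (of_real (norm (a n)) / a n) * (a n - w) / (1 - cnj (a n) * w)
                  else 1)))"

definition singular_circ :: "complex measure \<Rightarrow> bool" where
  "singular_circ \<mu> \<longleftrightarrow> (\<exists>A \<in> sets circ. emeasure circ A = 0 \<and> emeasure \<mu> (space circ - A) = 0)"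

definition singular_inner :: "(complex \<Rightarrow> complex) \<Rightarrow> complex measure \<Rightarrow> bool" where
  "singular_inner S \<mu> \<longleftrightarrow> inner_fun S \<and> sets \<mu> = sets circ \<and> finite_measure \<mu> \<and>
     singular_circ \<mu> \<and>
     (\<exists>c. norm c = 1 \<and> (\<forall>w\<in>ball 0 1.
        ext S w = c * exp (- (\<integral>z. (z + w) / (z - w) \<partial>\<mu>))))"

definition measure_support :: "complex measure \<Rightarrow> complex set" where
  "measure_support \<mu> = {\<zeta> \<in> sphere 0 1. \<forall>e>0. emeasure \<mu> (ball \<zeta> e \<inter> sphere 0 1) > 0}"

definition zero_acc :: "(complex \<Rightarrow> complex) \<Rightarrow> complex set" where
  "zero_acc B = {\<zeta>. \<zeta> islimpt {w \<in> ball 0 1. ext B w = 0}}"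

text \<open>sigma(I): for a decomposition I = B S, accumulation points of the zeros of B
  together with the support of the singular measure of S.  (The decomposition is
  unique up to unimodular constants, so we take the union over all decompositions.)\<close>
definition sigma_inner :: "(complex \<Rightarrow> complex) \<Rightarrow> complex set" where
  "sigma_inner I = \<Union> {zero_acc B \<union> measure_support \<mu> | B S \<mu>.
      blaschke B \<and> singular_inner S \<mu> \<and> (AE z in circ. I z = B z * S z)}"

definition Lplus :: "(complex \<Rightarrow> 'b::real_normed_vector) \<Rightarrow> real \<Rightarrow> complex set" where
  "Lplus \<psi> \<delta> = {z \<in> sphere 0 1. norm (\<psi> z) \<ge> linf_norm \<psi> * \<delta>}"

definition Lminus :: "(complex \<Rightarrow> 'b::real_normed_vector) \<Rightarrow> real \<Rightarrow> complex set" where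
  "Lminus \<psi> \<delta> = {z \<in> sphere 0 1. norm (\<psi> z) < linf_norm \<psi> * \<delta>}"

definition conj_fun :: "(complex \<Rightarrow> real) \<Rightarrow> complex \<Rightarrow> real" where
  "conj_fun v z = Lim (at_right 0) (\<lambda>\<epsilon>.
     (1 / (2*pi)) * (LINT t:{t. \<epsilon> < \<bar>t\<bar> \<and> \<bar>t\<bar> < pi}|lborel. v (z * cis (- t)) * cot (t / 2)))"

definition apical_HS :: "(complex \<Rightarrow> real) \<Rightarrow> real \<Rightarrow> bool" where
  "apical_HS w \<delta> \<longleftrightarrow> 0 < \<delta> \<and> \<delta> < 1 \<and> w \<in> Linf \<and> (AE z in circ. w z > 0) \<and>
     (\<exists>u v. u \<in> Linf \<and> integrable circ v \<and> (AE z in circ. w z = exp (u z + v z)) \<and>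
        (\<exists>c < pi / 2. AE z in circ. z \<in> Lplus w \<delta> \<longrightarrow> \<bar>conj_fun v z\<bar> \<le> c))"

end

theory Submission
  imports Defs "HOL-Probability.Probability" "HOL-Complex_Analysis.Complex_Analysis"
begin

text \<open>
  It suffices to find \<open>f\<close> in \<open>H\<^sup>\<infinity>\<close> with \<open>f(0) = 0\<close> and \<open>Re (\<phi> f) \<ge> k > 0\<close> almost everywhere on
  \<open>{|\<phi>| \<ge> \<delta> \<parallel>\<phi>\<parallel>}\<close>: then \<open>|\<phi> - t cnj f|\<^sup>2 = |\<phi>|\<^sup>2 - 2 t Re (\<phi> f) + t\<^sup>2 |f|\<^sup>2\<close> is bounded away from \<open>\<parallel>\<phi>\<parallel>\<^sup>2\<close>
  there for small \<open>t > 0\<close>, and on the rest of the circle \<open>|\<phi>|\<close> is small anyway.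

  Write \<open>|\<phi>| = exp (u + v)\<close>.  As \<open>\<Phi>\<close> is outer, multiplying it by the bounded outer function of modulus \<open>exp (-u)\<close>
  leaves \<open>exp (v + i v~)\<close>, whose argument stays below \<open>\<pi>/2\<close> on the set in question.  On the compact set \<open>K\<close>
  complementary to the interior of \<open>{|\<Phi>| < \<delta> \<parallel>\<Phi>\<parallel>}\<close> the inner function \<open>I\<close> is continuous, because \<open>K\<close> misses
  \<open>\<sigma>(I)\<close>; and as \<open>K\<close> misses an arc, \<open>cnj (z I)\<close> can be approximated on \<open>K\<close>, up to positive factors, by functions
  analytic on the closed disc.  The product of \<open>z\<close>, the outer factor and such an approximant is \<open>f\<close>.

  Two classical facts carry the argument.  The principal value \<open>v~\<close> is the boundary value of the conjugate Poisson
  integral; this follows at Lebesgue points of the Poisson means.  And every inner function is a Blaschke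
  product times a singular inner function, without which \<open>\<sigma>(I)\<close> would carry no information.
\<close>

section \<open>Normalised Lebesgue measure on the circle\<close>

text \<open>Positivity of \<open>Re (\<phi> f)\<close> on the whole circle is impossible:
  \<open>f(0) = 0\<close> makes the mean of \<open>\<phi> f\<close> vanish. The open arc on which
  \<open>|\<Phi>|\<close> is small supplies the needed room.

  Since only the argument of \<open>f\<close> matters, an approximant of the conjugate of
  \<open>z I\<close> may carry any positive weight bounded below. The weight is a power of the Koebe
  function, \<open>- \<zeta> z / (\<zeta> - z)^2\<close>, which is positive on the circle; pushing
  its pole slightly outside the disc, above the missed arc, turns \<open>1 / z ^ N\<close> into
  something analytic. If the argument of \<open>exp (v + i v~)\<close> is at most
  \<open>c1 < \<pi>/2\<close>, an approximation error of half of \<open>cos c1\<close> is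
  affordable.

  \<open>conj_fun\<close> is a \<open>Lim\<close>, hence meaningless until convergence is known.
  That comes from the outer function: \<open>exp\<close> of the Herglotz integral \<open>V\<close>
  of \<open>v\<close> is \<open>\<Phi>\<close> times a bounded analytic factor, so it has nonzero
  radial limits by Fatou; continuity along the radius lifts this to \<open>V\<close> itself, and at
  Lebesgue points the truncated integrals follow \<open>Im V\<close>.\<close>

lemma space_circ [simp]: "space circ = sphere 0 1"
  by (simp add: circ_def space_restrict_space)

lemma sets_circ [measurable_cong]: "sets circ = sets (restrict_space borel (sphere 0 1))"
  by (simp add: circ_def)

lemma cis_measurable_circ [measurable]: "cis \<in> measurable borel (restrict_space borel (sphere 0 1))"
  by (rule measurable_restrict_space2)
     (auto intro!: borel_measurable_continuous_onI continuous_intros)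

lemma cis_measurable_circ' [measurable]: "cis \<in> measurable (uniform_measure lborel {0..<2*pi}) (restrict_space borel (sphere 0 1))"
  using cis_measurable_circ by (simp cong: measurable_cong_sets)

interpretation circ: prob_space circ
proof -
  interpret U: prob_space "uniform_measure lborel {0..<2*pi}"
    by (rule prob_space_uniform_measure) auto
  show "prob_space circ"
    unfolding circ_def by (rule U.prob_space_distr) simp
qed

lemma borel_measurable_circI [measurable (raw)]:
  "f \<in> borel_measurable borel \<Longrightarrow> f \<in> borel_measurable circ"
  by (subst measurable_cong_sets[OF sets_circ refl]) (rule measurable_restrict_space1)

lemma continuous_on_circ_measurable:
  fixes f :: "complex \<Rightarrow> 'b::topological_space"
  assumes "continuous_on (sphere 0 1) f"
  shows "f \<in> borel_measurable circ"
  using assms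
  by (simp add: measurable_cong_sets[OF sets_circ refl] borel_measurable_continuous_on_restrict)

lemma measurable_circ_cis [measurable (raw)]:
  assumes "f \<in> borel_measurable circ"
  shows "(\<lambda>t. f (cis t)) \<in> borel_measurable borel"
  using assms measurable_compose[OF cis_measurable_circ, of f borel]
  by (simp add: measurable_cong_sets[OF sets_circ refl])

section \<open>Integration over the circle by angles\<close>

lemma nn_integral_circ:
  assumes [measurable]: "f \<in> borel_measurable circ"
  shows "(\<integral>\<^sup>+z. f z \<partial>circ) = (\<integral>\<^sup>+t. f (cis t) * indicator {0..<2*pi} t \<partial>lborel) / ennreal (2*pi)"
proof -
  have [measurable]: "f \<in> borel_measurable (restrict_space borel (sphere 0 1))"
    using assms by (simp add: measurable_cong_sets[OF sets_circ refl])
  have "(\<integral>\<^sup>+z. f z \<partial>circ) = (\<integral>\<^sup>+t. f (cis t) \<partial>uniform_measure lborel {0..<2*pi})"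
    unfolding circ_def by (subst nn_integral_distr) auto
  also have "\<dots> = (\<integral>\<^sup>+t. f (cis t) * indicator {0..<2*pi} t \<partial>lborel) / ennreal (2*pi)"
    by (subst nn_integral_uniform_measure) auto
  finally show ?thesis .
qed

text \<open>The overhang \<open>{p..<c+p}\<close> is moved back by one period onto
  \<open>{0..<c}\<close>. The general shift below first reduces its starting point modulo
  \<open>p\<close>.\<close>

lemma nn_integral_periodic_shift1:
  fixes g :: "real \<Rightarrow> ennreal"
  assumes [measurable]: "g \<in> borel_measurable borel" and per: "\<And>t. g (t + p) = g t" and p: "0 \<le> c" "c \<le> p"
  shows "(\<integral>\<^sup>+t. g t * indicator {c..<c+p} t \<partial>lborel) = (\<integral>\<^sup>+t. g t * indicator {0..<p} t \<partial>lborel)"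
proof -
  have "(\<integral>\<^sup>+t. g t * indicator {p..<c+p} t \<partial>lborel) = (\<integral>\<^sup>+t. g (p + t) * indicator {p..<c+p} (p + t) \<partial>lborel)"
    by (subst lborel_distr_plus[symmetric, of p]) (subst nn_integral_distr; simp)
  also have "\<dots> = (\<integral>\<^sup>+t. g t * indicator {0..<c} t \<partial>lborel)"
    by (intro nn_integral_cong) (auto simp: indicator_def add.commute[of p] per)
  finally have 1: "(\<integral>\<^sup>+t. g t * indicator {p..<c+p} t \<partial>lborel) = (\<integral>\<^sup>+t. g t * indicator {0..<c} t \<partial>lborel)" .
  have "(\<integral>\<^sup>+t. g t * indicator {c..<c+p} t \<partial>lborel) =
     (\<integral>\<^sup>+t. g t * indicator {c..<p} t + g t * indicator {p..<c+p} t \<partial>lborel)"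
    using p by (intro nn_integral_cong) (auto simp: indicator_def)
  also have "\<dots> = (\<integral>\<^sup>+t. g t * indicator {c..<p} t \<partial>lborel) + (\<integral>\<^sup>+t. g t * indicator {0..<c} t \<partial>lborel)"
    by (subst nn_integral_add) (auto simp: 1)
  also have "\<dots> = (\<integral>\<^sup>+t. g t * indicator {c..<p} t + g t * indicator {0..<c} t \<partial>lborel)"
    by (subst nn_integral_add) auto
  also have "\<dots> = (\<integral>\<^sup>+t. g t * indicator {0..<p} t \<partial>lborel)"
    using p by (intro nn_integral_cong) (auto simp: indicator_def)
  finally show ?thesis .
qed

lemma nn_integral_periodic_shift:
  fixes g :: "real \<Rightarrow> ennreal"
  assumes [measurable]: "g \<in> borel_measurable borel" and per: "\<And>t. g (t + p) = g t" and p: "0 < p"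
  shows "(\<integral>\<^sup>+t. g t * indicator {a..<a+p} t \<partial>lborel) = (\<integral>\<^sup>+t. g t * indicator {0..<p} t \<partial>lborel)"
proof -
  define k where "k = \<lfloor>a / p\<rfloor>"
  define c where "c = a - of_int k * p"
  have c: "0 \<le> c" "c \<le> p"
  proof -
    have "of_int k \<le> a / p" "a / p < of_int k + 1" unfolding k_def by linarith+
    then show "0 \<le> c" "c \<le> p" using p by (auto simp: c_def field_simps)
  qed
  have pern: "g (t + of_nat n * p) = g t" for t n
  proof (induction n)
    case (Suc n)
    have "g (t + of_nat (Suc n) * p) = g ((t + of_nat n * p) + p)" by (simp add: algebra_simps)
    then show ?case using Suc per by simp
  qed simp
  have perk: "g (t + of_int k * p) = g t" for t
  proof (cases "k \<ge> 0")
    case True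
    then show ?thesis using pern[of t "nat k"] by simp
  next
    case False
    then show ?thesis using pern[of "t + of_int k * p" "nat (-k)"] by simp
  qed
  have perk': "g (t + p * of_int k) = g t" for t
    using perk[of t] by (simp add: mult.commute)
  have "(\<integral>\<^sup>+t. g t * indicator {a..<a+p} t \<partial>lborel) = (\<integral>\<^sup>+t. g (of_int k * p + t) * indicator {a..<a+p} (of_int k * p + t) \<partial>lborel)"
    by (subst lborel_distr_plus[symmetric, of "of_int k * p"]) (subst nn_integral_distr; simp)
  also have "\<dots> = (\<integral>\<^sup>+t. g t * indicator {c..<c+p} t \<partial>lborel)"
    by (intro nn_integral_cong) (auto simp: indicator_def c_def perk' algebra_simps)
  also have "\<dots> = (\<integral>\<^sup>+t. g t * indicator {0..<p} t \<partial>lborel)"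
    using nn_integral_periodic_shift1[OF assms(1) per c] .
  finally show ?thesis .
qed

text \<open>The parametrisation \<open>t \<mapsto> x * cis (- t)\<close> is the one used by the principal value integral.\<close>

lemma nn_integral_circ_rotate:
  assumes [measurable]: "f \<in> borel_measurable circ" and x: "x \<in> sphere 0 1"
  shows "(\<integral>\<^sup>+z. f z \<partial>circ) = (\<integral>\<^sup>+t. f (x * cis (- t)) * indicator {-pi<..<pi} t \<partial>lborel) / ennreal (2*pi)"
proof -
  obtain a where a: "x = cis a"
    using x rcis_cmod_Arg[of x] that[of "Arg x"] by (simp add: rcis_def)
  define g where "g t = f (cis t)" for t
  have [measurable]: "g \<in> borel_measurable borel" unfolding g_def by measurable
  have per: "g (t + 2*pi) = g t" for t
    by (simp add: g_def flip: cis_mult)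
  have "(\<integral>\<^sup>+t. f (x * cis (- t)) * indicator {-pi<..<pi} t \<partial>lborel)
      = (\<integral>\<^sup>+t. g (a - t) * indicator {-pi<..<pi} t \<partial>lborel)"
    by (simp add: g_def a cis_mult)
  \<comment> \<open>The null point \<open>pi\<close> is added because the reflection
    \<open>t\<close> to \<open>a - t\<close> maps \<open>{-pi<..pi}\<close> exactly onto the
    half-open period \<open>{a-pi..<a+pi}\<close>.\<close>
  also have "\<dots> = (\<integral>\<^sup>+t. g (a - t) * indicator {-pi<..pi} t \<partial>lborel)"
    by (intro nn_integral_cong_AE, rule AE_mp[OF AE_lborel_singleton[of pi]]) (auto simp: indicator_def)
  also have "\<dots> = (\<integral>\<^sup>+t. g t * indicator {a-pi..<a-pi+2*pi} t \<partial>lborel)"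
    by (subst (2) nn_integral_real_affine[where c="-1" and t=a])
       (auto intro!: nn_integral_cong simp: indicator_def)
  also have "\<dots> = (\<integral>\<^sup>+t. g t * indicator {0..<2*pi} t \<partial>lborel)"
    using nn_integral_periodic_shift[where g=g and p="2*pi" and a="a-pi", OF _ per] by simp
  finally show ?thesis by (simp add: nn_integral_circ g_def)
qed

lemma measurable_circ_rotate:
  assumes f: "f \<in> borel_measurable circ" and x: "x \<in> sphere 0 1"
  shows "(\<lambda>t. f (x * cis (- t))) \<in> borel_measurable borel"
proof -
  have "(\<lambda>t. x * cis (- t)) \<in> measurable borel (restrict_space borel (sphere 0 1))"
    using x by (intro measurable_restrict_space2)
     (auto simp: norm_mult intro!: borel_measurable_continuous_onI continuous_intros)
  from measurable_compose[OF this, of f borel] f show ?thesis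
    by (simp add: measurable_cong_sets[OF sets_circ refl])
qed

text \<open>The identity for nonnegative integrals, tested on indicators, is upgraded to an equality
  of measures; in this form it transfers Bochner integrals and integrability as well.\<close>

lemma circ_eq_distr_rotate:
  assumes x: "x \<in> sphere 0 1"
  shows "circ = distr (uniform_measure lborel {-pi<..<pi}) (restrict_space borel (sphere 0 1)) (\<lambda>t. x * cis (- t))"
proof (rule measure_eqI)
  fix A assume A: "A \<in> sets circ"
  have [measurable]: "(\<lambda>t. x * cis (- t)) \<in> measurable borel (restrict_space borel (sphere 0 1))"
    using x by (intro measurable_restrict_space2)
     (auto simp: norm_mult intro!: borel_measurable_continuous_onI continuous_intros)
  have [measurable]: "(indicator A :: complex \<Rightarrow> ennreal) \<in> borel_measurable circ"
    using A by auto
  have A': "A \<in> sets (restrict_space borel (sphere 0 1))" using A by (simp add: sets_circ)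
  have [measurable]: "(\<lambda>t. x * cis (- t)) -` A \<in> sets borel"
    using measurable_sets[OF \<open>(\<lambda>t. x * cis (- t)) \<in> _\<close> A'] by simp
  have "emeasure circ A = (\<integral>\<^sup>+t. indicator A (x * cis (- t)) * indicator {-pi<..<pi} t \<partial>lborel) / ennreal (2*pi)"
    using nn_integral_circ_rotate[OF \<open>indicator A \<in> _\<close> x] A by simp
  also have "(\<lambda>t. indicator A (x * cis (- t)) * indicator {-pi<..<pi} t) = (\<lambda>t. indicator ({-pi<..<pi} \<inter> (\<lambda>t. x * cis (- t)) -` A) t :: ennreal)"
    by (auto simp: indicator_def fun_eq_iff)
  also have "(\<integral>\<^sup>+t. indicator ({-pi<..<pi} \<inter> (\<lambda>t. x * cis (- t)) -` A) t \<partial>lborel) = emeasure lborel ({-pi<..<pi} \<inter> (\<lambda>t. x * cis (- t)) -` A)"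
    by (subst nn_integral_indicator) auto
  also have "\<dots> / ennreal (2*pi) = emeasure (distr (uniform_measure lborel {-pi<..<pi}) (restrict_space borel (sphere 0 1)) (\<lambda>t. x * cis (- t))) A"
    using A' by (subst emeasure_distr) (auto simp: emeasure_uniform_measure)
  finally show "emeasure circ A = \<dots>" .
qed (simp add: sets_circ)

lemma integrable_scaleR_iff:
  fixes f :: "'a \<Rightarrow> 'b::{banach, second_countable_topology}"
  assumes "c \<noteq> 0"
  shows "integrable M (\<lambda>t. c *\<^sub>R f t) \<longleftrightarrow> integrable M f"
  using integrable_scaleR_right[of c M f] integrable_scaleR_right[of "inverse c" M "\<lambda>t. c *\<^sub>R f t"] assms
  by auto

lemma
  fixes f :: "complex \<Rightarrow> 'b::{banach, second_countable_topology}"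
  assumes x: "x \<in> sphere 0 1" and [measurable]: "f \<in> borel_measurable circ"
  shows integral_circ_rotate: "(\<integral>z. f z \<partial>circ) = (LINT t:{-pi<..<pi}|lborel. f (x * cis (- t))) /\<^sub>R (2*pi)"
    and integrable_circ_rotate: "integrable circ f \<longleftrightarrow> set_integrable lborel {-pi<..<pi} (\<lambda>t. f (x * cis (- t)))"
proof -
  have m[measurable]: "(\<lambda>t. f (x * cis (- t))) \<in> borel_measurable borel"
    using measurable_circ_rotate[OF assms(2) x] .
  have [measurable]: "(\<lambda>t. x * cis (- t)) \<in> measurable borel (restrict_space borel (sphere 0 1))"
    using x by (intro measurable_restrict_space2)
     (auto simp: norm_mult intro!: borel_measurable_continuous_onI continuous_intros)
  have f[measurable]: "f \<in> borel_measurable (restrict_space borel (sphere 0 1))"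
    using assms by (simp add: measurable_cong_sets[OF sets_circ refl])
  have u: "uniform_measure lborel {-pi<..<pi} = density lborel (\<lambda>t. ennreal (indicator {-pi<..<pi} t / (2*pi)))"
    unfolding uniform_measure_def
    by (intro density_cong) (auto simp: indicator_def divide_ennreal[symmetric] ennreal_1[symmetric] simp del: ennreal_1)
  have kernel: "(\<lambda>t. (indicator {-pi<..<pi} t / (2*pi)) *\<^sub>R f (x * cis (- t))) = (\<lambda>t. inverse (2*pi) *\<^sub>R (indicator {-pi<..<pi} t *\<^sub>R f (x * cis (- t))))"
    by (rule ext) (simp only: divide_inverse scaleR_scaleR mult.commute)
  have "(\<integral>z. f z \<partial>circ) = (\<integral>t. f (x * cis (- t)) \<partial>uniform_measure lborel {-pi<..<pi})"
    by (subst circ_eq_distr_rotate[OF x]) (subst integral_distr; simp)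
  also have "\<dots> = (\<integral>t. (indicator {-pi<..<pi} t / (2*pi)) *\<^sub>R f (x * cis (- t)) \<partial>lborel)"
    unfolding u by (subst integral_density) auto
  also have "\<dots> = (\<integral>t. inverse (2*pi) *\<^sub>R (indicator {-pi<..<pi} t *\<^sub>R f (x * cis (- t))) \<partial>lborel)"
    by (subst kernel) (rule refl)
  also have "\<dots> = (LINT t:{-pi<..<pi}|lborel. f (x * cis (- t))) /\<^sub>R (2*pi)"
    by (subst integral_scaleR_right) (simp add: set_lebesgue_integral_def)
  finally show "(\<integral>z. f z \<partial>circ) = \<dots>" .
  have "integrable circ f \<longleftrightarrow> integrable (uniform_measure lborel {-pi<..<pi}) (\<lambda>t. f (x * cis (- t)))"
    by (subst circ_eq_distr_rotate[OF x]) (subst integrable_distr_eq; simp)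
  also have "\<dots> \<longleftrightarrow> integrable lborel (\<lambda>t. (indicator {-pi<..<pi} t / (2*pi)) *\<^sub>R f (x * cis (- t)))"
    unfolding u by (subst integrable_density) auto
  also have "\<dots> \<longleftrightarrow> integrable lborel (\<lambda>t. inverse (2*pi) *\<^sub>R (indicator {-pi<..<pi} t *\<^sub>R f (x * cis (- t))))"
    by (subst kernel) (rule refl)
  also have "\<dots> \<longleftrightarrow> set_integrable lborel {-pi<..<pi} (\<lambda>t. f (x * cis (- t)))"
    unfolding set_integrable_def by (rule integrable_scaleR_iff) simp
  finally show "integrable circ f \<longleftrightarrow> \<dots>" .
qed

section \<open>Fourier coefficients and the Poisson kernel\<close>

lemma AE_circ_sphere: "AE z in circ. norm z = 1"
  using AE_space[of circ] by simp

lemma integrable_circ_mult_bounded: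
  fixes f g :: "complex \<Rightarrow> 'b::{banach, second_countable_topology, real_normed_algebra}"
  assumes "integrable circ f" "g \<in> borel_measurable circ" "AE z in circ. norm (g z) \<le> C"
  shows "integrable circ (\<lambda>z. g z * f z)"
proof (rule Bochner_Integration.integrable_bound[where f="\<lambda>z. C * norm (f z)"])
  show "AE x in circ. norm (g x * f x) \<le> norm (C * norm (f x))"
    using assms(3)
  proof eventually_elim
    case (elim x)
    then have "norm (g x * f x) \<le> C * norm (f x)"
      by (meson mult_right_mono norm_ge_zero norm_mult_ineq order_trans)
    then show ?case by (metis abs_ge_self order_trans real_norm_def)
  qed
qed (use assms in \<open>auto intro!: borel_measurable_times\<close>)

lemma integrable_circ_bounded:
  fixes g :: "complex \<Rightarrow> 'b::{banach, second_countable_topology}"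
  assumes "g \<in> borel_measurable circ" "AE z in circ. norm (g z) \<le> C"
  shows "integrable circ g"
  by (rule circ.integrable_const_bound[of _ C]) (use assms in auto)

lemma integral_circ_mult_rotate:
  fixes f :: "complex \<Rightarrow> 'b::{banach, second_countable_topology}"
  assumes x: "x \<in> sphere 0 1" and f: "f \<in> borel_measurable circ"
  shows "(\<integral>z. f (x * z) \<partial>circ) = (\<integral>z. f z \<partial>circ)"
proof -
  have "(\<lambda>z. x * z) \<in> measurable circ (restrict_space borel (sphere 0 1))"
    using x by (intro measurable_restrict_space2) (auto simp: norm_mult)
  from measurable_compose[OF this, of f borel] f have m: "(\<lambda>z. f (x * z)) \<in> borel_measurable circ"
    by (simp add: measurable_cong_sets[OF sets_circ refl])
  have "(1::complex) \<in> sphere 0 1" by simp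
  from integral_circ_rotate[OF x f] integral_circ_rotate[OF this m] show ?thesis by simp
qed

lemma powi_measurable_circ [measurable]: "(\<lambda>z. z powi n) \<in> borel_measurable circ"
  by (rule continuous_on_circ_measurable) (auto intro!: continuous_intros)

lemma integral_circ_powi: "(\<integral>z. z powi n \<partial>circ) = (if n = 0 then 1 else 0)"
proof (cases "n = 0")
  case True
  then show ?thesis using circ.prob_space by simp
next
  case False
  \<comment> \<open>A rotation with \<open>x powi n = -1\<close>: invariance of the measure then
    makes the integral equal to its own negative.\<close>
  define x where "x = cis (pi / of_int n)"
  have "x powi n = cis pi"
    using False by (simp add: x_def cis_power_int)
  then have xn: "x powi n = -1" by simp
  have "(\<integral>z. z powi n \<partial>circ) = (\<integral>z. (x * z) powi n \<partial>circ)"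
    by (rule integral_circ_mult_rotate[symmetric]) (auto simp: x_def)
  also have "\<dots> = - (\<integral>z. z powi n \<partial>circ)"
    by (simp add: power_int_mult_distrib xn)
  finally have "2 * (\<integral>z. z powi n \<partial>circ) = 0" by simp
  then show ?thesis using False by simp
qed

section \<open>Cauchy integrals as power series\<close>

lemma norm_diff_ge: "norm w < 1 \<Longrightarrow> norm z = 1 \<Longrightarrow> 1 - norm w \<le> norm (z - w :: complex)"
  by (metis norm_triangle_ineq2)

text \<open>Geometric series integrated term by term. With \<open>g = inverse\<close> it produces
  the coefficients of nonnegative index, with \<open>g\<close> the identity those of nonpositive
  index.\<close>

lemma cauchy_sums_aux:
  fixes f g :: "complex \<Rightarrow> complex"
  assumes f: "integrable circ f" and w: "norm w < 1"
    and g: "\<And>z. norm z = 1 \<Longrightarrow> norm (g z) = 1" "g \<in> borel_measurable circ"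
  shows "(\<lambda>n. \<integral>z. f z * g z ^ n * w ^ n \<partial>circ) sums (\<integral>z. f z * (1 / (1 - g z * w)) \<partial>circ)"
proof -
  have 0: "integrable circ (\<lambda>z. f z * g z ^ n * w ^ n)" for n
  proof -
    have "integrable circ (\<lambda>z. g z ^ n * f z)"
      by (rule integrable_circ_mult_bounded[OF f, where C=1])
         (use g AE_circ_sphere in \<open>auto simp: norm_power intro!: borel_measurable_power\<close>)
    from integrable_mult_right[OF this, of "w^n"] show ?thesis by (simp add: mult_ac)
  qed
  have 1: "AE z in circ. summable (\<lambda>n. norm (f z * g z ^ n * w ^ n))"
    using AE_circ_sphere
  proof eventually_elim
    case (elim z)
    have "summable (\<lambda>n. norm (f z) * norm w ^ n)" using w by (intro summable_mult summable_geometric) auto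
    then show ?case using g(1)[OF elim] by (simp add: norm_mult norm_power)
  qed
  have "(\<integral>z. norm (f z * g z ^ n * w ^ n) \<partial>circ) = (\<integral>z. norm (f z) * norm w ^ n \<partial>circ)" for n
    by (rule Bochner_Integration.integral_cong) (auto simp: norm_mult norm_power g)
  then have 2: "summable (\<lambda>n. \<integral>z. norm (f z * g z ^ n * w ^ n) \<partial>circ)"
    using w by (simp add: summable_mult summable_geometric)
  have "(\<lambda>n. \<integral>z. f z * g z ^ n * w ^ n \<partial>circ) sums (\<integral>z. (\<Sum>n. f z * g z ^ n * w ^ n) \<partial>circ)"
    by (rule sums_integral[OF 0 1 2])
  also have "(\<integral>z. (\<Sum>n. f z * g z ^ n * w ^ n) \<partial>circ) = (\<integral>z. f z * (1 / (1 - g z * w)) \<partial>circ)"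
  proof (rule Bochner_Integration.integral_cong)
    fix z assume "z \<in> space circ"
    then have "norm (g z * w) < 1" using g w by (simp add: norm_mult)
    then have "(\<lambda>n. f z * (g z * w) ^ n) sums (f z * (1 / (1 - g z * w)))"
      by (intro sums_mult geometric_sums)
    then show "(\<Sum>n. f z * g z ^ n * w ^ n) = f z * (1 / (1 - g z * w))"
      by (simp add: power_mult_distrib mult_ac sums_iff)
  qed simp
  finally show ?thesis .
qed

lemma fourier_sums_cauchy:
  assumes f: "integrable circ f" and w: "norm w < 1"
  shows "(\<lambda>n. fourier f (int n) * w ^ n) sums (\<integral>z. f z * (z / (z - w)) \<partial>circ)"
proof -
  have "(\<lambda>n. \<integral>z. f z * inverse z ^ n * w ^ n \<partial>circ) sums (\<integral>z. f z * (1 / (1 - inverse z * w)) \<partial>circ)"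
    by (rule cauchy_sums_aux[OF f w])
       (auto simp: norm_inverse intro!: continuous_on_circ_measurable continuous_intros)
  also have "(\<integral>z. f z * (1 / (1 - inverse z * w)) \<partial>circ) = (\<integral>z. f z * (z / (z - w)) \<partial>circ)"
  proof (rule Bochner_Integration.integral_cong)
    fix z assume "z \<in> space circ"
    then have "z \<noteq> 0" "z - w \<noteq> 0" using w by auto
    then have "1 / (1 - inverse z * w) = z / (z - w)" by (simp add: divide_simps)
    then show "f z * (1 / (1 - inverse z * w)) = f z * (z / (z - w))" by simp
  qed simp
  also have "(\<lambda>n. \<integral>z. f z * inverse z ^ n * w ^ n \<partial>circ) = (\<lambda>n. fourier f (int n) * w ^ n)"
    by (auto simp: fourier_def power_int_minus power_inverse)
  finally show ?thesis .
qed

lemma fourier_sums_conj_cauchy: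
  assumes f: "integrable circ f" and w: "norm w < 1"
  shows "(\<lambda>n. fourier f (- int n) * cnj w ^ n) sums (\<integral>z. f z * (1 / (1 - cnj w * z)) \<partial>circ)"
proof -
  have "(\<lambda>n. \<integral>z. f z * z ^ n * cnj w ^ n \<partial>circ) sums (\<integral>z. f z * (1 / (1 - z * cnj w)) \<partial>circ)"
    by (rule cauchy_sums_aux[OF f]) (use w in auto)
  then show ?thesis by (simp add: fourier_def mult.commute)
qed

lemma ext_eq_cauchy:
  assumes "integrable circ f" "norm w < 1"
  shows "ext f w = (\<integral>z. f z * (z / (z - w)) \<partial>circ)"
  unfolding ext_def using fourier_sums_cauchy[OF assms] by (simp add: sums_iff)

lemma ext_sums:
  assumes "integrable circ f" "norm w < 1"
  shows "(\<lambda>n. fourier f (int n) * w ^ n) sums ext f w"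
  using fourier_sums_cauchy[OF assms] ext_eq_cauchy[OF assms] by simp

lemma ext_holomorphic:
  assumes "integrable circ f"
  shows "ext f holomorphic_on ball 0 1"
  by (rule power_series_holomorphic[where a="\<lambda>n. fourier f (int n)" and z=0])
     (use ext_sums[OF assms] in auto)

lemma ext_0: "ext f 0 = fourier f 0"
  by (simp add: ext_def)

section \<open>The Poisson and Herglotz kernels\<close>

definition poisson :: "complex \<Rightarrow> complex \<Rightarrow> real" where
  "poisson w z = (1 - (norm w)\<^sup>2) / (norm (z - w))\<^sup>2"

lemma poisson_nonneg: "norm w < 1 \<Longrightarrow> 0 \<le> poisson w z"
  unfolding poisson_def by (simp add: power_le_one abs_square_le_1)

lemma poisson_le:
  assumes "norm w < 1" "norm z = 1"
  shows "poisson w z \<le> 2 / (1 - norm w)"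
proof -
  have "poisson w z \<le> (1 - (norm w)\<^sup>2) / (1 - norm w)\<^sup>2"
    unfolding poisson_def using assms norm_diff_ge[OF assms]
    by (intro divide_left_mono power_mono mult_pos_pos zero_less_power) (auto simp: abs_square_le_1)
  also have "\<dots> = (1 + norm w) / (1 - norm w)"
  proof -
    have "1 - (norm w)\<^sup>2 = (1 + norm w) * (1 - norm w)" by (simp add: power2_eq_square algebra_simps)
    then show ?thesis using assms by (simp add: power2_eq_square)
  qed
  also have "\<dots> \<le> 2 / (1 - norm w)" using assms by (intro divide_right_mono) auto
  finally show ?thesis .
qed

lemma poisson_measurable [measurable]: "poisson w \<in> borel_measurable circ"
  unfolding poisson_def[abs_def] by measurable

text \<open>The first summand is the series of \<open>(w / z) ^ n\<close>, the second that of
  \<open>(cnj w * z) ^ n\<close>; the constant term is counted twice, hence the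
  \<open>- 1\<close>.\<close>

lemma poisson_decomp:
  assumes "norm w < 1" "norm z = 1"
  shows "of_real (poisson w z) = z / (z - w) + 1 / (1 - cnj w * z) - 1"
proof -
  have z: "z * cnj z = 1" using assms by (simp add: complex_norm_square[symmetric])
  then have z0: "z \<noteq> 0" by auto
  have ne: "z - w \<noteq> 0" using assms by auto
  have ne2: "1 - cnj w * z \<noteq> 0"
    using assms by (metis complex_mod_cnj diff_eq_diff_eq diff_self mult.right_neutral norm_mult norm_one order_less_irrefl right_minus_eq)
  have 1: "z * cnj (z - w) = 1 - cnj w * z" using z by (simp add: algebra_simps)
  have "of_real (poisson w z) = (1 - w * cnj w) / ((z - w) * cnj (z - w))"
    unfolding poisson_def by (simp only: of_real_divide of_real_diff of_real_1 complex_norm_square)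
  also have "\<dots> = (1 - w * cnj w) * z / ((z - w) * (1 - cnj w * z))"
    using z0 by (simp flip: 1)
  also have "\<dots> = z / (z - w) + 1 / (1 - cnj w * z) - 1"
  proof -
    have "(1 - w * cnj w) * z = z * (1 - cnj w * z) + (z - w) - (z - w) * (1 - cnj w * z)"
      by (simp add: algebra_simps)
    moreover have "(z * b + a - a * b) / (a * b) = z / a + 1 / b - 1" if "a \<noteq> 0" "b \<noteq> 0" for a b
      using that by (simp add: divide_simps)
    ultimately show ?thesis using ne ne2 by metis
  qed
  finally show ?thesis .
qed

lemma Re_herglotz_kernel:
  assumes "norm w < 1" "norm z = 1"
  shows "Re ((z + w) / (z - w)) = poisson w z"
proof -
  have z: "z * cnj z = 1" using assms by (simp add: complex_norm_square[symmetric])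
  have ne: "z - w \<noteq> 0" using assms by auto
  have "(z + w) / (z - w) = (z + w) * cnj (z - w) / of_real ((norm (z - w))\<^sup>2)"
    by (simp add: complex_div_cnj[of _ "z - w"])
  then have "Re ((z + w) / (z - w)) = Re ((z + w) * cnj (z - w)) / (norm (z - w))\<^sup>2"
    by (simp add: Re_divide_of_real)
  also have "Re ((z + w) * cnj (z - w)) = (norm z)\<^sup>2 - (norm w)\<^sup>2"
    unfolding cmod_power2 by (simp add: algebra_simps power2_eq_square)
  finally show ?thesis using assms by (simp add: poisson_def)
qed

lemma integrable_herglotz_kernel:
  assumes "integrable circ f" "norm w < 1"
  shows "integrable circ (\<lambda>z. (z + w) / (z - w) * f z)"
    and "integrable circ (\<lambda>z. z / (z - w) * f z)"
    and "integrable circ (\<lambda>z. 1 / (1 - cnj w * z) * f z)"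
proof -
  show "integrable circ (\<lambda>z. (z + w) / (z - w) * f z)"
  proof (rule integrable_circ_mult_bounded[OF assms(1), where C="2 / (1 - norm w)"])
    show "AE z in circ. norm ((z + w) / (z - w)) \<le> 2 / (1 - norm w)"
      using AE_circ_sphere
    proof eventually_elim
      case (elim z)
      have "norm (z + w) \<le> 2" using norm_triangle_ineq[of z w] elim assms by simp
      then show ?case using norm_diff_ge[OF assms(2) elim] assms(2)
        by (auto simp: norm_divide intro!: frac_le)
    qed
  qed measurable
  show "integrable circ (\<lambda>z. z / (z - w) * f z)"
  proof (rule integrable_circ_mult_bounded[OF assms(1), where C="1 / (1 - norm w)"])
    show "AE z in circ. norm (z / (z - w)) \<le> 1 / (1 - norm w)"
      using AE_circ_sphere
    proof eventually_elim
      case (elim z)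
      then show ?case using norm_diff_ge[OF assms(2) elim] assms(2)
        by (auto simp: norm_divide intro!: frac_le)
    qed
  qed measurable
  show "integrable circ (\<lambda>z. 1 / (1 - cnj w * z) * f z)"
  proof (rule integrable_circ_mult_bounded[OF assms(1), where C="1 / (1 - norm w)"])
    show "AE z in circ. norm (1 / (1 - cnj w * z)) \<le> 1 / (1 - norm w)"
      using AE_circ_sphere
    proof eventually_elim
      case (elim z)
      have "norm (1 - cnj w * z) \<ge> 1 - norm w"
        using norm_triangle_ineq2[of 1 "cnj w * z"] elim by (simp add: norm_mult)
      then show ?case using assms(2)
        by (auto simp: norm_divide intro!: frac_le)
    qed
  qed measurable
qed

lemma integrable_poisson:
  fixes f :: "complex \<Rightarrow> 'b::{banach, second_countable_topology, real_normed_algebra_1}"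
  assumes "integrable circ f" "norm w < 1"
  shows "integrable circ (\<lambda>z. of_real (poisson w z) * f z)"
proof (rule integrable_circ_mult_bounded[OF assms(1), where C="2 / (1 - norm w)"])
  show "AE z in circ. norm (of_real (poisson w z) :: 'b) \<le> 2 / (1 - norm w)"
    using AE_circ_sphere by eventually_elim (use poisson_le[OF assms(2)] poisson_nonneg[OF assms(2)] in auto)
qed measurable

text \<open>For \<open>f\<close> in \<open>H1\<close> the conjugate Cauchy kernel sees only the
  zeroth coefficient, which the \<open>- 1\<close> of \<open>poisson_decomp\<close> cancels; what is
  left is the Cauchy integral.\<close>

lemma ext_eq_poisson:
  assumes f: "f \<in> H1" and w: "norm w < 1"
  shows "ext f w = (\<integral>z. of_real (poisson w z) * f z \<partial>circ)"
proof -
  have i: "integrable circ f" and neg: "\<And>n. n < 0 \<Longrightarrow> fourier f n = 0"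
    using f by (auto simp: H1_def)
  have "(\<lambda>n. fourier f (- int n) * cnj w ^ n) sums fourier f 0"
  proof -
    have "(\<lambda>n. fourier f (- int n) * cnj w ^ n) = (\<lambda>n. if n = 0 then fourier f 0 else 0)"
      by (auto simp: neg fun_eq_iff)
    then show ?thesis using sums_single[of 0 "\<lambda>n. fourier f 0"] by simp
  qed
  then have 1: "(\<integral>z. 1 / (1 - cnj w * z) * f z \<partial>circ) = (\<integral>z. f z \<partial>circ)"
    using sums_unique2[OF fourier_sums_conj_cauchy[OF i w]] by (simp add: fourier_def mult.commute)
  have "(\<integral>z. of_real (poisson w z) * f z \<partial>circ) = (\<integral>z. z / (z - w) * f z + 1 / (1 - cnj w * z) * f z - f z \<partial>circ)"
    by (rule Bochner_Integration.integral_cong)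
       (auto simp: poisson_decomp[OF w] algebra_simps)
  also have "\<dots> = (\<integral>z. z / (z - w) * f z \<partial>circ)"
    using integrable_herglotz_kernel[OF i w] i
    by (simp only: Bochner_Integration.integral_diff Bochner_Integration.integral_add
          Bochner_Integration.integrable_add 1 simp_thms) simp
  also have "\<dots> = ext f w" by (simp add: ext_eq_cauchy[OF i w] mult.commute)
  finally show ?thesis by simp
qed

lemma const_H1: "(\<lambda>_. c) \<in> H1"
proof -
  have "fourier (\<lambda>_. c) n = 0" if "n < 0" for n
    using integral_circ_powi[of "-n"] that by (simp add: fourier_def)
  then show ?thesis by (simp add: H1_def)
qed

lemma integral_poisson:
  assumes w: "norm w < 1"
  shows "(\<integral>z. poisson w z \<partial>circ) = 1"
proof -
  have "ext (\<lambda>_. 1) w = 1"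
  proof -
    have "fourier (\<lambda>_. 1) (int n) = (if n = 0 then 1 else 0)" for n
      using integral_circ_powi[of "- int n"] by (simp add: fourier_def)
    then have "(\<lambda>n. fourier (\<lambda>_. 1) (int n) * w ^ n) = (\<lambda>n. if n = 0 then 1 else 0)"
      by (auto simp: fun_eq_iff)
    then show ?thesis unfolding ext_def using suminf_split_head sums_single[of 0 "\<lambda>_. 1::complex"]
      by (simp add: sums_iff)
  qed
  then have "(\<integral>z. complex_of_real (poisson w z) \<partial>circ) = 1"
    using ext_eq_poisson[OF const_H1 w, of 1] by simp
  then show ?thesis by (metis integral_complex_of_real of_real_eq_1_iff)
qed

text \<open>From \<open>(z + w) / (z - w) = 2 z / (z - w) - 1\<close>. Holomorphy of Herglotz
  integrals is thereby inherited from the power series \<open>ext\<close>, without differentiating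
  under the integral.\<close>

lemma herglotz_eq_ext:
  assumes f: "integrable circ f" and w: "norm w < 1"
  shows "(\<integral>z. (z + w) / (z - w) * f z \<partial>circ) = 2 * ext f w - fourier f 0"
proof -
  have "(\<integral>z. (z + w) / (z - w) * f z \<partial>circ) = (\<integral>z. 2 * (z / (z - w) * f z) - f z \<partial>circ)"
  proof (rule Bochner_Integration.integral_cong)
    fix z assume "z \<in> space circ"
    then have "z - w \<noteq> 0" using w by auto
    then show "(z + w) / (z - w) * f z = 2 * (z / (z - w) * f z) - f z"
      by (simp add: field_simps)
  qed simp
  also have "\<dots> = 2 * (\<integral>z. z / (z - w) * f z \<partial>circ) - (\<integral>z. f z \<partial>circ)"
    using integrable_herglotz_kernel(2)[OF f w] f
    by (simp only: Bochner_Integration.integral_diff integrable_mult_right integral_mult_right_zero simp_thms)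
  finally show ?thesis by (simp add: ext_eq_cauchy[OF f w] fourier_def mult.commute)
qed

lemma herglotz_holomorphic:
  assumes f: "integrable circ f"
  shows "(\<lambda>w. \<integral>z. (z + w) / (z - w) * f z \<partial>circ) holomorphic_on ball 0 1"
proof -
  have "(\<lambda>w. 2 * ext f w - fourier f 0) holomorphic_on ball 0 1"
    using ext_holomorphic[OF f] by (intro holomorphic_intros)
  then show ?thesis
    by (rule holomorphic_cong[THEN iffD1, rotated -1])
       (simp_all only: herglotz_eq_ext[OF f] mem_ball_0)
qed

lemma Re_herglotz:
  assumes u: "integrable circ u" and w: "norm w < 1"
  shows "Re (\<integral>z. (z + w) / (z - w) * of_real (u z) \<partial>circ) = (\<integral>z. poisson w z * u z \<partial>circ)"
proof -
  have "integrable circ (\<lambda>z. (z + w) / (z - w) * of_real (u z))"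
    by (rule integrable_herglotz_kernel[OF _ w]) (use u in simp)
  then have "Re (\<integral>z. (z + w) / (z - w) * of_real (u z) \<partial>circ) = (\<integral>z. Re ((z + w) / (z - w) * of_real (u z)) \<partial>circ)"
    by simp
  also have "\<dots> = (\<integral>z. poisson w z * u z \<partial>circ)"
  proof (rule Bochner_Integration.integral_cong)
    fix z assume "z \<in> space circ"
    then have "Re ((z + w) / (z - w)) = poisson w z" using Re_herglotz_kernel[OF w] by simp
    then show "Re ((z + w) / (z - w) * of_real (u z)) = poisson w z * u z"
      by (simp only: times_complex.sel Re_complex_of_real Im_complex_of_real)
  qed simp
  finally show ?thesis .
qed

section \<open>Fatou's theorem\<close>

lemma le_tan:
  fixes y :: real
  assumes "0 \<le> y" "y < pi/2"
  shows "y \<le> tan y"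
proof -
  have "tan 0 - 0 \<le> tan y - y"
  proof (rule DERIV_nonneg_imp_nondecreasing[OF assms(1)])
    fix x assume x: "0 \<le> x" "x \<le> y"
    then have c: "cos x > 0" using assms by (intro cos_gt_zero_pi) auto
    have "((\<lambda>y. tan y - y) has_real_derivative (inverse ((cos x)\<^sup>2) - 1)) (at x)"
      using c by (auto intro!: derivative_eq_intros)
    moreover have "inverse ((cos x)\<^sup>2) - 1 \<ge> 0"
    proof -
      have "(cos x)\<^sup>2 \<le> 1" by (simp add: abs_square_le_1)
      then show ?thesis using c by (simp add: one_le_inverse)
    qed
    ultimately show "\<exists>z. ((\<lambda>y. tan y - y) has_real_derivative z) (at x) \<and> 0 \<le> z" by blast
  qed
  then show ?thesis by simp
qed

lemma norm_one_minus_cis: "norm (1 - cis t) = 2 * \<bar>sin (t / 2)\<bar>"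
proof -
  have "cos t = 1 - 2 * (sin (t/2))\<^sup>2"
    using cos_double_sin[of "t/2"] by simp
  then have "(norm (1 - cis t))\<^sup>2 = (2 * \<bar>sin (t / 2)\<bar>)\<^sup>2"
    using sin_cos_squared_add[of t] unfolding cmod_power2
    by (simp add: power2_eq_square algebra_simps)
  then show ?thesis by (rule power2_eq_imp_eq) auto
qed

text \<open>With \<open>y = |t| / 2\<close> the chord is \<open>2 sin y\<close>. A chord below 1
  forces \<open>cos y >= 1/2\<close>, so \<open>y <= tan y <= 2 sin y < s\<close>.\<close>

lemma abs_angle_less_of_chord:
  assumes t: "\<bar>t\<bar> < pi" and s: "norm (1 - cis t) < s" "s \<le> 1"
  shows "\<bar>t\<bar> < 2 * s"
proof -
  define y where "y = \<bar>t\<bar> / 2"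
  have y: "0 \<le> y" "y < pi / 2" using t by (auto simp: y_def)
  then have sp: "sin y \<ge> 0" and cp: "cos y > 0" by (auto intro!: sin_ge_zero cos_gt_zero_pi)
  have "\<bar>sin (t/2)\<bar> = sin y" using sp by (cases "t \<ge> 0") (auto simp: y_def)
  then have sy: "2 * sin y < s" using s norm_one_minus_cis[of t] by simp
  then have "sin y < 1/2" using s by simp
  then have "(sin y)\<^sup>2 \<le> (1/2)\<^sup>2" using sp by (intro power_mono) auto
  then have "(cos y)\<^sup>2 \<ge> (1/2)\<^sup>2" using sin_cos_squared_add[of y] by (simp add: power2_eq_square)
  then have c2: "cos y \<ge> 1/2" using cp by (meson less_eq_real_def power2_le_imp_le)
  have "y \<le> sin y / cos y" using le_tan[OF y] by (simp add: tan_def)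
  also have "\<dots> \<le> sin y / (1/2)" using sp c2 by (intro divide_left_mono) auto
  finally show ?thesis using sy by (simp add: y_def)
qed

lemma ball_sets_circ [measurable]: "ball x s \<inter> sphere 0 1 \<in> sets circ"
  by (auto simp: sets_circ sets_restrict_space)

text \<open>For \<open>s <= 1\<close> the ball lies in the angles \<open>|t| <= 2 s\<close>, of
  normalised length \<open>4 s / (2 pi)\<close>, and \<open>pi >= 2\<close>; for larger
  \<open>s\<close> total mass 1 is enough.\<close>

lemma emeasure_circ_ball_le:
  assumes x: "x \<in> sphere 0 1" and s: "0 < s"
  shows "emeasure circ (ball x s \<inter> sphere 0 1) \<le> ennreal s"
proof (cases "s \<le> 1")
  case False
  have "emeasure circ (ball x s \<inter> sphere 0 1) \<le> 1"
    by (rule circ.emeasure_le_1)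
  also have "1 \<le> ennreal s" using False by simp
  finally show ?thesis .
next
  case True
  have m: "(indicator (ball x s \<inter> sphere 0 1) :: complex \<Rightarrow> ennreal) \<in> borel_measurable circ"
    by measurable
  have "emeasure circ (ball x s \<inter> sphere 0 1) = (\<integral>\<^sup>+z. indicator (ball x s \<inter> sphere 0 1) z \<partial>circ)"
    by simp
  also have "\<dots> = (\<integral>\<^sup>+t. indicator (ball x s \<inter> sphere 0 1) (x * cis (- t)) * indicator {-pi<..<pi} t \<partial>lborel) / ennreal (2*pi)"
    by (rule nn_integral_circ_rotate[OF m x])
  also have "\<dots> \<le> (\<integral>\<^sup>+t. indicator {- (2 * s) .. 2 * s} t \<partial>lborel) / ennreal (2*pi)"
  proof (intro divide_right_mono_ennreal nn_integral_mono)
    fix t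
    show "indicator (ball x s \<inter> sphere 0 1) (x * cis (- t)) * indicator {-pi<..<pi} t \<le> (indicator {- (2 * s) .. 2 * s} t :: ennreal)"
    proof (cases "x * cis (- t) \<in> ball x s \<and> t \<in> {-pi<..<pi}")
      case t: True
      have "x - x * cis (- t) = x * (1 - cis (- t))" by (simp add: algebra_simps)
      then have "dist x (x * cis (- t)) = norm (1 - cis (- t))" using x by (simp add: dist_norm norm_mult)
      then have "\<bar>-t\<bar> < 2 * s" using t True by (intro abs_angle_less_of_chord) auto
      then have "t \<in> {- (2 * s) .. 2 * s}" by auto
      then show ?thesis by (simp add: indicator_def)
    qed (auto simp: indicator_def)
  qed
  also have "\<dots> = ennreal (4 * s) / ennreal (2*pi)"
    using s by simp
  also have "\<dots> = ennreal (4 * s / (2*pi))" using s by (subst divide_ennreal) auto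
  also have "\<dots> \<le> ennreal s"
  proof (rule ennreal_leI)
    have "2 * s \<le> pi * s" using pi_ge_two s by (intro mult_right_mono) auto
    then show "4 * s / (2*pi) \<le> s" using pi_gt_zero by (simp add: field_simps)
  qed
  finally show ?thesis .
qed

text \<open>Weak type (1,1) of the Hardy-Littlewood maximal function, by Vitali covering; the 5 is
  the dilation factor of the covering lemma. A measurable superset \<open>B\<close> is returned, so
  measurability of the level set itself is never at issue.\<close>

lemma maximal_weak_type:
  fixes g :: "complex \<Rightarrow> ennreal"
  assumes [measurable]: "g \<in> borel_measurable circ" and G: "(\<integral>\<^sup>+z. g z \<partial>circ) \<le> ennreal G" and l: "0 < l"
  shows "\<exists>B\<in>sets circ. {x \<in> sphere 0 1. \<exists>s>0. (\<integral>\<^sup>+z. g z * indicator (ball x s) z \<partial>circ) > ennreal (l * s)} \<subseteq> B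
          \<and> emeasure circ B \<le> ennreal (5 * G / l)"
proof -
  have [measurable]: "ball x s \<inter> sphere 0 1 \<in> sets (restrict_space borel (sphere 0 1))" for x :: complex and s
    using ball_sets_circ by (simp add: sets_circ)
  have mb[measurable]: "(indicator (ball x s) :: complex \<Rightarrow> ennreal) \<in> borel_measurable circ" for x s
    by (intro borel_measurable_circI borel_measurable_indicator) simp
  define A where "A = {x \<in> sphere 0 1. \<exists>s>0. (\<integral>\<^sup>+z. g z * indicator (ball x s) z \<partial>circ) > ennreal (l * s)}"
  obtain r where r: "\<And>x. x \<in> A \<Longrightarrow> r x > 0 \<and> (\<integral>\<^sup>+z. g z * indicator (ball x (r x)) z \<partial>circ) > ennreal (l * r x)"
  proof -
    have "\<forall>x\<in>A. \<exists>s. s > 0 \<and> (\<integral>\<^sup>+z. g z * indicator (ball x s) z \<partial>circ) > ennreal (l * s)"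
      by (simp add: A_def)
    from bchoice[OF this] show ?thesis using that by blast
  qed
  \<comment> \<open>Vitali's lemma asks for uniformly bounded radii; the total mass \<open>G\<close>
    provides the bound.\<close>
  have rb: "0 < r x \<and> r x \<le> G / l" if "x \<in> A" for x
  proof -
    have "ennreal (l * r x) < (\<integral>\<^sup>+z. g z * indicator (ball x (r x)) z \<partial>circ)" using r that by auto
    also have "\<dots> \<le> (\<integral>\<^sup>+z. g z \<partial>circ)" by (intro nn_integral_mono) (auto simp: indicator_def)
    also have "\<dots> \<le> ennreal G" by fact
    finally have "l * r x < G" using l r[OF that] by (simp add: ennreal_less_iff)
    then show ?thesis using l r[OF that] by (simp add: field_simps)
  qed
  have "A \<subseteq> (\<Union>i\<in>A. ball i (r i))" using rb by auto
  obtain C where C: "countable C" "C \<subseteq> A"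
     "pairwise (\<lambda>i j. disjnt (ball i (r i)) (ball j (r j))) C"
     "A \<subseteq> (\<Union>i\<in>C. ball i (5 * r i))"
    using Vitali_covering_lemma_balls[OF \<open>A \<subseteq> _\<close> rb] .
  define B where "B = (\<Union>i\<in>C. ball i (5 * r i) \<inter> sphere 0 1)"
  have Bs: "B \<in> sets circ" unfolding B_def using C(1) ball_sets_circ by (intro sets.countable_UN') auto
  have AB: "A \<subseteq> B" using C(4) unfolding B_def A_def by auto
  \<comment> \<open>Sums over the countable family \<open>C\<close> are integrals against
    \<open>count_space\<close>, so that they can be interchanged with the integral over the circle.
    Disjointness then lets at most one ball contribute at each \<open>z\<close>.\<close>
  have "(\<integral>\<^sup>+i. (\<integral>\<^sup>+z. g z * indicator (ball i (r i)) z \<partial>circ) \<partial>count_space C)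
       = (\<integral>\<^sup>+z. (\<integral>\<^sup>+i. g z * indicator (ball i (r i)) z \<partial>count_space C) \<partial>circ)"
    using C(1) by (intro nn_integral_count_space_nn_integral[symmetric]) auto
  also have "\<dots> \<le> (\<integral>\<^sup>+z. g z \<partial>circ)"
  proof (intro nn_integral_mono)
    fix z
    show "(\<integral>\<^sup>+i. g z * indicator (ball i (r i)) z \<partial>count_space C) \<le> g z"
    proof (cases "\<exists>j\<in>C. z \<in> ball j (r j)")
      case True
      then obtain j where j: "j \<in> C" "z \<in> ball j (r j)" by auto
      have "(\<integral>\<^sup>+i. g z * indicator (ball i (r i)) z \<partial>count_space C) \<le> (\<integral>\<^sup>+i. g z * indicator {j} i \<partial>count_space C)"
      proof (intro nn_integral_mono)
        fix i assume "i \<in> space (count_space C)"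
        then have "i \<in> C" by simp
        then have "disjnt (ball i (r i)) (ball j (r j))" if "i \<noteq> j"
          using C(3) j(1) that by (auto dest: pairwiseD)
        then have "z \<in> ball i (r i) \<Longrightarrow> i = j" using j(2) by (meson disjnt_iff)
        then show "g z * indicator (ball i (r i)) z \<le> g z * indicator {j} i"
          by (cases "z \<in> ball i (r i)") simp_all
      qed
      also have "\<dots> = g z * (\<integral>\<^sup>+i. indicator {j} i \<partial>count_space C)"
        by (rule nn_integral_cmult) simp
      also have "(\<integral>\<^sup>+i. indicator {j} i \<partial>count_space C) = (1 :: ennreal)" using j(1) by simp
      also have "g z * 1 = g z" by simp
      finally show ?thesis .
    next
      case False
      then have "(\<integral>\<^sup>+i. g z * indicator (ball i (r i)) z \<partial>count_space C) = (\<integral>\<^sup>+i. 0 \<partial>count_space C)"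
        by (intro nn_integral_cong) (auto simp: indicator_def)
      then show ?thesis by simp
    qed
  qed
  also have "\<dots> \<le> ennreal G" by fact
  finally have inner: "(\<integral>\<^sup>+i. (\<integral>\<^sup>+z. g z * indicator (ball i (r i)) z \<partial>circ) \<partial>count_space C) \<le> ennreal G" .
  have "emeasure circ B = (\<integral>\<^sup>+z. indicator B z \<partial>circ)" using Bs by simp
  also have "\<dots> \<le> (\<integral>\<^sup>+z. \<integral>\<^sup>+i. indicator (ball i (5 * r i) \<inter> sphere 0 1) z \<partial>count_space C \<partial>circ)"
  proof (intro nn_integral_mono)
    fix z
    show "indicator B z \<le> (\<integral>\<^sup>+i. indicator (ball i (5 * r i) \<inter> sphere 0 1) z \<partial>count_space C)"
    proof (cases "z \<in> B")
      case True
      then obtain j where j: "j \<in> C" "z \<in> ball j (5 * r j) \<inter> sphere 0 1" unfolding B_def by auto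
      have "1 = (\<integral>\<^sup>+i. indicator {j} i \<partial>count_space C)" using j(1) by simp
      also have "\<dots> \<le> (\<integral>\<^sup>+i. indicator (ball i (5 * r i) \<inter> sphere 0 1) z \<partial>count_space C)"
        using j by (intro nn_integral_mono) (auto simp: indicator_def)
      finally show ?thesis using True by simp
    qed simp
  qed
  also have "\<dots> = (\<integral>\<^sup>+i. \<integral>\<^sup>+z. indicator (ball i (5 * r i) \<inter> sphere 0 1) z \<partial>circ \<partial>count_space C)"
    using C(1) by (intro nn_integral_count_space_nn_integral) auto
  also have "\<dots> \<le> (\<integral>\<^sup>+i. ennreal (5 / l) * (\<integral>\<^sup>+z. g z * indicator (ball i (r i)) z \<partial>circ) \<partial>count_space C)"
  proof (intro nn_integral_mono)
    fix i assume "i \<in> space (count_space C)"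
    then have i: "i \<in> A" "i \<in> sphere 0 1" using C(2) by (auto simp: A_def)
    have "(\<integral>\<^sup>+z. indicator (ball i (5 * r i) \<inter> sphere 0 1) z \<partial>circ) \<le> ennreal (5 * r i)"
      using emeasure_circ_ball_le[OF i(2), of "5 * r i"] rb[OF i(1)] by simp
    also have "\<dots> = ennreal (5 / l) * ennreal (l * r i)"
      using l rb[OF i(1)] by (subst ennreal_mult[symmetric]) auto
    also have "\<dots> \<le> ennreal (5 / l) * (\<integral>\<^sup>+z. g z * indicator (ball i (r i)) z \<partial>circ)"
      using r[OF i(1)] by (intro mult_left_mono) auto
    finally show "(\<integral>\<^sup>+z. indicator (ball i (5 * r i) \<inter> sphere 0 1) z \<partial>circ) \<le> \<dots>" .
  qed
  also have "\<dots> = ennreal (5 / l) * (\<integral>\<^sup>+i. (\<integral>\<^sup>+z. g z * indicator (ball i (r i)) z \<partial>circ) \<partial>count_space C)"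
    by (rule nn_integral_cmult) simp
  also have "\<dots> \<le> ennreal (5 / l) * ennreal G"
    by (rule mult_left_mono[OF inner]) simp
  also have "\<dots> = ennreal (5 * G / l)"
    using l by (subst ennreal_mult'[symmetric]) auto
  finally show ?thesis using Bs AB unfolding A_def by blast
qed

section \<open>Poisson means controlled by the maximal function\<close>

lemma norm_diff_radial_ge:
  assumes x: "norm x = 1" and r: "0 \<le> r" "r < 1" and z: "norm z = (1::real)"
  shows "1 - r \<le> norm (z - of_real r * x)" "norm (z - x) \<le> 2 * norm (z - of_real r * x :: complex)"
proof -
  show 1: "1 - r \<le> norm (z - of_real r * x)"
    using norm_triangle_ineq2[of z "of_real r * x"] assms by (simp add: norm_mult)
  have "x - of_real r * x = of_real (1 - r) * x" by (simp add: algebra_simps)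
  then have "norm (x - of_real r * x) = 1 - r" using x r by (simp add: norm_mult del: of_real_diff)
  then have "norm (z - x) \<le> norm (z - of_real r * x) + (1 - r)"
    using norm_triangle_ineq4[of "z - of_real r * x" "x - of_real r * x"] by simp
  then show "norm (z - x) \<le> 2 * norm (z - of_real r * x)" using 1 by simp
qed

lemma poisson_radial_le:
  assumes x: "norm x = 1" and r: "0 \<le> r" "r < 1" and z: "norm z = 1"
  shows "poisson (of_real r * x) z \<le> 2 * (1 - r) / (norm (z - of_real r * x))\<^sup>2"
proof -
  have "1 - r\<^sup>2 = (1 + r) * (1 - r)" by (simp add: power2_eq_square algebra_simps)
  also have "\<dots> \<le> 2 * (1 - r)" using r by (intro mult_right_mono) auto
  finally show ?thesis unfolding poisson_def using x r
    by (intro divide_right_mono) (auto simp: norm_mult)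
qed

text \<open>One term of the series is enough: the least \<open>k\<close> with
  \<open>|z - x| < 2 ^ k (1 - r)\<close>. For \<open>k = Suc j\<close> minimality gives
  \<open>|z - r x| >= 2 ^ j (1 - r) / 2\<close>, and \<open>2 (1 - r)\<close> over the square of
  this is \<open>32 / ((1 - r) 4 ^ k)\<close>.\<close>

lemma poisson_le_dyadic:
  assumes x: "norm x = 1" and r: "0 \<le> r" "r < 1" and z: "norm z = 1"
  shows "ennreal (poisson (of_real r * x) z) \<le> (\<Sum>k. ennreal (32 / ((1 - r) * 4 ^ k)) * indicator (ball x (2 ^ k * (1 - r))) z)"
proof -
  define e where "e = 1 - r"
  define d where "d = norm (z - x)"
  define D where "D = norm (z - of_real r * x)"
  have e: "e > 0" using r by (simp add: e_def)
  have D: "e \<le> D" "d \<le> 2 * D"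
    using norm_diff_radial_ge[OF x r z] by (auto simp: e_def d_def D_def)
  have P: "poisson (of_real r * x) z \<le> 2 * e / D\<^sup>2"
    using poisson_radial_le[OF x r z] by (simp add: e_def D_def)
  obtain n where "d / e < 2 ^ n" using real_arch_pow[of 2] by auto
  then have ex: "\<exists>k. d < 2 ^ k * e" using e by (auto simp: field_simps)
  define k where "k = (LEAST k. d < 2 ^ k * e)"
  have k: "d < 2 ^ k * e" using LeastI_ex[OF ex] by (simp add: k_def)
  have main: "poisson (of_real r * x) z \<le> 32 / (e * 4 ^ k)"
  proof (cases k)
    case 0
    have "2 * e / D\<^sup>2 \<le> 2 * e / e\<^sup>2" using D e by (intro divide_left_mono power_mono) auto
    also have "\<dots> = 2 / e" using e by (simp add: power2_eq_square)
    also have "\<dots> \<le> 32 / e" using e by (intro divide_right_mono) auto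
    finally show ?thesis using P 0 by simp
  next
    case (Suc j)
    have "\<not> d < 2 ^ j * e" using not_less_Least[of j "\<lambda>k. d < 2 ^ k * e"] Suc by (simp add: k_def)
    then have "2 ^ j * e / 2 \<le> D" using D by simp
    then have "2 * e / D\<^sup>2 \<le> 2 * e / (2 ^ j * e / 2)\<^sup>2"
      using D e by (intro divide_left_mono power_mono) auto
    also have "\<dots> = 32 / (e * 4 ^ k)"
    proof -
      have "((2::real) ^ j)\<^sup>2 = 4 ^ j" by (simp add: power_mult[symmetric] mult.commute[of j] power_mult)
      then show ?thesis using e Suc by (simp add: power_divide power_mult_distrib power2_eq_square)
    qed
    finally show ?thesis using P by simp
  qed
  define F :: "nat \<Rightarrow> ennreal" where "F k = ennreal (32 / (e * 4 ^ k)) * indicator (ball x (2 ^ k * e)) z" for k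
  have "ennreal (poisson (of_real r * x) z) \<le> F k"
    unfolding F_def using main k by (simp add: d_def dist_norm norm_minus_commute ennreal_leI)
  also have "\<dots> \<le> (\<Sum>k. F k)"
    using sum_le_suminf[of F "{k}"] by simp
  finally show ?thesis by (simp add: e_def F_def)
qed

text \<open>The dyadic ball of index \<open>k\<close> contributes at most
  \<open>32 l / 2 ^ k\<close>: its weight decays like \<open>4 ^ k\<close> while its mass grows only
  like \<open>2 ^ k\<close>. The sum is \<open>64 l\<close>.\<close>

lemma poisson_maximal:
  fixes g :: "complex \<Rightarrow> ennreal"
  assumes [measurable]: "g \<in> borel_measurable circ" and x: "norm x = 1" and r: "0 \<le> r" "r < 1" and l: "0 < l"
    and M: "\<And>s. s > 0 \<Longrightarrow> (\<integral>\<^sup>+z. g z * indicator (ball x s) z \<partial>circ) \<le> ennreal (l * s)"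
  shows "(\<integral>\<^sup>+z. ennreal (poisson (of_real r * x) z) * g z \<partial>circ) \<le> ennreal (64 * l)"
proof -
  have mb[measurable]: "(indicator (ball x s) :: complex \<Rightarrow> ennreal) \<in> borel_measurable circ" for x s
    by (intro borel_measurable_circI borel_measurable_indicator) simp
  have "(\<integral>\<^sup>+z. ennreal (poisson (of_real r * x) z) * g z \<partial>circ)
      \<le> (\<integral>\<^sup>+z. (\<Sum>k. ennreal (32 / ((1 - r) * 4 ^ k)) * (g z * indicator (ball x (2 ^ k * (1 - r))) z)) \<partial>circ)"
  proof (intro nn_integral_mono)
    fix z assume "z \<in> space circ"
    then have "ennreal (poisson (of_real r * x) z) \<le> (\<Sum>k. ennreal (32 / ((1 - r) * 4 ^ k)) * indicator (ball x (2 ^ k * (1 - r))) z)"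
      using poisson_le_dyadic[OF x r] by simp
    then have "ennreal (poisson (of_real r * x) z) * g z \<le> (\<Sum>k. ennreal (32 / ((1 - r) * 4 ^ k)) * indicator (ball x (2 ^ k * (1 - r))) z) * g z"
      by (rule mult_right_mono) simp
    then show "ennreal (poisson (of_real r * x) z) * g z \<le> (\<Sum>k. ennreal (32 / ((1 - r) * 4 ^ k)) * (g z * indicator (ball x (2 ^ k * (1 - r))) z))"
      by (simp add: mult_ac flip: ennreal_suminf_cmult)
  qed
  also have "\<dots> = (\<Sum>k. ennreal (32 / ((1 - r) * 4 ^ k)) * (\<integral>\<^sup>+z. g z * indicator (ball x (2 ^ k * (1 - r))) z \<partial>circ))"
    by (subst nn_integral_suminf) (auto simp: nn_integral_cmult)
  also have "\<dots> \<le> (\<Sum>k. ennreal (32 * l * (1/2) ^ k))"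
  proof (rule suminf_le)
    fix k
    have "ennreal (32 / ((1 - r) * 4 ^ k)) * (\<integral>\<^sup>+z. g z * indicator (ball x (2 ^ k * (1 - r))) z \<partial>circ)
        \<le> ennreal (32 / ((1 - r) * 4 ^ k)) * ennreal (l * (2 ^ k * (1 - r)))"
      using r by (intro mult_left_mono M) auto
    also have "\<dots> = ennreal (32 / ((1 - r) * 4 ^ k) * (l * (2 ^ k * (1 - r))))"
      using r l by (subst ennreal_mult) auto
    also have "32 / ((1 - r) * 4 ^ k) * (l * (2 ^ k * (1 - r))) = 32 * l * (1/2) ^ k"
    proof -
      have "(4::real) ^ k = 2 ^ k * 2 ^ k" by (simp flip: power_mult_distrib)
      then show ?thesis using r by (simp add: power_divide)
    qed
    finally show "ennreal (32 / ((1 - r) * 4 ^ k)) * (\<integral>\<^sup>+z. g z * indicator (ball x (2 ^ k * (1 - r))) z \<partial>circ) \<le> \<dots>" .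
  qed auto
  also have "\<dots> = ennreal (64 * l)"
  proof -
    have "(\<lambda>k. 32 * l * (1/2) ^ k) sums (32 * l * (1 / (1 - 1/2)))"
      by (intro sums_mult geometric_sums) auto
    then show ?thesis using l by (intro suminf_ennreal_eq) auto
  qed
  finally show ?thesis .
qed

lemma AE_notin_of_small_cover:
  assumes "\<And>e. e > 0 \<Longrightarrow> \<exists>B\<in>sets M. A \<subseteq> B \<and> emeasure M B \<le> ennreal e"
  shows "AE x in M. x \<notin> A"
proof -
  have "\<forall>n. \<exists>B\<in>sets M. A \<subseteq> B \<and> emeasure M B \<le> ennreal (1 / Suc n)" using assms by simp
  then obtain B where B: "\<And>n. B n \<in> sets M" "\<And>n. A \<subseteq> B n" "\<And>n. emeasure M (B n) \<le> ennreal (1 / Suc n)"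
    by metis
  have "emeasure M (\<Inter>n. B n) \<le> ennreal (1 / Suc n)" for n
    using B(3)[of n] emeasure_mono[of "\<Inter>n. B n" "B n" M] B(1) by (meson INT_lower UNIV_I order_trans)
  moreover have "(\<lambda>n. ennreal (1 / Suc n)) \<longlonglongrightarrow> ennreal 0"
    by (intro tendsto_ennrealI LIMSEQ_Suc[OF lim_1_over_n])
  ultimately have "emeasure M (\<Inter>n. B n) \<le> ennreal 0"
    by (intro LIMSEQ_le_const) auto
  then have "(\<Inter>n. B n) \<in> null_sets M" using B(1) by (intro null_setsI) auto
  then show ?thesis using B(2) by (intro AE_I'[of "\<Inter>n. B n"]) auto
qed

text \<open>Outer regularity of the finite Borel measure with density \<open>g\<close>, for which
  \<open>E\<close> is a null set.\<close>

lemma open_cover_small_integral: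
  fixes g :: "complex \<Rightarrow> real"
  assumes g: "integrable circ g" "\<And>z. 0 \<le> g z" and E: "E \<in> sets circ" "\<And>z. z \<in> E \<Longrightarrow> g z = 0" and e: "e > 0"
  shows "\<exists>U. open U \<and> E \<subseteq> U \<and> (\<integral>\<^sup>+z. ennreal (g z) * indicator U z \<partial>circ) \<le> ennreal e"
proof -
  have [measurable]: "g \<in> borel_measurable circ" using g by simp
  have gf: "(\<integral>\<^sup>+z. ennreal (g z) \<partial>circ) < \<infinity>"
    using g by (simp add: integrable_iff_bounded)
  have idm[measurable]: "(\<lambda>z. z) \<in> measurable circ borel" by (rule borel_measurable_circI) simp
  define N where "N = distr (density circ g) borel (\<lambda>z. z)"
  have sN: "sets N = sets borel" by (simp add: N_def)
  have eN: "emeasure N U = (\<integral>\<^sup>+z. ennreal (g z) * indicator U z \<partial>circ)" if "U \<in> sets borel" for U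
  proof -
    have "U \<inter> sphere 0 1 \<in> sets circ" using that by (auto simp: sets_circ sets_restrict_space)
    then have "emeasure N U = (\<integral>\<^sup>+z. ennreal (g z) * indicator (U \<inter> sphere 0 1) z \<partial>circ)"
      unfolding N_def using that by (subst emeasure_distr) (auto simp: emeasure_density)
    also have "\<dots> = (\<integral>\<^sup>+z. ennreal (g z) * indicator U z \<partial>circ)"
      by (intro nn_integral_cong) (auto simp: indicator_def)
    finally show ?thesis .
  qed
  have "emeasure N UNIV < \<infinity>" using eN[of UNIV] gf by simp
  then have fin: "emeasure N (space N) \<noteq> \<infinity>" by (simp add: N_def)
  have Eb: "E \<in> sets borel" using E(1) by (auto simp: sets_circ sets_restrict_space)
  have "emeasure N E = (\<integral>\<^sup>+z. 0 \<partial>circ)"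
    unfolding eN[OF Eb] by (intro nn_integral_cong) (auto simp: indicator_def E)
  then have "(INF U \<in> {U. E \<subseteq> U \<and> open U}. emeasure N U) < ennreal e"
    using outer_regular[OF sN fin Eb] e by simp
  then obtain U where "E \<subseteq> U" "open U" "emeasure N U < ennreal e"
    by (auto simp: INF_less_iff)
  then show ?thesis using eN[of U] by (intro exI[of _ U]) auto
qed

lemma poisson_far:
  fixes g :: "complex \<Rightarrow> ennreal"
  assumes [measurable]: "g \<in> borel_measurable circ" and x: "norm x = 1" and r: "0 \<le> r" "r < 1" and d: "0 < d"
    and g0: "\<And>z. z \<in> ball x d \<Longrightarrow> g z = 0"
  shows "(\<integral>\<^sup>+z. ennreal (poisson (of_real r * x) z) * g z \<partial>circ) \<le> ennreal (8 * (1 - r) / d\<^sup>2) * (\<integral>\<^sup>+z. g z \<partial>circ)"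
proof -
  have "(\<integral>\<^sup>+z. ennreal (poisson (of_real r * x) z) * g z \<partial>circ) \<le> (\<integral>\<^sup>+z. ennreal (8 * (1 - r) / d\<^sup>2) * g z \<partial>circ)"
  proof (intro nn_integral_mono)
    fix z assume z: "z \<in> space circ"
    show "ennreal (poisson (of_real r * x) z) * g z \<le> ennreal (8 * (1 - r) / d\<^sup>2) * g z"
    proof (cases "z \<in> ball x d")
      case False
      then have "d / 2 \<le> norm (z - of_real r * x)"
        using norm_diff_radial_ge(2)[OF x r, of z] z by (simp add: dist_norm norm_minus_commute)
      moreover from this have "0 < norm (z - of_real r * x)" using d by linarith
      ultimately have "2 * (1 - r) / (norm (z - of_real r * x))\<^sup>2 \<le> 2 * (1 - r) / (d / 2)\<^sup>2"
        using d r by (intro divide_left_mono power_mono mult_pos_pos zero_less_power) auto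
      also have "\<dots> = 8 * (1 - r) / d\<^sup>2" by (simp add: power_divide)
      finally show ?thesis using poisson_radial_le[OF x r, of z] z
        by (intro mult_right_mono ennreal_leI) auto
    qed (simp add: g0)
  qed
  then show ?thesis by (simp add: nn_integral_cmult)
qed

lemma eventually_at_left_1_Ioo: "eventually (\<lambda>r::real. r \<in> {0<..<1}) (at_left 1)"
  by (rule eventually_at_leftI[of 0]) auto

text \<open>An open \<open>U\<close> containing \<open>E\<close> splits \<open>g\<close>. The part
  on \<open>U\<close> has tiny mass, so outside a small exceptional set the maximal inequality
  controls its Poisson means; the part off \<open>U\<close> vanishes near each point of
  \<open>E\<close> and its means are \<open>O(1 - r)\<close>.\<close>

lemma poisson_vanishing_set:
  fixes g :: "complex \<Rightarrow> real"
  assumes g: "integrable circ g" "\<And>z. 0 \<le> g z" and E: "E \<in> sets circ" "\<And>z. z \<in> E \<Longrightarrow> g z = 0"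
  shows "AE x in circ. x \<in> E \<longrightarrow> ((\<lambda>r. \<integral>\<^sup>+z. ennreal (poisson (of_real r * x) z) * ennreal (g z) \<partial>circ) \<longlongrightarrow> 0) (at_left 1)"
proof -
  have [measurable]: "g \<in> borel_measurable circ" using g by simp
  define G where "G = (\<integral>z. g z \<partial>circ)"
  have G: "(\<integral>\<^sup>+z. ennreal (g z) \<partial>circ) = ennreal G" "G \<ge> 0"
    using g by (auto simp: G_def nn_integral_eq_integral)
  define I where "I r x = (\<integral>\<^sup>+z. ennreal (poisson (of_real r * x) z) * ennreal (g z) \<partial>circ)" for r x
  have key: "AE x in circ. x \<notin> {x \<in> E. \<not> (eventually (\<lambda>r. I r x \<le> ennreal (65 * l)) (at_left 1))}" if l: "l > 0" for l
  proof (rule AE_notin_of_small_cover)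
    fix e :: real assume e: "e > 0"
    \<comment> \<open>Chosen so that the weak type bound \<open>5 h / l\<close> of the exceptional
      set is exactly \<open>e\<close>.\<close>
    define h where "h = e * l / 5"
    have h: "h > 0" using e l by (simp add: h_def)
    obtain U where U: "open U" "E \<subseteq> U" "(\<integral>\<^sup>+z. ennreal (g z) * indicator U z \<partial>circ) \<le> ennreal h"
      using open_cover_small_integral[OF g E h] by auto
    have mU[measurable]: "(indicator U :: complex \<Rightarrow> ennreal) \<in> borel_measurable circ" "(indicator (-U) :: complex \<Rightarrow> ennreal) \<in> borel_measurable circ"
      using U(1) by (auto intro!: borel_measurable_circI borel_measurable_indicator)
    define gU where "gU z = ennreal (g z) * indicator U z" for z
    define gV where "gV z = ennreal (g z) * indicator (-U) z" for z
    have [measurable]: "gU \<in> borel_measurable circ" "gV \<in> borel_measurable circ"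
      unfolding gU_def gV_def by measurable
    obtain B where B: "B \<in> sets circ" "{x \<in> sphere 0 1. \<exists>s>0. (\<integral>\<^sup>+z. gU z * indicator (ball x s) z \<partial>circ) > ennreal (l * s)} \<subseteq> B"
        "emeasure circ B \<le> ennreal (5 * h / l)"
      using maximal_weak_type[of gU h l] U(3) l by (auto simp: gU_def)
    have "{x \<in> E. \<not> (eventually (\<lambda>r. I r x \<le> ennreal (65 * l)) (at_left 1))} \<subseteq> B"
    proof (rule ccontr)
      assume "\<not> ?thesis"
      then obtain x where x: "x \<in> E" "\<not> (eventually (\<lambda>r. I r x \<le> ennreal (65 * l)) (at_left 1))" "x \<notin> B" by auto
      have nx: "norm x = 1" using x(1) sets.sets_into_space[OF E(1)] by auto
      have mx: "(\<integral>\<^sup>+z. gU z * indicator (ball x s) z \<partial>circ) \<le> ennreal (l * s)" if "s > 0" for s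
        using B(2) x(3) nx that by (auto simp: not_less[symmetric])
      obtain d where d: "d > 0" "ball x d \<subseteq> U" using U(1,2) x(1) open_contains_ball by blast
      have bound: "I r x \<le> ennreal (64 * l) + ennreal (8 * (1 - r) / d\<^sup>2 * G)" if r: "0 \<le> r" "r < 1" for r
      proof -
        have "I r x = (\<integral>\<^sup>+z. ennreal (poisson (of_real r * x) z) * gU z + ennreal (poisson (of_real r * x) z) * gV z \<partial>circ)"
          unfolding I_def gU_def gV_def by (intro nn_integral_cong) (auto simp: indicator_def)
        also have "\<dots> = (\<integral>\<^sup>+z. ennreal (poisson (of_real r * x) z) * gU z \<partial>circ) + (\<integral>\<^sup>+z. ennreal (poisson (of_real r * x) z) * gV z \<partial>circ)"
          by (subst nn_integral_add) auto
        also have "\<dots> \<le> ennreal (64 * l) + ennreal (8 * (1 - r) / d\<^sup>2) * (\<integral>\<^sup>+z. gV z \<partial>circ)"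
        proof -
          have "gV z = 0" if "z \<in> ball x d" for z using d that by (auto simp: gV_def)
          then show ?thesis using d by (intro add_mono poisson_maximal poisson_far mx nx r l) auto
        qed
        also have "\<dots> \<le> ennreal (64 * l) + ennreal (8 * (1 - r) / d\<^sup>2) * (\<integral>\<^sup>+z. ennreal (g z) \<partial>circ)"
          by (intro add_left_mono mult_left_mono nn_integral_mono) (auto simp: gV_def indicator_def)
        also have "\<dots> = ennreal (64 * l) + ennreal (8 * (1 - r) / d\<^sup>2 * G)"
          unfolding G(1) using r by (subst ennreal_mult') auto
        finally show ?thesis .
      qed
      have "((\<lambda>r. 8 * (1 - r) / d\<^sup>2 * G) \<longlongrightarrow> 8 * (1 - 1) / d\<^sup>2 * G) (at_left 1)"
        by (intro tendsto_intros) (use d in auto)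
      then have "eventually (\<lambda>r. 8 * (1 - r) / d\<^sup>2 * G < l) (at_left 1)"
        using l by (intro order_tendstoD(2)) auto
      moreover note eventually_at_left_1_Ioo
      ultimately have "eventually (\<lambda>r. I r x \<le> ennreal (65 * l)) (at_left 1)"
      proof eventually_elim
        case (elim r)
        then have "I r x \<le> ennreal (64 * l) + ennreal (8 * (1 - r) / d\<^sup>2 * G)" by (intro bound) auto
        also have "\<dots> \<le> ennreal (64 * l) + ennreal l" using elim by (intro add_left_mono ennreal_leI) auto
        also have "\<dots> = ennreal (65 * l)" using l by (simp flip: ennreal_plus)
        finally show ?case .
      qed
      then show False using x(2) by simp
    qed
    moreover have "5 * h / l = e" using l by (simp add: h_def)
    ultimately show "\<exists>B\<in>sets circ. {x \<in> E. \<not> (eventually (\<lambda>r. I r x \<le> ennreal (65 * l)) (at_left 1))} \<subseteq> B \<and> emeasure circ B \<le> ennreal e"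
      using B(1,3) by (intro bexI[of _ B]) auto
  qed
  have "AE x in circ. \<forall>n::nat. x \<notin> {x \<in> E. \<not> (eventually (\<lambda>r. I r x \<le> ennreal (65 * (1 / Suc n))) (at_left 1))}"
    unfolding AE_all_countable by (intro allI key) simp
  then show ?thesis
  proof eventually_elim
    case (elim x)
    show ?case
    proof
      assume "x \<in> E"
      with elim have ev: "eventually (\<lambda>r. I r x \<le> ennreal (65 * (1 / Suc n))) (at_left 1)" for n by auto
      have "((\<lambda>r. I r x) \<longlongrightarrow> 0) (at_left 1)"
      proof (rule order_tendstoI)
        fix a :: ennreal assume a: "0 < a"
        have "(\<lambda>n. ennreal (65 * (1 / Suc n))) \<longlonglongrightarrow> ennreal (65 * 0)"
          by (intro tendsto_ennrealI tendsto_intros LIMSEQ_Suc[OF lim_1_over_n])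
        then have "eventually (\<lambda>n. ennreal (65 * (1 / Suc n)) < a) sequentially"
          using a by (intro order_tendstoD(2)) auto
        then obtain n where "ennreal (65 * (1 / Suc n)) < a" by (auto simp: eventually_sequentially)
        with ev[of n] show "eventually (\<lambda>r. I r x < a) (at_left 1)"
          by (auto elim: eventually_mono)
      qed simp
      then show "((\<lambda>r. \<integral>\<^sup>+z. ennreal (poisson (of_real r * x) z) * ennreal (g z) \<partial>circ) \<longlongrightarrow> 0) (at_left 1)"
        by (simp add: I_def)
    qed
  qed
qed

text \<open>Each point is a Lebesgue point in the Poisson sense, almost surely; this is stronger
  than convergence of the Poisson integral and is also what the conjugate function needs. The
  vanishing-set lemma is applied to countably many \<open>g q n\<close>, with \<open>q\<close> in a
  dense set: \<open>g q n\<close> is \<open>|f - q|\<close> cut off to zero where it is below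
  \<open>1 / (n + 1)\<close>, and \<open>x\<close> belongs to \<open>E q n\<close> once
  \<open>q\<close> is close enough to \<open>f x\<close>.\<close>

theorem fatou_lebesgue_points:
  fixes f :: "complex \<Rightarrow> 'b::{banach, second_countable_topology}"
  assumes f: "integrable circ f"
  shows "AE x in circ. ((\<lambda>r. \<integral>z. poisson (of_real r * x) z * norm (f z - f x) \<partial>circ) \<longlongrightarrow> 0) (at_left 1)"
proof -
  have [measurable]: "f \<in> borel_measurable circ" using f by simp
  obtain D :: "'b set" where D: "countable D" "\<And>X. open X \<Longrightarrow> X \<noteq> {} \<Longrightarrow> \<exists>d\<in>D. d \<in> X"
    using countable_dense_setE by metis
  define E where "E q n = {z \<in> space circ. norm (f z - q) < 1 / real (Suc n)}" for q n
  define g where "g q n z = (if norm (f z - q) < 1 / real (Suc n) then 0 else norm (f z - q))" for q n z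
  have [measurable]: "(\<lambda>z. g q n z) \<in> borel_measurable circ" for q n
    unfolding g_def by measurable
  have gi: "integrable circ (g q n)" for q n
    by (rule Bochner_Integration.integrable_bound[where f="\<lambda>z. norm (f z - q)"])
       (use f in \<open>auto simp: g_def[of q n]\<close>)
  have "AE x in circ. \<forall>q\<in>D. \<forall>n. x \<in> E q n \<longrightarrow> ((\<lambda>r. \<integral>\<^sup>+z. ennreal (poisson (of_real r * x) z) * ennreal (g q n z) \<partial>circ) \<longlongrightarrow> 0) (at_left 1)"
    unfolding AE_ball_countable[OF D(1)] AE_all_countable
  proof (intro ballI allI poisson_vanishing_set gi)
    fix q n
    show "E q n \<in> sets circ" unfolding E_def by measurable
  qed (auto simp: g_def E_def)
  with AE_circ_sphere show ?thesis
  proof eventually_elim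
    case (elim x)
    show ?case
    proof (rule tendstoI)
      fix e :: real assume e: "e > 0"
      \<comment> \<open>Two errors of \<open>e/4\<close> occur, one from \<open>|q - f x|\<close>
        and one from the cut-off in \<open>g q n\<close>; together they leave \<open>e/2\<close> for
        the Poisson mean of \<open>g q n\<close>.\<close>
      obtain n where n: "1 / real (Suc n) < e / 4" using e by (metis nat_approx_posE zero_less_divide_iff zero_less_numeral)
      obtain q where q: "q \<in> D" "q \<in> ball (f x) (1 / real (Suc n))" using D(2)[of "ball (f x) (1 / real (Suc n))"] by auto
      then have "x \<in> E q n" using elim(1) by (auto simp: E_def dist_norm)
      with elim(2) q(1) have "((\<lambda>r. \<integral>\<^sup>+z. ennreal (poisson (of_real r * x) z) * ennreal (g q n z) \<partial>circ) \<longlongrightarrow> 0) (at_left 1)" by blast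
      then have "eventually (\<lambda>r. (\<integral>\<^sup>+z. ennreal (poisson (of_real r * x) z) * ennreal (g q n z) \<partial>circ) < ennreal (e/2)) (at_left 1)"
        using e by (intro order_tendstoD(2)) auto
      moreover note eventually_at_left_1_Ioo
      ultimately show "eventually (\<lambda>r. dist (\<integral>z. poisson (of_real r * x) z * norm (f z - f x) \<partial>circ) 0 < e) (at_left 1)"
      proof eventually_elim
        case (elim r)
        have w: "norm (of_real r * x) < 1" using elim(2) \<open>norm x = 1\<close> by (simp add: norm_mult)
        have p0: "poisson (of_real r * x) z \<ge> 0" for z using poisson_nonneg[OF w] .
        have i1: "integrable circ (\<lambda>z. poisson (of_real r * x) z * g q n z)"
          using integrable_poisson[OF gi w] by simp
        have i2: "integrable circ (\<lambda>z. poisson (of_real r * x) z)"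
          using integrable_poisson[OF _ w, of "\<lambda>_. 1::real"] by simp
        have i3: "integrable circ (\<lambda>z. poisson (of_real r * x) z * norm (f z - f x))"
          using integrable_poisson[OF _ w, of "\<lambda>z. norm (f z - f x)"] f by simp
        have "ennreal (\<integral>z. poisson (of_real r * x) z * g q n z \<partial>circ) = (\<integral>\<^sup>+z. ennreal (poisson (of_real r * x) z * g q n z) \<partial>circ)"
          by (rule nn_integral_eq_integral[symmetric]) (use i1 p0 in \<open>auto simp: g_def\<close>)
        also have "\<dots> < ennreal (e/2)" using elim(1) p0 by (simp add: ennreal_mult' g_def)
        finally have a: "(\<integral>z. poisson (of_real r * x) z * g q n z \<partial>circ) < e/2"
          by (simp add: ennreal_less_iff[OF integral_nonneg_AE] p0 g_def)
        have "(\<integral>z. poisson (of_real r * x) z * norm (f z - f x) \<partial>circ)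
           \<le> (\<integral>z. poisson (of_real r * x) z * g q n z + poisson (of_real r * x) z * (e/2) \<partial>circ)"
        proof (rule integral_mono)
          fix z
          have "norm (f z - f x) \<le> norm (f z - q) + norm (q - f x)"
            using norm_triangle_ineq[of "f z - q" "q - f x"] by simp
          moreover have "norm (q - f x) < e/4" using q(2) n by (simp add: dist_norm norm_minus_commute)
          moreover have "norm (f z - q) \<le> g q n z + e/4"
            unfolding g_def using n e by (simp split: if_split del: of_nat_Suc)
          ultimately have "norm (f z - f x) \<le> g q n z + e/2" by linarith
          then show "poisson (of_real r * x) z * norm (f z - f x) \<le> poisson (of_real r * x) z * g q n z + poisson (of_real r * x) z * (e/2)"
            using mult_left_mono[OF _ p0] by (metis distrib_left)
        qed (use i1 i2 i3 in auto)
        also have "\<dots> = (\<integral>z. poisson (of_real r * x) z * g q n z \<partial>circ) + e/2"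
          using i1 i2 integral_poisson[OF w] by simp
        finally have "(\<integral>z. poisson (of_real r * x) z * norm (f z - f x) \<partial>circ) < e" using a by simp
        moreover have "(\<integral>z. poisson (of_real r * x) z * norm (f z - f x) \<partial>circ) \<ge> 0"
          using p0 by (intro integral_nonneg_AE) auto
        ultimately show ?case by simp
      qed
    qed
  qed
qed

lemma poisson_integral_tendsto:
  fixes f :: "complex \<Rightarrow> 'b::{banach, second_countable_topology, real_normed_algebra_1}"
  assumes f: "integrable circ f" and x: "norm x = 1"
    and lim: "((\<lambda>r. \<integral>z. poisson (of_real r * x) z * norm (f z - f x) \<partial>circ) \<longlongrightarrow> 0) (at_left 1)"
  shows "((\<lambda>r. \<integral>z. of_real (poisson (of_real r * x) z) * f z \<partial>circ) \<longlongrightarrow> f x) (at_left 1)"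
proof -
  have "((\<lambda>r. (\<integral>z. of_real (poisson (of_real r * x) z) * f z \<partial>circ) - f x) \<longlongrightarrow> 0) (at_left 1)"
  proof (rule Lim_null_comparison[OF _ lim])
    from eventually_at_left_1_Ioo show "eventually (\<lambda>r. norm ((\<integral>z. of_real (poisson (of_real r * x) z) * f z \<partial>circ) - f x) \<le> (\<integral>z. poisson (of_real r * x) z * norm (f z - f x) \<partial>circ)) (at_left 1)"
    proof eventually_elim
      case (elim r)
      have w: "norm (of_real r * x) < 1" using elim x by (simp add: norm_mult)
      have p0: "poisson (of_real r * x) z \<ge> 0" for z using poisson_nonneg[OF w] .
      have i1: "integrable circ (\<lambda>z. of_real (poisson (of_real r * x) z) * f z)"
        using integrable_poisson[OF f w] by simp
      have i2: "integrable circ (\<lambda>z. of_real (poisson (of_real r * x) z) * f x)"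
        using integrable_poisson[OF _ w, of "\<lambda>_. f x"] by simp
      have "(\<integral>z. (of_real (poisson (of_real r * x) z) :: 'b) \<partial>circ) = 1"
        using integral_poisson[OF w] integrable_poisson[OF _ w, of "\<lambda>_. 1::real"] integral_of_real[of circ "poisson (of_real r * x)"] by simp
      then have c: "(\<integral>z. of_real (poisson (of_real r * x) z) * f x \<partial>circ) = f x"
        using integrable_poisson[OF _ w, of "\<lambda>_. 1::'b"] Bochner_Integration.integral_mult_left[of "f x" circ "\<lambda>z. of_real (poisson (of_real r * x) z)"] by simp
      have "(\<integral>z. of_real (poisson (of_real r * x) z) * f z \<partial>circ) - f x = (\<integral>z. of_real (poisson (of_real r * x) z) * f z - of_real (poisson (of_real r * x) z) * f x \<partial>circ)"
        using Bochner_Integration.integral_diff[OF i1 i2] c by simp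
      also have "norm \<dots> \<le> (\<integral>z. norm (of_real (poisson (of_real r * x) z) * f z - of_real (poisson (of_real r * x) z) * f x) \<partial>circ)"
        by (rule integral_norm_bound)
      also have "\<dots> = (\<integral>z. poisson (of_real r * x) z * norm (f z - f x) \<partial>circ)"
      proof (rule Bochner_Integration.integral_cong)
        fix z
        have "of_real (poisson (of_real r * x) z) * f z - of_real (poisson (of_real r * x) z) * f x = poisson (of_real r * x) z *\<^sub>R (f z - f x)"
          by (simp add: of_real_def algebra_simps)
        then show "norm (of_real (poisson (of_real r * x) z) * f z - of_real (poisson (of_real r * x) z) * f x) = poisson (of_real r * x) z * norm (f z - f x)"
          using p0[of z] by simp
      qed simp
      finally show ?case .
    qed
  qed
  then show ?thesis by (simp add: LIM_zero_iff)
qed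

lemma ext_radial_limit:
  assumes f: "f \<in> H1"
  shows "AE x in circ. ((\<lambda>r. ext f (of_real r * x)) \<longlongrightarrow> f x) (at_left 1)"
proof -
  have i: "integrable circ f" using f by (simp add: H1_def)
  from fatou_lebesgue_points[OF i] AE_circ_sphere show ?thesis
  proof eventually_elim
    case (elim x)
    have "((\<lambda>r. \<integral>z. of_real (poisson (of_real r * x) z) * f z \<partial>circ) \<longlongrightarrow> f x) (at_left 1)"
      using poisson_integral_tendsto[OF i elim(2) elim(1)] .
    moreover from eventually_at_left_1_Ioo have "eventually (\<lambda>r. (\<integral>z. of_real (poisson (of_real r * x) z) * f z \<partial>circ) = ext f (of_real r * x)) (at_left 1)"
      by eventually_elim (use elim(2) in \<open>auto simp: ext_eq_poisson[OF f] norm_mult\<close>)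
    ultimately show ?case by (rule Lim_transform_eventually)
  qed
qed

section \<open>Boundary functions of bounded analytic functions\<close>

lemma sums_imp_measurable_circ:
  fixes f :: "complex \<Rightarrow> complex"
  assumes "\<And>z. norm z = 1 \<Longrightarrow> (\<lambda>k. a k * z ^ k) sums f z"
  shows "f \<in> borel_measurable circ"
proof -
  have "(\<lambda>z. \<Sum>k. a k * z ^ k) \<in> borel_measurable circ" by measurable
  then show ?thesis
    by (rule measurable_cong[THEN iffD1, rotated]) (use assms in \<open>auto simp: sums_iff\<close>)
qed

lemma norm_le_of_abs_series:
  fixes y z :: complex
  assumes s: "summable (\<lambda>k. norm (a k))" and f: "(\<lambda>k. a k * z ^ k) sums y" and z: "norm z = 1"
  shows "norm y \<le> (\<Sum>k. norm (a k))"
proof -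
  have "norm (\<Sum>k. a k * z ^ k) \<le> (\<Sum>k. norm (a k * z ^ k))"
    using s z by (intro summable_norm) (simp add: norm_mult norm_power)
  then show ?thesis using f z by (simp add: sums_iff norm_mult norm_power)
qed

lemma fourier_abs_series:
  fixes f :: "complex \<Rightarrow> complex"
  assumes s: "summable (\<lambda>k. norm (a k))" and f: "\<And>z. norm z = 1 \<Longrightarrow> (\<lambda>k. a k * z ^ k) sums f z"
  shows "fourier f n = (if n \<ge> 0 then a (nat n) else 0)"
proof -
  have "(\<lambda>k. \<integral>z. a k * z powi (int k - n) \<partial>circ) sums (\<integral>z. (\<Sum>k. a k * z powi (int k - n)) \<partial>circ)"
  proof (rule sums_integral)
    fix k
    show "integrable circ (\<lambda>z. a k * z powi (int k - n))"
      by (rule integrable_circ_bounded[where C="norm (a k)"])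
         (use AE_circ_sphere in \<open>auto simp: norm_mult norm_power_int intro!: borel_measurable_times\<close>)
  next
    show "AE z in circ. summable (\<lambda>k. norm (a k * z powi (int k - n)))"
      using AE_circ_sphere by eventually_elim (use s in \<open>auto simp: norm_mult norm_power_int\<close>)
  next
    have "(\<integral>z. norm (a k * z powi (int k - n)) \<partial>circ) = (\<integral>z. norm (a k) \<partial>circ)" for k
      by (rule Bochner_Integration.integral_cong) (auto simp: norm_mult norm_power_int)
    also have "(\<integral>z. norm (a k) \<partial>circ) = norm (a k)" for k using circ.prob_space by simp
    finally show "summable (\<lambda>k. \<integral>z. norm (a k * z powi (int k - n)) \<partial>circ)" using s by simp
  qed
  also have "(\<integral>z. (\<Sum>k. a k * z powi (int k - n)) \<partial>circ) = fourier f n"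
    unfolding fourier_def
  proof (rule Bochner_Integration.integral_cong)
    fix z assume "z \<in> space circ"
    then have z: "norm z = 1" by simp
    then have z0: "z \<noteq> 0" by auto
    have "(\<lambda>k. a k * z ^ k * z powi (- n)) sums (f z * z powi (- n))"
      using f[OF z] by (rule sums_mult2)
    moreover have "a k * z ^ k * z powi (- n) = a k * z powi (int k - n)" for k
      using power_int_add[of z "int k" "- n"] z0 by simp
    ultimately show "(\<Sum>k. a k * z powi (int k - n)) = f z * z powi (- n)"
      by (simp add: sums_iff)
  qed simp
  also have "(\<lambda>k. \<integral>z. a k * z powi (int k - n) \<partial>circ) = (\<lambda>k. if int k = n then a k else 0)"
    by (simp add: integral_circ_powi fun_eq_iff)
  finally have *: "(\<lambda>k. if int k = n then a k else 0) sums fourier f n" .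
  show ?thesis
  proof (cases "n \<ge> 0")
    case True
    then have "(\<lambda>k. if int k = n then a k else 0) = (\<lambda>k. if k = nat n then a k else 0)" by (auto simp: fun_eq_iff)
    then show ?thesis using * sums_single[of "nat n" a] True sums_unique2 by metis
  next
    case False
    then have "(\<lambda>k. if int k = n then a k else 0) = (\<lambda>k. 0)" by (auto simp: fun_eq_iff)
    then show ?thesis using * False sums_unique2 sums_zero by metis
  qed
qed

text \<open>Termwise integration of \<open>f\<close> times the conjugated series. Absolute
  summability suffices for both uses: polynomials, and dilates to a radius below 1 of functions on
  the disc.\<close>

lemma parseval_abs_series:
  fixes f :: "complex \<Rightarrow> complex"
  assumes s: "summable (\<lambda>k. norm (a k))" and f: "\<And>z. norm z = 1 \<Longrightarrow> (\<lambda>k. a k * z ^ k) sums f z"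
  shows "(\<lambda>k. (norm (a k))\<^sup>2) sums (\<integral>z. (norm (f z))\<^sup>2 \<partial>circ)"
proof -
  define S where "S = (\<Sum>k. norm (a k))"
  have [measurable]: "f \<in> borel_measurable circ" by (rule sums_imp_measurable_circ[OF f])
  have fS: "norm (f z) \<le> S" if "norm z = 1" for z
    unfolding S_def by (rule norm_le_of_abs_series[OF s f[OF that] that])
  have S0: "S \<ge> 0" unfolding S_def using s by (intro suminf_nonneg) auto
  have b: "norm (cnj (a k) * (f z * z powi (- int k))) \<le> norm (a k) * S" if "norm z = 1" for z k
    using fS[OF that] that by (simp add: norm_mult norm_power_int mult_left_mono)
  have i: "integrable circ (\<lambda>z. cnj (a k) * (f z * z powi (- int k)))" for k
    by (rule integrable_circ_bounded[where C="norm (a k) * S"])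
       (use AE_circ_sphere b in \<open>auto intro!: borel_measurable_times\<close>)
  have "(\<lambda>k. \<integral>z. cnj (a k) * (f z * z powi (- int k)) \<partial>circ) sums (\<integral>z. (\<Sum>k. cnj (a k) * (f z * z powi (- int k))) \<partial>circ)"
  proof (rule sums_integral[OF i])
    show "AE z in circ. summable (\<lambda>k. norm (cnj (a k) * (f z * z powi (- int k))))"
      using AE_circ_sphere
    proof eventually_elim
      case (elim z)
      show ?case
        by (rule summable_comparison_test'[where N=0 and g="\<lambda>k. norm (a k) * S"])
           (use b[OF elim] s in \<open>auto intro: summable_mult2\<close>)
    qed
    show "summable (\<lambda>k. \<integral>z. norm (cnj (a k) * (f z * z powi (- int k))) \<partial>circ)"
    proof (rule summable_comparison_test'[where N=0 and g="\<lambda>k. norm (a k) * S"])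
      fix k
      have "(\<integral>z. norm (cnj (a k) * (f z * z powi (- int k))) \<partial>circ) \<le> (\<integral>z. norm (a k) * S \<partial>circ)"
        by (rule integral_mono_AE) (use i AE_circ_sphere b in \<open>auto elim: eventually_mono\<close>)
      also have "\<dots> = norm (a k) * S" using circ.prob_space by simp
      finally show "norm (\<integral>z. norm (cnj (a k) * (f z * z powi (- int k))) \<partial>circ) \<le> norm (a k) * S" by simp
    qed (use s in \<open>auto intro: summable_mult2\<close>)
  qed
  also have "(\<lambda>k. \<integral>z. cnj (a k) * (f z * z powi (- int k)) \<partial>circ) = (\<lambda>k. of_real ((norm (a k))\<^sup>2))"
  proof
    fix k
    have "(\<integral>z. cnj (a k) * (f z * z powi (- int k)) \<partial>circ) = cnj (a k) * fourier f (int k)"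
      unfolding fourier_def by simp
    also have "\<dots> = of_real ((norm (a k))\<^sup>2)"
      using fourier_abs_series[OF s f, of "int k"] by (simp add: complex_norm_square mult.commute del: of_real_power)
    finally show "(\<integral>z. cnj (a k) * (f z * z powi (- int k)) \<partial>circ) = of_real ((norm (a k))\<^sup>2)" .
  qed
  also have "(\<integral>z. (\<Sum>k. cnj (a k) * (f z * z powi (- int k))) \<partial>circ) = (\<integral>z. of_real ((norm (f z))\<^sup>2) \<partial>circ)"
  proof (rule Bochner_Integration.integral_cong)
    fix z assume "z \<in> space circ"
    then have z: "norm z = 1" by simp
    have "z * cnj z = 1" using complex_norm_square[of z] z by simp
    then have "inverse z = cnj z" by (rule inverse_unique)
    then have "z powi (- int k) = cnj (z ^ k)" for k by (simp add: power_int_minus power_inverse[symmetric])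
    then have *: "cnj (a k) * (f z * z powi (- int k)) = f z * cnj (a k * z ^ k)" for k by simp
    have "(\<lambda>k. cnj (a k * z ^ k)) sums cnj (f z)" using f[OF z] by (simp only: sums_cnj)
    then have "(\<lambda>k. f z * cnj (a k * z ^ k)) sums (f z * cnj (f z))" by (rule sums_mult)
    then show "(\<Sum>k. cnj (a k) * (f z * z powi (- int k))) = of_real ((norm (f z))\<^sup>2)"
      unfolding * by (simp only: sums_iff complex_norm_square)
  qed simp
  also have "\<dots> = of_real (\<integral>z. (norm (f z))\<^sup>2 \<partial>circ)" by (rule integral_complex_of_real)
  finally show ?thesis by (simp only: sums_of_real_iff)
qed

text \<open>Cauchy-Schwarz on a probability space, read off from nonnegativity of the variance of
  \<open>|f|\<close>.\<close>

lemma integral_norm_le_L2: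
  fixes f :: "complex \<Rightarrow> complex"
  assumes m: "f \<in> borel_measurable circ" and b: "AE z in circ. norm (f z) \<le> B" and l: "(\<integral>z. (norm (f z))\<^sup>2 \<partial>circ) \<le> L\<^sup>2" "0 \<le> L"
  shows "(\<integral>z. norm (f z) \<partial>circ) \<le> L"
proof -
  have i1: "integrable circ (\<lambda>z. norm (f z))" using integrable_circ_bounded[OF m b] by simp
  have i2: "integrable circ (\<lambda>z. (norm (f z))\<^sup>2)"
  proof (rule integrable_circ_bounded[where C="B\<^sup>2"])
    show "AE z in circ. norm ((norm (f z))\<^sup>2) \<le> B\<^sup>2"
      using b by eventually_elim (auto intro: power_mono)
  qed (use m in measurable)
  have "circ.variance (\<lambda>z. norm (f z)) = (\<integral>z. (norm (f z))\<^sup>2 \<partial>circ) - (\<integral>z. norm (f z) \<partial>circ)\<^sup>2"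
    by (rule circ.variance_eq[OF i1 i2])
  then have "(\<integral>z. norm (f z) \<partial>circ)\<^sup>2 \<le> L\<^sup>2" using circ.variance_positive[of "\<lambda>z. norm (f z)"] l by linarith
  then show ?thesis using l(2) by (rule power2_le_imp_le)
qed

section \<open>Functions with prescribed square-summable coefficients\<close>

lemma AE_summable_of_integrals:
  fixes d :: "nat \<Rightarrow> 'a \<Rightarrow> 'b::{banach, second_countable_topology}"
  assumes i: "\<And>j. integrable M (d j)" and s: "summable (\<lambda>j. \<integral>z. norm (d j z) \<partial>M)"
  shows "AE z in M. summable (\<lambda>j. norm (d j z))"
proof -
  have [measurable]: "d j \<in> borel_measurable M" for j using i by simp
  have "(\<integral>\<^sup>+z. (\<Sum>j. ennreal (norm (d j z))) \<partial>M) = (\<Sum>j. \<integral>\<^sup>+z. ennreal (norm (d j z)) \<partial>M)"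
    by (rule nn_integral_suminf) auto
  also have "\<dots> = (\<Sum>j. ennreal (\<integral>z. norm (d j z) \<partial>M))"
    by (intro suminf_cong nn_integral_eq_integral) (use i in auto)
  also have "\<dots> \<noteq> \<infinity>" using s by (subst suminf_ennreal_eq[OF _ summable_sums]) auto
  finally have "AE z in M. (\<Sum>j. ennreal (norm (d j z))) \<noteq> \<infinity>"
    by (intro nn_integral_PInf_AE) auto
  then show ?thesis by eventually_elim (auto intro: summable_suminf_not_top)
qed

lemma Hinf_subset_H1: "f \<in> Hinf \<Longrightarrow> f \<in> H1"
  by (auto simp: Hinf_def H1_def Linf_def intro: integrable_circ_bounded)

text \<open>Partial sums along a fast subsequence are Cauchy in L2, hence in L1, and the telescoping
  series of their differences converges absolutely almost everywhere. An L1 limit is enough here;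
  for bounded analytic functions the essential bound is recovered later from radial limits.\<close>

lemma riesz_fischer:
  assumes c: "summable (\<lambda>k. (norm (c k))\<^sup>2)"
  shows "\<exists>f\<in>H1. \<forall>n. fourier f (int n) = c n"
proof -
  define T where "T N = (\<Sum>k. (norm (c (k + N)))\<^sup>2)" for N
  have "T \<longlonglongrightarrow> 0" unfolding T_def by (rule suminf_exist_split2[OF c])
  then have "\<exists>N. T N \<le> (1/4) ^ j" for j
  proof -
    have "eventually (\<lambda>N. T N < (1/4) ^ j) sequentially" using \<open>T \<longlonglongrightarrow> 0\<close> by (rule order_tendstoD) simp
    then show ?thesis by (auto simp: eventually_sequentially intro: less_imp_le)
  qed
  \<comment> \<open>The tails are squares of L2 norms, so \<open>(1/4) ^ j\<close> makes the
    successive differences \<open>d j\<close> of size \<open>2 * (1/2) ^ j\<close> in L2.\<close>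
  then obtain N where N: "\<And>j. T (N j) \<le> (1/4) ^ j" by metis
  define a where "a j k = (if k < N j then c k else 0)" for j k
  have fin: "summable (\<lambda>k. norm (a j k))" for j
    by (rule summable_finite[of "{..<N j}"]) (auto simp: a_def)
  have asum: "(\<lambda>k. a j k * z ^ k) sums (\<Sum>k<N j. c k * z ^ k)" for j z
    using sums_finite[of "{..<N j}" "\<lambda>k. a j k * z ^ k"] by (auto simp: a_def)
  define s where "s j z = (\<Sum>k<N j. c k * z ^ k)" for j z
  have ssum: "(\<lambda>k. a j k * z ^ k) sums s j z" for j z unfolding s_def by (rule asum)
  have [measurable]: "s j \<in> borel_measurable circ" for j unfolding s_def by measurable
  have sb: "norm (s j z) \<le> (\<Sum>k. norm (a j k))" if "norm z = 1" for j z
    using norm_le_of_abs_series[OF fin ssum that] .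
  have si: "integrable circ (s j)" for j
    by (rule integrable_circ_bounded[where C="(\<Sum>k. norm (a j k))"]) (use AE_circ_sphere sb in auto)
  have tail: "(\<lambda>k. (norm (c k - a j k))\<^sup>2) sums T (N j)" for j
  proof -
    have "(\<lambda>k. (norm (c (k + N j) - a j (k + N j)))\<^sup>2) sums T (N j)"
      unfolding T_def a_def using summable_sums[OF summable_ignore_initial_segment[OF c, of "N j"]] by simp
    then show ?thesis by (subst (asm) sums_iff_shift) (simp add: a_def)
  qed
  define d where "d j z = s (Suc j) z - s j z" for j z
  have di: "integrable circ (d j)" for j unfolding d_def using si by simp
  have dL: "(\<integral>z. norm (d j z) \<partial>circ) \<le> 2 * (1/2) ^ j" for j
  proof (rule integral_norm_le_L2)
    show "AE z in circ. norm (d j z) \<le> (\<Sum>k. norm (a (Suc j) k)) + (\<Sum>k. norm (a j k))"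
      using AE_circ_sphere
    proof eventually_elim
      case (elim z)
      then show ?case unfolding d_def using sb[OF elim, of j] sb[OF elim, of "Suc j"] norm_triangle_ineq4[of "s (Suc j) z" "s j z"] by linarith
    qed
    have ds: "(\<lambda>k. (a (Suc j) k - a j k) * z ^ k) sums d j z" for z
      unfolding d_def using sums_diff[OF ssum ssum] by (simp add: algebra_simps)
    have "summable (\<lambda>k. norm (a (Suc j) k - a j k))"
      by (rule summable_finite[of "{..<N j + N (Suc j)}"]) (auto simp: a_def)
    from parseval_abs_series[OF this ds]
    have P: "(\<lambda>k. (norm (a (Suc j) k - a j k))\<^sup>2) sums (\<integral>z. (norm (d j z))\<^sup>2 \<partial>circ)" .
    have Q: "(\<lambda>k. 2 * (norm (c k - a (Suc j) k))\<^sup>2 + 2 * (norm (c k - a j k))\<^sup>2) sums (2 * T (N (Suc j)) + 2 * T (N j))"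
      by (intro sums_add sums_mult tail)
    have "(\<integral>z. (norm (d j z))\<^sup>2 \<partial>circ) \<le> 2 * T (N (Suc j)) + 2 * T (N j)"
    proof (rule sums_le[OF _ P Q])
      fix k
      have "norm (a (Suc j) k - a j k) \<le> norm (c k - a (Suc j) k) + norm (c k - a j k)"
        using norm_triangle_ineq4[of "c k - a j k" "c k - a (Suc j) k"] by simp
      then have "(norm (a (Suc j) k - a j k))\<^sup>2 \<le> (norm (c k - a (Suc j) k) + norm (c k - a j k))\<^sup>2"
        by (intro power_mono) auto
      also have "\<dots> \<le> 2 * (norm (c k - a (Suc j) k))\<^sup>2 + 2 * (norm (c k - a j k))\<^sup>2"
        using sum_squares_bound[of "norm (c k - a (Suc j) k)" "norm (c k - a j k)"] by (simp add: power2_sum)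
      finally show "(norm (a (Suc j) k - a j k))\<^sup>2 \<le> \<dots>" .
    qed
    also have "\<dots> \<le> 2 * (1/4) ^ j + 2 * (1/4) ^ j"
      by (intro add_mono mult_left_mono N order_trans[OF N power_decreasing]) auto
    also have "\<dots> = (2 * (1/2) ^ j)\<^sup>2"
    proof -
      have "((1/2::real) ^ j)\<^sup>2 = (1/4) ^ j" by (simp add: power_divide power_mult[symmetric] mult.commute[of j] power_mult)
      then show ?thesis by (simp add: power_mult_distrib)
    qed
    finally show "(\<integral>z. (norm (d j z))\<^sup>2 \<partial>circ) \<le> (2 * (1/2) ^ j)\<^sup>2" .
  qed (use di in auto)
  have dsum: "summable (\<lambda>j. \<integral>z. norm (d j z) \<partial>circ)"
    by (rule summable_comparison_test'[where N=0 and g="\<lambda>j. 2 * (1/2) ^ j"]) (use dL in \<open>auto intro!: summable_mult\<close>)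
  have AEs: "AE z in circ. summable (\<lambda>j. norm (d j z))" by (rule AE_summable_of_integrals[OF di dsum])
  define f where "f z = s 0 z + (\<Sum>j. d j z)" for z
  have fi: "integrable circ f" unfolding f_def
    by (intro Bochner_Integration.integrable_add si integrable_suminf di AEs dsum)
  have ff: "fourier f n = (if n \<ge> 0 then c (nat n) else 0)" for n
  proof -
    have pb: "AE z in circ. norm (z powi (- n)) \<le> 1"
      using AE_circ_sphere by eventually_elim (simp add: norm_power_int)
    have di': "integrable circ (\<lambda>z. d j z * z powi (- n))" for j
      using integrable_circ_mult_bounded[OF di powi_measurable_circ pb] by (simp add: mult.commute)
    have si': "integrable circ (\<lambda>z. s j z * z powi (- n))" for j
      using integrable_circ_mult_bounded[OF si powi_measurable_circ pb] by (simp add: mult.commute)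
    have AEs': "AE z in circ. summable (\<lambda>j. norm (d j z * z powi (- n)))"
      using AEs AE_circ_sphere by eventually_elim (simp add: norm_mult norm_power_int)
    have "(\<integral>z. norm (d j z * z powi (- n)) \<partial>circ) = (\<integral>z. norm (d j z) \<partial>circ)" for j
      by (rule Bochner_Integration.integral_cong) (auto simp: norm_mult norm_power_int)
    then have dsum': "summable (\<lambda>j. \<integral>z. norm (d j z * z powi (- n)) \<partial>circ)" using dsum by simp
    have "(\<lambda>j. \<integral>z. d j z * z powi (- n) \<partial>circ) sums (\<integral>z. (\<Sum>j. d j z * z powi (- n)) \<partial>circ)"
      by (rule sums_integral[OF di' AEs' dsum'])
    moreover have "(\<integral>z. d j z * z powi (- n) \<partial>circ) = fourier (s (Suc j)) n - fourier (s j) n" for j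
      unfolding d_def fourier_def left_diff_distrib by (rule Bochner_Integration.integral_diff[OF si' si'])
    ultimately have 1: "(\<lambda>j. fourier (s (Suc j)) n - fourier (s j) n) sums (\<integral>z. (\<Sum>j. d j z * z powi (- n)) \<partial>circ)" by simp
    have fs: "fourier (s j) n = (if n \<ge> 0 then a j (nat n) else 0)" for j
      using fourier_abs_series[OF fin ssum] .
    have "(\<lambda>j. fourier (s j) n) \<longlonglongrightarrow> (if n \<ge> 0 then c (nat n) else 0)"
    proof (cases "n \<ge> 0")
      case True
      have "(\<lambda>j. a j (nat n)) \<longlonglongrightarrow> c (nat n)"
      proof (rule LIM_zero_cancel, rule Lim_null_comparison)
        have "norm (a j (nat n) - c (nat n)) \<le> (1/2) ^ j" for j
        proof -
          have "(norm (c (nat n) - a j (nat n)))\<^sup>2 \<le> T (N j)"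
            using tail[of j] sum_le_suminf[of "\<lambda>k. (norm (c k - a j k))\<^sup>2" "{nat n}"] by (simp add: sums_iff)
          also have "\<dots> \<le> (1/4) ^ j" by (rule N)
          also have "\<dots> = ((1/2) ^ j)\<^sup>2" by (simp add: power_divide power_mult[symmetric] mult.commute[of j] power_mult)
          finally have "norm (c (nat n) - a j (nat n)) \<le> (1/2) ^ j" by (rule power2_le_imp_le) simp
          then show ?thesis by (subst norm_minus_commute)
        qed
        then show "\<forall>\<^sub>F j in sequentially. norm (a j (nat n) - c (nat n)) \<le> (1/2) ^ j" by simp
        show "(\<lambda>j. (1/2::real) ^ j) \<longlonglongrightarrow> 0" by (rule LIMSEQ_realpow_zero) auto
      qed
      then show ?thesis using True by (simp add: fs)
    qed (simp add: fs)
    \<comment> \<open>The coefficient of the summed series is found by telescoping: coefficients of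
      the partial sums tend to \<open>c n\<close> because \<open>|c n - a j n|^2\<close> is one term
      of the tail \<open>T (N j)\<close>.\<close>
    from telescope_sums[OF this] have "(\<integral>z. (\<Sum>j. d j z * z powi (- n)) \<partial>circ) = (if n \<ge> 0 then c (nat n) else 0) - fourier (s 0) n"
      using 1 sums_unique2 by blast
    moreover have "fourier f n = fourier (s 0) n + (\<integral>z. (\<Sum>j. d j z * z powi (- n)) \<partial>circ)"
    proof -
      have "fourier f n = (\<integral>z. s 0 z * z powi (- n) + (\<Sum>j. d j z * z powi (- n)) \<partial>circ)"
        unfolding fourier_def
      proof (rule integral_cong_AE)
        show "AE z in circ. f z * z powi (- n) = s 0 z * z powi (- n) + (\<Sum>j. d j z * z powi (- n))"
          using AEs
        proof eventually_elim
          case (elim z)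
          then have "summable (\<lambda>j. d j z)" by (rule summable_norm_cancel)
          from suminf_mult2[OF this, of "z powi (- n)"] show ?case by (simp add: f_def distrib_right)
        qed
        have [measurable]: "d j \<in> borel_measurable circ" for j using di by simp
        show "(\<lambda>z. s 0 z * z powi (- n) + (\<Sum>j. d j z * z powi (- n))) \<in> borel_measurable circ"
          by measurable
      qed (use fi in auto)
      also have "\<dots> = fourier (s 0) n + (\<integral>z. (\<Sum>j. d j z * z powi (- n)) \<partial>circ)"
        unfolding fourier_def by (rule Bochner_Integration.integral_add[OF si' integrable_suminf[OF di' AEs' dsum']])
      finally show ?thesis .
    qed
    ultimately show ?thesis by simp
  qed
  have "f \<in> H1" using fi ff by (simp add: H1_def)
  then show ?thesis by (intro bexI[of _ f]) (auto simp: ff)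
qed

text \<open>Parseval on the circle of radius \<open>r\<close> bounds every partial sum of the
  \<open>|c k|^2 r ^ (2 k)\<close> by \<open>M^2\<close>; then \<open>r\<close> tends to 1 in a
  finite sum. The auxiliary radius \<open>r'\<close> between \<open>r\<close> and 1 gives absolute
  convergence at \<open>r\<close>.\<close>

lemma summable_coeffs_of_bounded:
  assumes hol: "F holomorphic_on ball 0 1" and bd: "\<And>w. norm w < 1 \<Longrightarrow> norm (F w) \<le> M"
    and c: "\<And>w. norm w < 1 \<Longrightarrow> (\<lambda>n. c n * w ^ n) sums F w"
  shows "summable (\<lambda>n. (norm (c n))\<^sup>2)"
proof (rule summableI_nonneg_bounded)
  fix N
  have M0: "M \<ge> 0" using bd[of 0] norm_ge_zero[of "F 0"] by (simp del: norm_ge_zero)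
  have le: "(\<Sum>k<N. (norm (c k * of_real r ^ k))\<^sup>2) \<le> M\<^sup>2" if r: "0 < r" "r < 1" for r
  proof -
    define r' where "r' = (1 + r) / 2"
    have r': "r < r'" "r' < 1" using r by (auto simp: r'_def)
    have s: "summable (\<lambda>k. norm (c k * of_real r ^ k))"
    proof (rule powser_insidea)
      show "summable (\<lambda>k. c k * of_real r' ^ k)" using c[of "of_real r'"] r' r by (simp add: sums_iff)
    qed (use r r' in auto)
    have f: "(\<lambda>k. (c k * of_real r ^ k) * z ^ k) sums F (of_real r * z)" if "norm z = 1" for z
      using c[of "of_real r * z"] r that by (simp add: norm_mult power_mult_distrib mult_ac)
    have P: "(\<lambda>k. (norm (c k * of_real r ^ k))\<^sup>2) sums (\<integral>z. (norm (F (of_real r * z)))\<^sup>2 \<partial>circ)"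
      by (rule parseval_abs_series[OF s f])
    then have "(\<Sum>k<N. (norm (c k * of_real r ^ k))\<^sup>2) \<le> (\<integral>z. (norm (F (of_real r * z)))\<^sup>2 \<partial>circ)"
      using sum_le_suminf[of "\<lambda>k. (norm (c k * of_real r ^ k))\<^sup>2" "{..<N}"] by (simp add: sums_iff)
    also have "\<dots> \<le> (\<integral>z. M\<^sup>2 \<partial>circ)"
    proof (rule integral_mono_AE)
      have m: "(\<lambda>z. F (of_real r * z)) \<in> borel_measurable circ"
        by (rule sums_imp_measurable_circ[OF f])
      show le: "AE z in circ. (norm (F (of_real r * z)))\<^sup>2 \<le> M\<^sup>2"
        using AE_circ_sphere
      proof eventually_elim
        case (elim z)
        then have "norm (of_real r * z) < 1" using r by (simp add: norm_mult)
        then show ?case using bd by (intro power_mono) auto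
      qed
      show "integrable circ (\<lambda>z. (norm (F (of_real r * z)))\<^sup>2)"
        by (rule integrable_circ_bounded[where C="M\<^sup>2"]) (use m le in auto)
    qed simp
    also have "\<dots> = M\<^sup>2" using circ.prob_space by simp
    finally show ?thesis .
  qed
  have "((\<lambda>r. \<Sum>k<N. (norm (c k * of_real r ^ k))\<^sup>2) \<longlongrightarrow> (\<Sum>k<N. (norm (c k * of_real 1 ^ k))\<^sup>2)) (at_left (1::real))"
    by (intro tendsto_intros)
  moreover from eventually_at_left_1_Ioo have "eventually (\<lambda>r::real. (\<Sum>k<N. (norm (c k * of_real r ^ k))\<^sup>2) \<le> M\<^sup>2) (at_left 1)"
    by eventually_elim (use le in auto)
  ultimately show "(\<Sum>k<N. (norm (c k))\<^sup>2) \<le> M\<^sup>2"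
    using tendsto_upperbound[of _ _ "at_left (1::real)"] by fastforce
qed simp

text \<open>Square-summable Taylor coefficients give some \<open>f\<close> in \<open>H1\<close>
  whose extension is \<open>F\<close>; Fatou identifies \<open>f\<close> with the radial limits of
  \<open>F\<close>, which inherit the bound \<open>M\<close>.\<close>

theorem boundary_function:
  assumes hol: "F holomorphic_on ball 0 1" and bd: "\<And>w. norm w < 1 \<Longrightarrow> norm (F w) \<le> M"
  obtains f where "f \<in> Hinf" "\<And>w. norm w < 1 \<Longrightarrow> ext f w = F w" "AE x in circ. norm (f x) \<le> M"
    "AE x in circ. ((\<lambda>r. F (of_real r * x)) \<longlongrightarrow> f x) (at_left 1)"
proof -
  define c where "c n = (deriv ^^ n) F 0 / fact n" for n
  have c: "(\<lambda>n. c n * w ^ n) sums F w" if "norm w < 1" for w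
    using holomorphic_power_series[OF hol, of w] that by (simp add: c_def)
  from riesz_fischer[OF summable_coeffs_of_bounded[OF hol bd c]]
  obtain f where f: "f \<in> H1" "\<And>n. fourier f (int n) = c n" by auto
  have e: "ext f w = F w" if "norm w < 1" for w
    unfolding ext_def f(2) using c[OF that] by (simp add: sums_iff)
  note ev = eventually_at_left_1_Ioo
  have lim: "AE x in circ. ((\<lambda>r. F (of_real r * x)) \<longlongrightarrow> f x) (at_left 1)"
    using ext_radial_limit[OF f(1)] AE_circ_sphere
  proof eventually_elim
    case (elim x)
    have "eventually (\<lambda>r. ext f (of_real r * x) = F (of_real r * x)) (at_left 1)"
      using ev by eventually_elim (use elim in \<open>auto intro!: e simp: norm_mult\<close>)
    with elim(1) show ?case by (rule Lim_transform_eventually)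
  qed
  have b: "AE x in circ. norm (f x) \<le> M"
    using lim AE_circ_sphere
  proof eventually_elim
    case (elim x)
    have "eventually (\<lambda>r. norm (F (of_real r * x)) \<le> M) (at_left 1)"
      using ev by eventually_elim (use elim in \<open>auto intro!: bd simp: norm_mult\<close>)
    then show ?case using tendsto_upperbound[OF tendsto_norm[OF elim(1)]] by simp
  qed
  have "f \<in> Hinf" using f(1) b by (auto simp: H1_def Hinf_def Linf_def)
  then show ?thesis using that e b lim by blast
qed

lemma norm_ext_le:
  assumes f: "f \<in> H1" and b: "AE z in circ. norm (f z) \<le> M" and w: "norm w < 1"
  shows "norm (ext f w) \<le> M"
proof -
  have i: "integrable circ f" using f by (simp add: H1_def)
  have "norm (ext f w) \<le> (\<integral>z. norm (of_real (poisson w z) * f z) \<partial>circ)"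
    unfolding ext_eq_poisson[OF f w] by (rule integral_norm_bound)
  also have "\<dots> \<le> (\<integral>z. poisson w z * M \<partial>circ)"
  proof (rule integral_mono_AE)
    show "AE z in circ. norm (of_real (poisson w z) * f z) \<le> poisson w z * M"
      using b by eventually_elim (auto simp: norm_mult poisson_nonneg[OF w] intro!: mult_left_mono)
  qed (use integrable_poisson[OF i w] integrable_poisson[OF _ w, of "\<lambda>_. M"] in auto)
  also have "\<dots> = M" using integral_poisson[OF w] by simp
  finally show ?thesis .
qed

section \<open>The conjugate function as a principal value\<close>

text \<open>The imaginary part of \<open>f\<close> could only fail to converge by jumping between
  values differing by multiples of \<open>2 pi\<close>, which continuity on an interval
  forbids.\<close>

lemma exp_limit_imp_limit:
  fixes f :: "real \<Rightarrow> complex"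
  assumes cont: "continuous_on {0<..<1} f" and lim: "((\<lambda>r. exp (f r)) \<longlongrightarrow> L) (at_left 1)" and L: "L \<noteq> 0"
  shows "\<exists>l. (f \<longlongrightarrow> l) (at_left 1)"
proof -
  define g where "g r = f r - Ln L" for r
  have eg: "exp (g r) = exp (f r) / L" for r using L by (simp add: g_def exp_diff)
  have "((\<lambda>r. exp (f r) / L) \<longlongrightarrow> L / L) (at_left 1)"
    by (intro tendsto_intros lim L)
  then have lim1: "((\<lambda>r. exp (g r)) \<longlongrightarrow> 1) (at_left 1)" using L by (simp add: eg)
  then have "eventually (\<lambda>r. dist (exp (g r)) 1 < 1/2) (at_left 1)"
    by (rule tendstoD) simp
  then obtain b where b: "b < 1" "\<And>y. b < y \<Longrightarrow> y < 1 \<Longrightarrow> dist (exp (g y)) 1 < 1/2"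
    by (subst (asm) eventually_at_left[of 0]) auto
  define S where "S = {max b 0<..<1}"
  have near: "dist (exp (g y)) 1 < 1/2" if "y \<in> S" for y using b(2) that by (auto simp: S_def)
  have nonpos: "exp (g y) \<notin> \<real>\<^sub>\<le>\<^sub>0" if "y \<in> S" for y
  proof
    assume "exp (g y) \<in> \<real>\<^sub>\<le>\<^sub>0"
    then have "Re (exp (g y)) \<le> 0" by (simp add: complex_nonpos_Reals_iff)
    moreover have "\<bar>Re (exp (g y) - 1)\<bar> < 1/2"
      using abs_Re_le_cmod[of "exp (g y) - 1"] near[OF that] by (simp add: dist_norm)
    ultimately show False by simp
  qed
  have cg: "continuous_on S g" unfolding g_def S_def
    by (intro continuous_intros continuous_on_subset[OF cont]) auto
  \<comment> \<open>Near 1 the values \<open>exp (g r)\<close> avoid the cut of \<open>Ln\<close>,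
    so \<open>q\<close> is continuous; its values lie in \<open>2 pi i\<close> times the integers,
    hence it is constant. A gap of 1 between distinct values is all that the discreteness criterion
    asks.\<close>
  define q where "q r = g r - Ln (exp (g r))" for r
  have cq: "continuous_on S q" unfolding q_def
    by (intro continuous_intros cg nonpos)
  have eq: "exp (q r) = 1" for r by (simp add: q_def exp_diff)
  have "q constant_on S"
  proof (rule continuous_discrete_range_constant[OF _ cq])
    show "connected S" by (simp add: S_def)
    fix x assume "x \<in> S"
    show "\<exists>e>0. \<forall>y. y \<in> S \<and> q y \<noteq> q x \<longrightarrow> e \<le> norm (q y - q x)"
    proof (intro exI[of _ 1] conjI allI impI)
      fix y assume y: "y \<in> S \<and> q y \<noteq> q x"
      have "exp (q y - q x) = 1" by (simp add: exp_diff eq)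
      then obtain n :: int where n: "Re (q y - q x) = 0" "Im (q y - q x) = of_int (2 * n) * pi"
        by (auto simp: exp_eq_1)
      have "n \<noteq> 0" using n y by (auto simp: complex_eq_iff)
      then have "1 \<le> \<bar>real_of_int n\<bar>" by linarith
      then have "1 * 1 \<le> \<bar>real_of_int n\<bar> * (2 * pi)" using pi_ge_two by (intro mult_mono) auto
      also have "\<dots> = \<bar>Im (q y - q x)\<bar>" using n(2) by (simp add: abs_mult)
      also have "\<dots> \<le> norm (q y - q x)" by (rule abs_Im_le_cmod)
      finally show "1 \<le> norm (q y - q x)" by simp
    qed simp
  qed
  then obtain c where c: "\<And>r. r \<in> S \<Longrightarrow> q r = c" by (auto simp: constant_on_def)
  have "((\<lambda>r. Ln (exp (g r))) \<longlongrightarrow> Ln 1) (at_left 1)"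
    by (rule tendsto_Ln[OF lim1]) simp
  then have "((\<lambda>r. Ln L + c + Ln (exp (g r))) \<longlongrightarrow> Ln L + c + Ln 1) (at_left 1)"
    by (intro tendsto_add tendsto_const)
  moreover have "eventually (\<lambda>r. r \<in> S) (at_left 1)"
    unfolding S_def using b by (intro eventually_at_leftI[of "max b 0"]) auto
  then have "eventually (\<lambda>r. Ln L + c + Ln (exp (g r)) = f r) (at_left 1)"
  proof eventually_elim
    case (elim r)
    have "g r - Ln (exp (g r)) = c" using c[OF elim] by (simp add: q_def)
    then show ?case by (simp add: g_def algebra_simps)
  qed
  ultimately show ?thesis using Lim_transform_eventually by blast
qed

text \<open>The conjugate Poisson kernel \<open>2 r sin t / (1 - 2 r cos t + r^2)\<close>, in the
  angle \<open>t\<close> for which the boundary point is \<open>x * cis (- t)\<close>. The reflected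
  angle gives it the sign of the \<open>cot (t / 2)\<close> in \<open>conj_fun\<close>.\<close>

definition conj_kernel :: "real \<Rightarrow> real \<Rightarrow> real" where
  "conj_kernel r t = 2 * r * sin t / (norm (cis (- t) - of_real r))\<^sup>2"

section \<open>Conjugate Poisson means against truncated principal values\<close>

lemma norm_cis_minus_real:
  "(norm (cis (- t) - of_real r))\<^sup>2 = (1 - r)\<^sup>2 + 4 * r * (sin (t / 2))\<^sup>2"
proof -
  have "cos t = 1 - 2 * (sin (t/2))\<^sup>2"
    using cos_double_sin[of "t/2"] by simp
  moreover have "(norm (cis (- t) - of_real r))\<^sup>2 = 1 - 2 * r * cos t + r\<^sup>2"
    using sin_cos_squared_add[of t] unfolding cmod_power2
    by (simp add: power2_eq_square algebra_simps)
  ultimately have "(norm (cis (- t) - of_real r))\<^sup>2 = 1 - 2 * r * (1 - 2 * (sin (t/2))\<^sup>2) + r\<^sup>2" by metis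
  then show ?thesis by (simp add: power2_eq_square algebra_simps)
qed

lemma Im_herglotz_kernel:
  assumes x: "norm x = 1" and r: "\<bar>r\<bar> < 1"
  shows "Im ((x * cis (- t) + of_real r * x) / (x * cis (- t) - of_real r * x)) = conj_kernel r t"
proof -
  have x0: "x \<noteq> 0" using x by auto
  have "(x * cis (- t) + of_real r * x) / (x * cis (- t) - of_real r * x) = (x * (cis (- t) + of_real r)) / (x * (cis (- t) - of_real r))"
    by (simp add: algebra_simps)
  also have "\<dots> = (cis (- t) + of_real r) / (cis (- t) - of_real r)"
    using x0 by simp
  also have "\<dots> = (cis (- t) + of_real r) * cnj (cis (- t) - of_real r) / of_real ((norm (cis (- t) - of_real r))\<^sup>2)"
    by (subst complex_div_cnj) simp
  finally have "Im ((x * cis (- t) + of_real r * x) / (x * cis (- t) - of_real r * x)) =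
      Im ((cis (- t) + of_real r) * cnj (cis (- t) - of_real r)) / (norm (cis (- t) - of_real r))\<^sup>2"
    by (simp add: Im_divide_of_real)
  then show ?thesis unfolding conj_kernel_def by (simp add: algebra_simps)
qed

lemma poisson_rotate:
  assumes x: "norm x = 1" and r: "\<bar>r\<bar> < 1"
  shows "poisson (of_real r * x) (x * cis (- t)) = (1 - r\<^sup>2) / (norm (cis (- t) - of_real r))\<^sup>2"
proof -
  have "x * cis (- t) - of_real r * x = x * (cis (- t) - of_real r)" by (simp add: algebra_simps)
  then have "norm (x * cis (- t) - of_real r * x) = norm (cis (- t) - of_real r)" using x by (simp add: norm_mult)
  then show ?thesis using x by (simp add: poisson_def norm_mult)
qed

lemma abs_cot_half_le:
  assumes "0 < \<bar>t\<bar>" "\<bar>t\<bar> < pi"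
  shows "\<bar>cot (t / 2)\<bar> \<le> 2 / \<bar>t\<bar>"
proof -
  define y where "y = \<bar>t\<bar> / 2"
  have y: "0 < y" "y < pi / 2" using assms by (auto simp: y_def)
  have "\<bar>cot (t/2)\<bar> = \<bar>cot y\<bar>" by (cases "t \<ge> 0") (auto simp: y_def cot_def)
  also have "\<dots> = 1 / tan y" using y by (simp add: cot_def tan_def abs_of_pos sin_gt_zero cos_gt_zero)
  also have "\<dots> \<le> 1 / y" using le_tan[of y] y by (intro divide_left_mono) auto
  finally show ?thesis by (simp add: y_def)
qed

text \<open>Truncation length and distance to the circle are the same \<open>e\<close>. With
  \<open>D\<close> the squared norm in the denominator, both ranges give at most
  \<open>2 e / D\<close>, which twice the Poisson kernel dominates: for \<open>|t| <= e\<close>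
  because \<open>|sin t| <= e\<close>, and for \<open>|t| > e\<close> because the difference is
  exactly \<open>- cot (t/2) * e^2 / D\<close> with \<open>|cot (t/2)| <= 2 / e\<close>.\<close>

lemma truncated_kernel_bound:
  assumes e: "0 < e" "e < 1" and t: "\<bar>t\<bar> < pi"
  shows "\<bar>conj_kernel (1 - e) t - (if e < \<bar>t\<bar> then cot (t / 2) else 0)\<bar>
     \<le> 2 * ((1 - (1 - e)\<^sup>2) / (norm (cis (- t) - of_real (1 - e)))\<^sup>2)"
proof -
  define r where "r = 1 - e"
  define D where "D = (norm (cis (- t) - of_real r))\<^sup>2"
  have D: "D = e\<^sup>2 + 4 * r * (sin (t / 2))\<^sup>2" using norm_cis_minus_real[of t r] by (simp add: D_def r_def)
  have Dp: "D > 0" using D e by (simp add: r_def add_pos_nonneg)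
  have r0: "0 \<le> r" using e by (simp add: r_def)
  have er: "e \<le> 1 - r\<^sup>2"
    using e by (simp add: r_def power2_eq_square algebra_simps)
  have eD: "2 * e / D \<le> 2 * ((1 - r\<^sup>2) / D)" using er Dp by (simp add: divide_right_mono)
  show ?thesis
  proof (cases "e < \<bar>t\<bar>")
    case False
    have "\<bar>conj_kernel r t\<bar> = 2 * r * \<bar>sin t\<bar> / D"
      using r0 Dp by (simp add: conj_kernel_def D_def[symmetric] abs_mult)
    also have "\<dots> \<le> 2 * e / D"
    proof (intro divide_right_mono)
      have "r * \<bar>sin t\<bar> \<le> 1 * e" using e False abs_sin_x_le_abs_x[of t] by (intro mult_mono) (auto simp: r_def)
      then show "2 * r * \<bar>sin t\<bar> \<le> 2 * e" by simp
    qed (use Dp in auto)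
    finally show ?thesis using False eD by (simp add: r_def[symmetric] D_def[symmetric])
  next
    case True
    define s where "s = sin (t/2)"
    define c where "c = cos (t/2)"
    have s0: "s \<noteq> 0"
    proof (cases "t > 0")
      case True
      then show ?thesis using t sin_gt_zero[of "t/2"] by (auto simp: s_def)
    next
      case False
      then show ?thesis using t \<open>e < \<bar>t\<bar>\<close> e sin_gt_zero[of "- t/2"] by (auto simp: s_def)
    qed
    have st: "sin t = 2 * s * c" using sin_double[of "t/2"] by (simp add: s_def c_def)
    have "conj_kernel r t - cot (t/2) = (4 * r * s * c) / D - c / s"
      by (simp add: conj_kernel_def D_def[symmetric] st cot_def s_def[symmetric] c_def[symmetric])
    also have "\<dots> = (4 * r * s\<^sup>2 * c - c * D) / (s * D)"
      using s0 Dp by (simp add: field_simps power2_eq_square)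
    also have "4 * r * s\<^sup>2 * c - c * D = - (c * e\<^sup>2)" by (simp add: D s_def[symmetric] algebra_simps)
    finally have "\<bar>conj_kernel r t - cot (t/2)\<bar> = \<bar>cot (t/2)\<bar> * e\<^sup>2 / D"
      using Dp by (simp add: abs_mult abs_divide cot_def s_def c_def)
    also have "\<dots> \<le> (2 / e) * e\<^sup>2 / D"
    proof (intro divide_right_mono mult_right_mono)
      have "\<bar>cot (t/2)\<bar> \<le> 2 / \<bar>t\<bar>" using True e t by (intro abs_cot_half_le) auto
      also have "\<dots> \<le> 2 / e" using True e by (intro divide_left_mono) auto
      finally show "\<bar>cot (t/2)\<bar> \<le> 2 / e" .
    qed (use Dp in auto)
    also have "\<dots> = 2 * e / D" using e by (simp add: power2_eq_square)
    finally show ?thesis using True eD by (simp add: r_def[symmetric] D_def[symmetric])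
  qed
qed

lemma set_integrable_bounded_mult:
  fixes h :: "real \<Rightarrow> real"
  assumes h: "set_integrable lborel A h" and [measurable]: "b \<in> borel_measurable borel" "h \<in> borel_measurable borel" "A \<in> sets borel"
    and b: "\<And>t. t \<in> A \<Longrightarrow> \<bar>b t\<bar> \<le> C"
  shows "set_integrable lborel A (\<lambda>t. b t * h t)"
  unfolding set_integrable_def
proof (rule Bochner_Integration.integrable_bound)
  show "integrable lborel (\<lambda>t. C * (indicator A t *\<^sub>R h t))"
    using h by (simp add: set_integrable_def)
  show "AE t in lborel. norm (indicator A t *\<^sub>R (b t * h t)) \<le> norm (C * (indicator A t *\<^sub>R h t))"
  proof (intro AE_I2)
    fix t
    show "norm (indicator A t *\<^sub>R (b t * h t)) \<le> norm (C * (indicator A t *\<^sub>R h t))"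
    proof (cases "t \<in> A")
      case True
      then have "\<bar>b t\<bar> \<le> \<bar>C\<bar>" using b[of t] by linarith
      then show ?thesis using True by (simp add: abs_mult mult_right_mono)
    qed simp
  qed
qed measurable

lemma set_integral_odd_zero:
  fixes k :: "real \<Rightarrow> real"
  assumes "\<And>t. k (- t) = - k t"
  shows "(LINT t:{-a<..<a}|lborel. k t) = 0"
proof -
  have "(LINT t:{-a<..<a}|lborel. k t) = (\<integral>t. indicator {-a<..<a} (0 + (-1) * t) *\<^sub>R k (0 + (-1) * t) \<partial>lborel)"
    unfolding set_lebesgue_integral_def
    by (subst lborel_integral_real_affine[where c="-1" and t=0]) auto
  also have "\<dots> = (\<integral>t. - (indicator {-a<..<a} t *\<^sub>R k t) \<partial>lborel)"
    by (intro Bochner_Integration.integral_cong) (auto simp: indicator_def assms)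
  also have "\<dots> = - (LINT t:{-a<..<a}|lborel. k t)" by (simp add: set_lebesgue_integral_def)
  finally show ?thesis by simp
qed

definition trunc_conj :: "(complex \<Rightarrow> real) \<Rightarrow> complex \<Rightarrow> real \<Rightarrow> real" where
  "trunc_conj v z \<epsilon> = (1 / (2*pi)) * (LINT t:{t. \<epsilon> < \<bar>t\<bar> \<and> \<bar>t\<bar> < pi}|lborel. v (z * cis (- t)) * cot (t / 2))"

lemma conj_fun_trunc: "conj_fun v z = Lim (at_right 0) (trunc_conj v z)"
  by (simp add: conj_fun_def trunc_conj_def[abs_def])

lemma trunc_conj_approx:
  assumes v: "integrable circ v" and x: "norm x = 1" and e: "0 < e" "e < 1"
  shows "\<bar>Im (\<integral>z. (z + of_real (1 - e) * x) / (z - of_real (1 - e) * x) * of_real (v z) \<partial>circ) - trunc_conj v x e\<bar>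
     \<le> 2 * (\<integral>z. poisson (of_real (1 - e) * x) z * norm (v z - v x) \<partial>circ)"
proof -
  define r where "r = 1 - e"
  have r: "\<bar>r\<bar> < 1" "0 < r" using e by (auto simp: r_def)
  have w: "norm (of_real r * x) < 1" using r x by (simp add: norm_mult)
  have xs: "x \<in> sphere 0 1" using x by simp
  have vm: "v \<in> borel_measurable circ" using v by simp
  define A where "A = {-pi<..<pi}"
  define h where "h t = v (x * cis (- t))" for t
  have [measurable]: "h \<in> borel_measurable borel" unfolding h_def by (rule measurable_circ_rotate[OF vm xs])
  have [measurable]: "A \<in> sets borel" by (simp add: A_def)
  have hi: "set_integrable lborel A h"
    unfolding h_def A_def using integrable_circ_rotate[OF xs vm] v by simp
  have [measurable]: "conj_kernel r \<in> borel_measurable borel"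
    unfolding conj_kernel_def[abs_def] norm_cis_minus_real by measurable
  define c where "c t = (if e < \<bar>t\<bar> then cot (t / 2) else 0)" for t
  have [measurable]: "c \<in> borel_measurable borel"
    unfolding c_def[abs_def] cot_def by measurable
  define k where "k t = conj_kernel r t - c t" for t
  have [measurable]: "k \<in> borel_measurable borel" unfolding k_def[abs_def] by measurable
  have cb: "\<bar>c t\<bar> \<le> 2 / e" if "t \<in> A" for t
  proof (cases "e < \<bar>t\<bar>")
    case True
    then have "\<bar>c t\<bar> \<le> 2 / \<bar>t\<bar>" using that e by (auto simp: c_def A_def intro!: abs_cot_half_le)
    also have "\<dots> \<le> 2 / e" using True e by (intro divide_left_mono) auto
    finally show ?thesis .
  qed (use e in \<open>auto simp: c_def\<close>)
  have kP: "\<bar>k t\<bar> \<le> 2 * poisson (of_real r * x) (x * cis (- t))" if "t \<in> A" for t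
    using truncated_kernel_bound[OF e, of t] that unfolding poisson_rotate[OF x r(1)]
    by (auto simp: k_def c_def r_def A_def)
  have kb: "\<bar>k t\<bar> \<le> 4 / (1 - r)" if "t \<in> A" for t
    using kP[OF that] poisson_le[OF w, of "x * cis (- t)"] x r by (simp add: norm_mult)
  have ck: "conj_kernel r t = k t + c t" for t by (simp add: k_def)
  have hk: "set_integrable lborel A (\<lambda>t. k t * h t)"
    by (rule set_integrable_bounded_mult[OF hi _ _ _ kb]) measurable
  have hc: "set_integrable lborel A (\<lambda>t. c t * h t)"
    by (rule set_integrable_bounded_mult[OF hi _ _ _ cb]) measurable
  have k1: "set_integrable lborel A (\<lambda>t. k t * v x)"
    by (rule set_integrable_bounded_mult[OF _ _ _ _ kb]) (auto simp: A_def set_integrable_def)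
  have iK: "integrable circ (\<lambda>z. (z + of_real r * x) / (z - of_real r * x) * of_real (v z))"
    using integrable_herglotz_kernel(1)[OF _ w, of "\<lambda>z. of_real (v z)"] v by simp
  have "Im (\<integral>z. (z + of_real r * x) / (z - of_real r * x) * of_real (v z) \<partial>circ)
      = (\<integral>z. Im ((z + of_real r * x) / (z - of_real r * x) * of_real (v z)) \<partial>circ)"
    using iK by simp
  also have "\<dots> = (LINT t:A|lborel. Im ((x * cis (- t) + of_real r * x) / (x * cis (- t) - of_real r * x) * of_real (v (x * cis (- t))))) /\<^sub>R (2*pi)"
    unfolding A_def by (rule integral_circ_rotate[OF xs]) (use iK in measurable)
  also have "(\<lambda>t. Im ((x * cis (- t) + of_real r * x) / (x * cis (- t) - of_real r * x) * of_real (v (x * cis (- t))))) = (\<lambda>t. conj_kernel r t * h t)"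
  proof -
    have "Im (a * of_real y) = Im a * y" for a y by simp
    then show ?thesis by (simp only: Im_herglotz_kernel[OF x r(1)] h_def)
  qed
  also have "(LINT t:A|lborel. conj_kernel r t * h t) = (LINT t:A|lborel. k t * h t) + (LINT t:A|lborel. c t * h t)"
    unfolding ck distrib_right by (rule set_integral_add(2)[OF hk hc])
  also have "(LINT t:A|lborel. c t * h t) = (LINT t:{t. e < \<bar>t\<bar> \<and> \<bar>t\<bar> < pi}|lborel. v (x * cis (- t)) * cot (t / 2))"
    unfolding set_lebesgue_integral_def
    by (rule Bochner_Integration.integral_cong) (auto simp: indicator_def A_def c_def h_def)
  finally have E: "Im (\<integral>z. (z + of_real r * x) / (z - of_real r * x) * of_real (v z) \<partial>circ) =
      ((LINT t:A|lborel. k t * h t) + (LINT t:{t. e < \<bar>t\<bar> \<and> \<bar>t\<bar> < pi}|lborel. v (x * cis (- t)) * cot (t / 2))) /\<^sub>R (2*pi)" .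
  have gen: "(a + b) /\<^sub>R (2*pi) - (1/(2*pi)) * b = a / (2*pi)" for a b :: real by (simp add: field_simps)
  have "Im (\<integral>z. (z + of_real r * x) / (z - of_real r * x) * of_real (v z) \<partial>circ) - trunc_conj v x e
     = (LINT t:A|lborel. k t * h t) / (2*pi)"
    unfolding E trunc_conj_def by (rule gen)
  \<comment> \<open>The difference kernel \<open>k\<close> is odd, so the constant
    \<open>v x\<close> may be subtracted from \<open>v\<close> for free; without this the bound
    would not tend to zero.\<close>
  also have "(LINT t:A|lborel. k t * h t) = (LINT t:A|lborel. k t * (h t - v x))"
  proof -
    have kodd: "k (- t) = - k t" for t
      unfolding k_def c_def conj_kernel_def norm_cis_minus_real by (simp add: cot_def)
    have "(LINT t:A|lborel. k t * v x) = (LINT t:{-pi<..<pi}|lborel. k t * v x)" by (simp add: A_def)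
    also have "\<dots> = 0"
      by (rule set_integral_odd_zero) (simp add: kodd)
    finally show ?thesis using set_integral_diff(2)[OF hk k1] by (simp add: right_diff_distrib)
  qed
  also have "\<bar>(LINT t:A|lborel. k t * (h t - v x)) / (2*pi)\<bar> \<le> (LINT t:A|lborel. 2 * (poisson (of_real r * x) (x * cis (- t)) * norm (h t - v x))) / (2*pi)"
  proof -
    have i1: "set_integrable lborel A (\<lambda>t. k t * (h t - v x))"
      using set_integral_diff(1)[OF hk k1] by (simp add: right_diff_distrib)
    have i0: "integrable circ (\<lambda>z. poisson (of_real r * x) z * norm (v z - v x))"
      using integrable_poisson[OF _ w, of "\<lambda>z. norm (v z - v x)"] v by simp
    have i2: "set_integrable lborel A (\<lambda>t. poisson (of_real r * x) (x * cis (- t)) * norm (h t - v x))"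
      unfolding A_def h_def using integrable_circ_rotate[OF xs borel_measurable_integrable[OF i0]] i0 by simp
    have "\<bar>LINT t:A|lborel. k t * (h t - v x)\<bar> \<le> (LINT t:A|lborel. norm (k t * (h t - v x)))"
      using set_integral_norm_bound[OF i1] by simp
    also have "\<dots> \<le> (LINT t:A|lborel. 2 * (poisson (of_real r * x) (x * cis (- t)) * norm (h t - v x)))"
    proof (rule set_integral_mono)
      show "set_integrable lborel A (\<lambda>t. norm (k t * (h t - v x)))" using i1 by (rule set_integrable_norm)
      show "set_integrable lborel A (\<lambda>t. 2 * (poisson (of_real r * x) (x * cis (- t)) * norm (h t - v x)))"
        using i2 by (rule set_integrable_mult_right)
      fix t assume "t \<in> A"
      from mult_right_mono[OF kP[OF this], of "norm (h t - v x)"]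
      show "norm (k t * (h t - v x)) \<le> 2 * (poisson (of_real r * x) (x * cis (- t)) * norm (h t - v x))"
        by (simp add: abs_mult)
    qed
    finally have F: "\<bar>LINT t:A|lborel. k t * (h t - v x)\<bar> \<le> \<dots>" .
    have pos: "0 \<le> 2 * pi" by simp
    from divide_right_mono[OF F pos] show ?thesis by (simp only: abs_divide abs_of_nonneg[OF pos])
  qed
  also have "\<dots> = 2 * (\<integral>z. poisson (of_real r * x) z * norm (v z - v x) \<partial>circ)"
  proof -
    have "(\<integral>z. poisson (of_real r * x) z * norm (v z - v x) \<partial>circ) = (LINT t:A|lborel. poisson (of_real r * x) (x * cis (- t)) * norm (h t - v x)) /\<^sub>R (2*pi)"
      unfolding A_def h_def by (rule integral_circ_rotate[OF xs]) (use vm in measurable)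
    moreover have "(2 * a) / (2*pi) = 2 * (a /\<^sub>R (2*pi))" for a :: real by (simp add: field_simps)
    ultimately show ?thesis by (simp only: set_integral_mult_right)
  qed
  finally show ?thesis unfolding r_def .
qed

text \<open>At a Lebesgue point the truncations differ from the conjugate Poisson means by a
  quantity tending to zero, so the \<open>Lim\<close> in \<open>conj_fun\<close> is a genuine limit
  as soon as the Herglotz integral converges radially.\<close>

lemma conj_fun_eq_radial_limit:
  assumes v: "integrable circ v" and x: "norm x = 1"
    and fl: "((\<lambda>r. \<integral>z. poisson (of_real r * x) z * norm (v z - v x) \<partial>circ) \<longlongrightarrow> 0) (at_left 1)"
    and lim: "((\<lambda>r. \<integral>z. (z + of_real r * x) / (z - of_real r * x) * of_real (v z) \<partial>circ) \<longlongrightarrow> L) (at_left 1)"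
  shows "conj_fun v x = Im L"
proof -
  have fl1: "filterlim (\<lambda>e::real. 1 - e) (at_left 1) (at_right 0)"
    unfolding filterlim_at
    by (auto intro!: tendsto_eq_intros eventually_at_rightI[of 0 1])
  have l1: "((\<lambda>e. Im (\<integral>z. (z + of_real (1 - e) * x) / (z - of_real (1 - e) * x) * of_real (v z) \<partial>circ)) \<longlongrightarrow> Im L) (at_right 0)"
    by (rule tendsto_Im[OF filterlim_compose[OF lim fl1]])
  have l2: "((\<lambda>e. 2 * (\<integral>z. poisson (of_real (1 - e) * x) z * norm (v z - v x) \<partial>circ)) \<longlongrightarrow> 0) (at_right 0)"
    using tendsto_mult[OF tendsto_const[of 2] filterlim_compose[OF fl fl1]] by simp
  have ev: "eventually (\<lambda>e::real. 0 < e \<and> e < 1) (at_right 0)"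
    by (rule eventually_at_rightI[of 0 1]) auto
  have "((\<lambda>e. Im (\<integral>z. (z + of_real (1 - e) * x) / (z - of_real (1 - e) * x) * of_real (v z) \<partial>circ) - trunc_conj v x e) \<longlongrightarrow> 0) (at_right 0)"
    by (rule Lim_null_comparison[OF _ l2])
       (use ev in \<open>eventually_elim, use trunc_conj_approx[OF v x] in auto\<close>)
  from tendsto_diff[OF l1 this] have "(trunc_conj v x \<longlongrightarrow> Im L) (at_right 0)" by simp
  then show ?thesis unfolding conj_fun_trunc by (intro tendsto_Lim) auto
qed

section \<open>Blaschke products\<close>

text \<open>Schwarz's lemma for the closed bound 1: scaling by \<open>c < 1\<close> produces the
  strict inequality the classical version asks for, and then \<open>c\<close> tends to 1.\<close>

lemma schwarz_le:
  assumes hol: "f holomorphic_on ball 0 1" and f0: "f 0 = 0" and bd: "\<And>w. norm w < 1 \<Longrightarrow> norm (f w) \<le> 1"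
    and w: "norm w < 1"
  shows "norm (f w) \<le> norm w"
proof (rule field_le_mult_one_interval)
  fix c :: real assume c: "0 < c" "c < 1"
  have "norm (of_real c * f w) \<le> norm w"
  proof (rule Schwarz_Lemma(1)[of "\<lambda>w. of_real c * f w"])
    show "(\<lambda>w. of_real c * f w) holomorphic_on ball 0 1" using hol by (intro holomorphic_intros)
    fix z :: complex assume "norm z < 1"
    then have "c * norm (f z) \<le> c * 1" using bd c by (intro mult_left_mono) auto
    then have "c * norm (f z) < 1" using c by linarith
    then show "norm (of_real c * f z) < 1" using c by (simp add: norm_mult)
  qed (use f0 w in auto)
  then show "c * norm (f w) \<le> norm w" using c by (simp add: norm_mult)
qed

lemma schwarz_pick_zero:
  assumes hol: "f holomorphic_on ball 0 1" and bd: "\<And>w. norm w < 1 \<Longrightarrow> norm (f w) \<le> 1"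
    and a: "norm a < 1" "f a = 0" and w: "norm w < 1"
  shows "norm (f w) \<le> norm (Moebius_function 0 a w)"
proof -
  define h where "h = f \<circ> Moebius_function 0 (- a)"
  have M1: "norm (Moebius_function 0 (- a) z) < 1" if "norm z < 1" for z
    using Moebius_function_norm_lt_1[of "- a" z] a that by simp
  have "h holomorphic_on ball 0 1" unfolding h_def
  proof (rule holomorphic_on_compose_gen[OF _ hol])
    show "Moebius_function 0 (- a) holomorphic_on ball 0 1" using a by (intro Moebius_function_holomorphic) simp
  qed (use M1 in auto)
  moreover have "h 0 = 0" using a by (simp add: h_def Moebius_function_of_zero)
  moreover have "norm (h z) \<le> 1" if "norm z < 1" for z using bd M1[OF that] by (simp add: h_def)
  ultimately have "norm (h (Moebius_function 0 a w)) \<le> norm (Moebius_function 0 a w)"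
    using Moebius_function_norm_lt_1[OF a(1) w] by (intro schwarz_le) auto
  moreover have "Moebius_function 0 (- a) (Moebius_function 0 a w) = w"
    using a w by (intro Moebius_function_compose) auto
  ultimately show ?thesis by (simp add: h_def)
qed

text \<open>The unit \<open>u\<close> turns \<open>w - a\<close> into a factor with the modulus of
  the Moebius map, so Schwarz-Pick bounds the quotient by 1 off \<open>a\<close>, and continuity
  does so at \<open>a\<close>. One statement serves zeros at the origin (\<open>u = 1\<close>) and
  Blaschke factors.\<close>

lemma divide_zero:
  assumes hol: "f holomorphic_on ball 0 1" and bd: "\<And>w. norm w < 1 \<Longrightarrow> norm (f w) \<le> 1"
    and a: "norm a < 1" "f a = 0"
    and u: "u holomorphic_on ball 0 1" "\<And>w. norm w < 1 \<Longrightarrow> u w \<noteq> 0"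
      "\<And>w. norm w < 1 \<Longrightarrow> norm ((w - a) * u w) = norm (Moebius_function 0 a w)"
  shows "\<exists>g. g holomorphic_on ball 0 1 \<and> (\<forall>w. norm w < 1 \<longrightarrow> norm (g w) \<le> 1 \<and> f w = (w - a) * u w * g w)"
proof -
  define q where "q z = (if z = a then deriv f a else (f z - f a) / (z - a))" for z
  have q: "q holomorphic_on ball 0 1" unfolding q_def[abs_def]
    by (rule pole_lemma[OF hol]) (use a in auto)
  define g where "g z = q z / u z" for z
  have g: "g holomorphic_on ball 0 1" unfolding g_def using q u by (intro holomorphic_intros) auto
  have fg: "f w = (w - a) * u w * g w" if "norm w < 1" for w
    using u(2)[OF that] a by (auto simp: g_def q_def)
  have ga: "norm (g w) \<le> 1" if w: "norm w < 1" "w \<noteq> a" for w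
  proof -
    have "norm ((w - a) * u w) * norm (g w) \<le> norm ((w - a) * u w) * 1"
      using schwarz_pick_zero[OF hol bd a w(1)] fg[OF w(1)] u(3)[OF w(1)] by (simp add: norm_mult)
    moreover have "norm ((w - a) * u w) > 0" using w u(2) by simp
    ultimately show ?thesis by (simp only: mult_le_cancel_left_pos)
  qed
  have "norm (g a) \<le> 1"
  proof (rule tendsto_upperbound)
    have "isCont g a" using g a holomorphic_on_imp_continuous_on
      by (metis continuous_on_interior interior_ball mem_ball_0)
    then show "((\<lambda>w. norm (g w)) \<longlongrightarrow> norm (g a)) (at a)" by (intro tendsto_norm) (simp add: isCont_def)
    have "eventually (\<lambda>w. w \<in> ball 0 1 - {a}) (at a)"
      using a by (auto simp: eventually_at_topological intro!: exI[of _ "ball 0 1"])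
    then show "eventually (\<lambda>w. norm (g w) \<le> 1) (at a)" by eventually_elim (use ga in auto)
  qed simp
  then have "norm (g w) \<le> 1" if "norm w < 1" for w using ga[OF that] by (cases "w = a") auto
  then show ?thesis using g fg by blast
qed

section \<open>Blaschke factors and removal of zeros\<close>

definition blaschke_factor :: "complex \<Rightarrow> complex \<Rightarrow> complex" where
  "blaschke_factor a w = (of_real (norm a) / a) * (a - w) / (1 - cnj a * w)"

lemma one_minus_cnj_mult_nz:
  assumes "norm a < 1" "norm w \<le> 1"
  shows "1 - cnj a * w \<noteq> 0"
proof
  assume "1 - cnj a * w = 0"
  then have "norm (cnj a * w) = 1" by (metis eq_iff_diff_eq_0 norm_one)
  moreover have "norm a * norm w \<le> norm a * 1" using assms by (intro mult_left_mono) auto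
  ultimately show False using assms by (simp add: norm_mult)
qed

lemma norm_blaschke_factor:
  assumes "a \<noteq> 0"
  shows "norm (blaschke_factor a w) = norm (Moebius_function 0 a w)"
  using assms by (simp add: blaschke_factor_def Moebius_function_simple norm_mult norm_divide norm_minus_commute)

lemma norm_blaschke_factor_le:
  assumes "a \<noteq> 0" "norm a < 1" "norm w < 1"
  shows "norm (blaschke_factor a w) \<le> 1"
  using norm_blaschke_factor[OF assms(1)] Moebius_function_norm_lt_1[OF assms(2,3)] by (simp add: less_imp_le)

lemma blaschke_factor_holomorphic:
  assumes "norm a < 1"
  shows "blaschke_factor a holomorphic_on ball 0 1"
  unfolding blaschke_factor_def[abs_def] using one_minus_cnj_mult_nz[OF assms]
  by (intro holomorphic_intros) auto

text \<open>The numerator of \<open>blaschke_factor a w - 1\<close> is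
  \<open>- (1 - |a|) (a + |a| w)\<close>, and the \<open>|a|\<close> cancels. The point
  \<open>w\<close> is not confined to the disc: the estimate is used on both sides of an arc of the
  circle.\<close>

lemma one_minus_blaschke_factor:
  assumes a: "a \<noteq> 0" and w: "1 - cnj a * w \<noteq> 0"
  shows "norm (blaschke_factor a w - 1) \<le> \<bar>1 - norm a\<bar> * (1 + norm w) / norm (1 - cnj a * w)"
proof -
  have aa: "a * cnj a = of_real (norm a) * of_real (norm a)"
    using complex_norm_square[of a] by (simp add: power2_eq_square)
  have "blaschke_factor a w - 1 = (of_real (norm a) * (a - w) - a * (1 - cnj a * w)) / (a * (1 - cnj a * w))"
    unfolding blaschke_factor_def using a w by (simp add: diff_divide_distrib)
  also have "of_real (norm a) * (a - w) - a * (1 - cnj a * w) = - (of_real (1 - norm a) * (a + of_real (norm a) * w))"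
  proof -
    have "a * (1 - cnj a * w) = a - of_real (norm a) * of_real (norm a) * w"
      unfolding aa[symmetric] by (simp add: algebra_simps)
    then show ?thesis by (simp only:) (simp add: algebra_simps)
  qed
  finally have "norm (blaschke_factor a w - 1) = \<bar>1 - norm a\<bar> * norm (a + of_real (norm a) * w) / (norm a * norm (1 - cnj a * w))"
    by (simp add: norm_divide norm_mult del: of_real_diff)
  also have "\<dots> \<le> \<bar>1 - norm a\<bar> * (norm a * (1 + norm w)) / (norm a * norm (1 - cnj a * w))"
    using norm_triangle_ineq[of a "of_real (norm a) * w"]
    by (intro divide_right_mono mult_left_mono) (auto simp: norm_mult algebra_simps)
  also have "\<dots> = \<bar>1 - norm a\<bar> * (1 + norm w) / norm (1 - cnj a * w)" using a by simp
  finally show ?thesis .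
qed

lemma divide_blaschke_factor:
  assumes hol: "f holomorphic_on ball 0 1" and bd: "\<And>w. norm w < 1 \<Longrightarrow> norm (f w) \<le> 1"
    and a: "norm a < 1" "a \<noteq> 0" "f a = 0"
  shows "\<exists>g. g holomorphic_on ball 0 1 \<and> (\<forall>w. norm w < 1 \<longrightarrow> norm (g w) \<le> 1 \<and> f w = blaschke_factor a w * g w)"
proof -
  define u where "u w = - (of_real (norm a) / a) / (1 - cnj a * w)" for w
  have eq: "(w - a) * u w = blaschke_factor a w" for w
    unfolding u_def blaschke_factor_def by (metis (no_types, lifting) minus_diff_eq minus_mult_minus mult.commute mult.left_commute mult_minus_right times_divide_eq_right)
  have "u holomorphic_on ball 0 1"
    unfolding u_def[abs_def] using one_minus_cnj_mult_nz[OF a(1)] a by (intro holomorphic_intros) auto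
  moreover have "u w \<noteq> 0" if "norm w < 1" for w
    using one_minus_cnj_mult_nz[OF a(1), of w] a that by (simp add: u_def)
  ultimately show ?thesis
    using divide_zero[OF hol bd a(1,3), of u] norm_blaschke_factor[OF a(2)] unfolding eq by blast
qed

text \<open>If the division by \<open>w\<close> never stopped, \<open>|f w0| <= |w0| ^ n\<close>
  would hold for every \<open>n\<close>, contradicting \<open>f w0 \<noteq> 0\<close>.\<close>

lemma factor_order_at_0:
  assumes hol: "f holomorphic_on ball 0 1" and bd: "\<And>w. norm w < 1 \<Longrightarrow> norm (f w) \<le> 1"
    and nz: "norm w0 < 1" "f w0 \<noteq> 0"
  shows "\<exists>m g. g holomorphic_on ball 0 1 \<and> g 0 \<noteq> 0 \<and> (\<forall>w. norm w < 1 \<longrightarrow> norm (g w) \<le> 1 \<and> f w = w ^ m * g w)"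
proof (rule ccontr)
  assume no: "\<not> ?thesis"
  have ex: "\<exists>g. g holomorphic_on ball 0 1 \<and> (\<forall>w. norm w < 1 \<longrightarrow> norm (g w) \<le> 1 \<and> f w = w ^ n * g w)" for n
  proof (induction n)
    case 0
    then show ?case using hol bd by (intro exI[of _ f]) auto
  next
    case (Suc n)
    then obtain g where g: "g holomorphic_on ball 0 1" "\<And>w. norm w < 1 \<Longrightarrow> norm (g w) \<le> 1 \<and> f w = w ^ n * g w" by auto
    then have "g 0 = 0" using no by blast
    with divide_zero[OF g(1), of 0 "\<lambda>_. 1"] g(2)
    obtain h where h: "h holomorphic_on ball 0 1" "\<And>w. norm w < 1 \<Longrightarrow> norm (h w) \<le> 1 \<and> g w = w * h w"
      by (auto simp: Moebius_function_simple)
    then show ?case using g(2) by (intro exI[of _ h]) auto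
  qed
  have "norm (f w0) \<le> norm w0 ^ n" for n
  proof -
    obtain g where "norm (g w0) \<le> 1" "f w0 = w0 ^ n * g w0" using ex[of n] nz by auto
    then show ?thesis by (simp add: norm_mult norm_power mult_left_le)
  qed
  moreover have "(\<lambda>n. norm w0 ^ n) \<longlonglongrightarrow> 0" using nz by (intro LIMSEQ_realpow_zero) auto
  ultimately have "norm (f w0) \<le> 0" by (intro LIMSEQ_le_const) auto
  then show False using nz by simp
qed

text \<open>Zeros will be removed in order of modulus. This choice is what later guarantees that
  none survives in the limit.\<close>

lemma minimal_zero:
  assumes hol: "f holomorphic_on ball 0 1" and z: "norm z < 1" "f z = 0"
  shows "\<exists>a. norm a < 1 \<and> f a = 0 \<and> (\<forall>w. norm w < 1 \<longrightarrow> f w = 0 \<longrightarrow> norm a \<le> norm w)"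
proof -
  define Z where "Z = cball 0 (norm z) \<inter> f -` {0}"
  have "continuous_on (cball 0 (norm z)) f"
    using z by (intro holomorphic_on_imp_continuous_on holomorphic_on_subset[OF hol]) auto
  then have "closed Z" unfolding Z_def by (intro continuous_closed_preimage) auto
  then have "compact Z" unfolding Z_def by (metis compact_Int_closed compact_cball inf.idem inf_assoc inf_commute)
  moreover have "z \<in> Z" using z by (simp add: Z_def)
  ultimately obtain a where a: "a \<in> Z" "\<And>w. w \<in> Z \<Longrightarrow> norm a \<le> norm w"
    using continuous_attains_inf[of Z norm] continuous_on_norm_id by (metis empty_iff)
  have "norm a \<le> norm w" if w: "norm w < 1" "f w = 0" for w
  proof (cases "norm w \<le> norm z")
    case True
    then show ?thesis using a(2)[of w] w by (simp add: Z_def)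
  next
    case False
    then show ?thesis using a(2)[OF \<open>z \<in> Z\<close>] by simp
  qed
  moreover have "norm a < 1" "f a = 0" using a(1) z by (auto simp: Z_def)
  ultimately show ?thesis by blast
qed

section \<open>Infinite Blaschke products\<close>

abbreviation blaschke_seq :: "(nat \<Rightarrow> complex) \<Rightarrow> nat set \<Rightarrow> nat \<Rightarrow> complex \<Rightarrow> complex" where
  "blaschke_seq a K n w \<equiv> (if n \<in> K then blaschke_factor (a n) w else 1)"

text \<open>Weierstrass test with \<open>(1 - |a n|) * 3 / d\<close>, where 3 bounds
  \<open>1 + |w|\<close>. Allowing \<open>|w| <= 2\<close> lets \<open>A\<close> be a neighbourhood
  of a boundary point kept away from the poles.\<close>

lemma blaschke_seq_uniform_limit:
  assumes a: "\<And>n. n \<in> K \<Longrightarrow> norm (a n) < 1 \<and> a n \<noteq> 0"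
    and s: "summable (\<lambda>n. if n \<in> K then 1 - norm (a n) else 0)"
    and A: "compact A" "\<And>w. w \<in> A \<Longrightarrow> norm w \<le> 2"
    and d: "d > 0" "\<And>n w. n \<in> K \<Longrightarrow> w \<in> A \<Longrightarrow> d \<le> norm (1 - cnj (a n) * w)"
  shows "uniform_limit A (\<lambda>N w. \<Prod>n<N. blaschke_seq a K n w) (\<lambda>w. \<Prod>n. blaschke_seq a K n w) sequentially"
    and "continuous_on A (\<lambda>w. \<Prod>n. blaschke_seq a K n w)"
proof -
  define M where "M n = (if n \<in> K then 1 - norm (a n) else 0) * (3 / d)" for n
  have M: "summable M" unfolding M_def using s by (rule summable_mult2)
  have nz: "1 - cnj (a n) * w \<noteq> 0" if "n \<in> K" "w \<in> A" for n w using d(2)[OF that] d(1) by auto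
  have bd: "norm (blaschke_seq a K n w - 1) \<le> M n" if w: "w \<in> A" for n w
  proof (cases "n \<in> K")
    case True
    have "norm (blaschke_factor (a n) w - 1) \<le> \<bar>1 - norm (a n)\<bar> * (1 + norm w) / norm (1 - cnj (a n) * w)"
      using one_minus_blaschke_factor[of "a n" w] a[OF True] nz[OF True w] by auto
    also have "\<dots> \<le> (1 - norm (a n)) * 3 / d"
      using a[OF True] A(2)[OF w] d(1) d(2)[OF True w] by (intro frac_le mult_mono) auto
    finally show ?thesis using True by (simp add: M_def)
  qed (simp add: M_def)
  have cont: "continuous_on A (blaschke_seq a K n)" for n
    using nz[of n] a[of n] by (cases "n \<in> K") (auto simp: blaschke_factor_def intro!: continuous_intros)
  have "uniformly_convergent_on A (\<lambda>N w. \<Sum>n<N. norm (blaschke_seq a K n w - 1))"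
    by (rule Weierstrass_m_test'[OF _ M]) (use bd in auto)
  then have "uniformly_convergent_on A (\<lambda>N w. \<Prod>n<N. blaschke_seq a K n w)"
    by (intro uniformly_convergent_on_prod'[OF cont A(1)])
  then have ul: "uniform_limit A (\<lambda>N w. \<Prod>n<N. blaschke_seq a K n w) (\<lambda>w. lim (\<lambda>N. \<Prod>n<N. blaschke_seq a K n w)) sequentially"
    by (simp add: uniformly_convergent_uniform_limit_iff)
  have pr: "(\<lambda>N. \<Prod>n<N. blaschke_seq a K n w) \<longlonglongrightarrow> (\<Prod>n. blaschke_seq a K n w)" if w: "w \<in> A" for w
  proof -
    have "summable (\<lambda>n. norm (blaschke_seq a K n w - 1))"
      by (rule summable_comparison_test'[OF M, of 0]) (use bd[OF w] in auto)
    then have "convergent_prod (\<lambda>n. blaschke_seq a K n w)"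
      by (intro abs_convergent_prod_imp_convergent_prod) (simp only: abs_convergent_prod_conv_summable)
    from convergent_prod_LIMSEQ[OF this] show ?thesis
      by (subst LIMSEQ_lessThan_iff_atMost)
  qed
  show u: "uniform_limit A (\<lambda>N w. \<Prod>n<N. blaschke_seq a K n w) (\<lambda>w. \<Prod>n. blaschke_seq a K n w) sequentially"
    by (rule uniform_limit_cong'[THEN iffD1, OF _ _ ul]) (use pr limI in auto)
  show "continuous_on A (\<lambda>w. \<Prod>n. blaschke_seq a K n w)"
    by (rule uniform_limit_theorem[OF _ u]) (auto intro!: always_eventually continuous_on_prod cont)
qed

lemma norm_one_minus_cnj_mult_ge:
  assumes "norm a \<le> 1"
  shows "1 - norm w \<le> norm (1 - cnj a * w)"
proof -
  have "norm (cnj a * w) \<le> 1 * norm w" unfolding norm_mult using assms by (intro mult_right_mono) auto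
  then show ?thesis using norm_triangle_ineq2[of 1 "cnj a * w"] by simp
qed

lemma blaschke_seq_holomorphic:
  assumes a: "\<And>n. n \<in> K \<Longrightarrow> norm (a n) < 1 \<and> a n \<noteq> 0"
    and s: "summable (\<lambda>n. if n \<in> K then 1 - norm (a n) else 0)"
  shows "(\<lambda>w. \<Prod>n. blaschke_seq a K n w) holomorphic_on ball 0 1"
    and "\<And>w. norm w < 1 \<Longrightarrow> (\<lambda>N. \<Prod>n<N. blaschke_seq a K n w) \<longlonglongrightarrow> (\<Prod>n. blaschke_seq a K n w)"
    and "\<And>w. norm w < 1 \<Longrightarrow> norm (\<Prod>n. blaschke_seq a K n w) \<le> 1"
proof -
  have ul: "uniform_limit (cball 0 r) (\<lambda>N w. \<Prod>n<N. blaschke_seq a K n w) (\<lambda>w. \<Prod>n. blaschke_seq a K n w) sequentially"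
    if r: "r < 1" for r
  proof (rule blaschke_seq_uniform_limit(1)[OF a s, where d="1 - r"])
    fix n and w :: complex assume "n \<in> K" "w \<in> cball 0 r"
    then show "1 - r \<le> norm (1 - cnj (a n) * w)" using norm_one_minus_cnj_mult_ge[of "a n" w] a[of n] by auto
  qed (use r in auto)
  have hol: "blaschke_seq a K n holomorphic_on ball 0 1" for n
    using a[of n] blaschke_factor_holomorphic[of "a n"] by (cases "n \<in> K") auto
  show "(\<lambda>w. \<Prod>n. blaschke_seq a K n w) holomorphic_on ball 0 1"
  proof (rule holomorphic_uniform_sequence[where f="\<lambda>N w. \<Prod>n<N. blaschke_seq a K n w"])
    show "(\<lambda>w. \<Prod>n<N. blaschke_seq a K n w) holomorphic_on ball 0 1" for N
      by (intro holomorphic_on_prod hol)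
    fix x :: complex assume x: "x \<in> ball 0 1"
    define d where "d = (1 - norm x) / 2"
    have d: "d > 0" using x by (simp add: d_def)
    have sub: "cball x d \<subseteq> cball 0 (norm x + d)"
    proof
      fix y assume "y \<in> cball x d"
      then have "norm (y - x) \<le> d" by (simp add: dist_norm norm_minus_commute)
      then show "y \<in> cball 0 (norm x + d)" using norm_triangle_ineq2[of y x] by simp
    qed
    have xd: "norm x + d < 1" using x by (simp add: d_def field_simps)
    then have "cball x d \<subseteq> ball 0 1" using sub by (auto intro: order_le_less_trans)
    then show "\<exists>d>0. cball x d \<subseteq> ball 0 1 \<and> uniform_limit (cball x d) (\<lambda>N w. \<Prod>n<N. blaschke_seq a K n w) (\<lambda>w. \<Prod>n. blaschke_seq a K n w) sequentially"
      using d uniform_limit_on_subset[OF ul[OF xd] sub] by blast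
  qed simp
  show lim: "(\<lambda>N. \<Prod>n<N. blaschke_seq a K n w) \<longlonglongrightarrow> (\<Prod>n. blaschke_seq a K n w)" if "norm w < 1" for w
    using tendsto_uniform_limitI[OF ul[OF that]] by simp
  show "norm (\<Prod>n. blaschke_seq a K n w) \<le> 1" if w: "norm w < 1" for w
  proof (rule LIMSEQ_le_const2[OF tendsto_norm[OF lim[OF w]]])
    have "norm (\<Prod>n<N. blaschke_seq a K n w) \<le> 1" for N
      unfolding prod_norm[symmetric] using a norm_blaschke_factor_le w by (intro prod_le_1) auto
    then show "\<exists>N. \<forall>n\<ge>N. norm (\<Prod>n<n. blaschke_seq a K n w) \<le> 1" by blast
  qed
qed

theorem blaschke_decomposition:
  assumes hol: "f holomorphic_on ball 0 1" and bd: "\<And>w. norm w < 1 \<Longrightarrow> norm (f w) \<le> 1"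
    and nz: "norm w0 < 1" "f w0 \<noteq> 0"
  obtains m a K s where "\<And>n. n \<in> K \<Longrightarrow> norm (a n) < 1 \<and> a n \<noteq> 0"
    "summable (\<lambda>n. if n \<in> K then 1 - norm (a n) else 0)"
    "s holomorphic_on ball 0 1" "\<And>w. norm w < 1 \<Longrightarrow> norm (s w) \<le> 1 \<and> s w \<noteq> 0"
    "\<And>w. norm w < 1 \<Longrightarrow> f w = w ^ m * (\<Prod>n. blaschke_seq a K n w) * s w"
proof -
  obtain m f0 where f0: "f0 holomorphic_on ball 0 1" "f0 0 \<noteq> 0" "\<And>w. norm w < 1 \<Longrightarrow> norm (f0 w) \<le> 1"
      "\<And>w. norm w < 1 \<Longrightarrow> f w = w ^ m * f0 w"
    using factor_order_at_0[OF hol bd nz] by auto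
  define P where "P g \<longleftrightarrow> g holomorphic_on ball 0 1 \<and> g 0 \<noteq> 0 \<and> (\<forall>w. norm w < 1 \<longrightarrow> norm (g w) \<le> 1)" for g :: "complex \<Rightarrow> complex"
  \<comment> \<open>A step from \<open>g\<close> to \<open>h\<close> either divides out a zero of
    least modulus or, when there is none, stands still. The recursion is thus total, and
    \<open>K\<close> records the steps of the first kind.\<close>
  define Q where "Q g h \<longleftrightarrow> (\<exists>a. norm a < 1 \<and> a \<noteq> 0 \<and> (\<forall>w. norm w < 1 \<longrightarrow> g w = 0 \<longrightarrow> norm a \<le> norm w) \<and> (\<forall>w. norm w < 1 \<longrightarrow> g w = blaschke_factor a w * h w))
       \<or> ((\<forall>w. norm w < 1 \<longrightarrow> g w \<noteq> 0) \<and> h = g)" for g h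
  have step: "\<exists>h. P h \<and> Q g h" if g: "P g" for g
  proof (cases "\<exists>z. norm z < 1 \<and> g z = 0")
    case True
    with minimal_zero g obtain a where a: "norm a < 1" "g a = 0" "\<forall>w. norm w < 1 \<longrightarrow> g w = 0 \<longrightarrow> norm a \<le> norm w"
      unfolding P_def by blast
    have a0: "a \<noteq> 0" using a g unfolding P_def by auto
    obtain h where h: "h holomorphic_on ball 0 1" "\<And>w. norm w < 1 \<Longrightarrow> norm (h w) \<le> 1 \<and> g w = blaschke_factor a w * h w"
      using divide_blaschke_factor[of g a] a a0 g unfolding P_def by blast
    have "h 0 \<noteq> 0" using h(2)[of 0] g unfolding P_def by auto
    then have "P h" using h unfolding P_def by blast
    moreover have "Q g h" unfolding Q_def using a a0 h(2) by blast
    ultimately show ?thesis by blast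
  next
    case False
    then show ?thesis using g unfolding Q_def by blast
  qed
  define F where "F = rec_nat f0 (\<lambda>n g. SOME h. P h \<and> Q g h)"
  have F0: "F 0 = f0" by (simp add: F_def)
  have FP: "P (F n)" for n
  proof (induction n)
    case 0
    then show ?case using f0 by (simp add: F0 P_def)
  next
    case (Suc n)
    then show ?case using someI_ex[OF step[OF Suc]] by (simp add: F_def)
  qed
  have FQ: "Q (F n) (F (Suc n))" for n
    using someI_ex[OF step[OF FP[of n]]] by (simp add: F_def)
  define K where "K = {n. \<exists>z. norm z < 1 \<and> F n z = 0}"
  have "\<forall>n\<in>K. \<exists>a. norm a < 1 \<and> a \<noteq> 0 \<and> (\<forall>w. norm w < 1 \<longrightarrow> F n w = 0 \<longrightarrow> norm a \<le> norm w) \<and> (\<forall>w. norm w < 1 \<longrightarrow> F n w = blaschke_factor a w * F (Suc n) w)"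
    using FQ unfolding Q_def K_def by blast
  then obtain a where a: "\<And>n. n \<in> K \<Longrightarrow> norm (a n) < 1 \<and> a n \<noteq> 0"
      "\<And>n w. n \<in> K \<Longrightarrow> norm w < 1 \<Longrightarrow> F n w = 0 \<Longrightarrow> norm (a n) \<le> norm w"
      "\<And>n w. n \<in> K \<Longrightarrow> norm w < 1 \<Longrightarrow> F n w = blaschke_factor (a n) w * F (Suc n) w"
    by (metis (no_types, lifting))
  have FS: "F n w = blaschke_seq a K n w * F (Suc n) w" if "norm w < 1" for n w
  proof (cases "n \<in> K")
    case False
    \<comment> \<open>The first alternative of \<open>Q\<close> would make \<open>F n\<close> vanish
      at \<open>a\<close>, where the Blaschke factor is zero, putting \<open>n\<close> into
      \<open>K\<close>.\<close>
    then have "F (Suc n) = F n" using FQ[of n] unfolding Q_def K_def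
      by (metis (mono_tags, lifting) blaschke_factor_def diff_self div_0 mem_Collect_eq mult_eq_0_iff)
    then show ?thesis using False by simp
  qed (use a that in auto)
  have Fprod: "f0 w = (\<Prod>k<n. blaschke_seq a K k w) * F n w" if "norm w < 1" for n w
  proof (induction n)
    case (Suc n)
    then show ?case using FS[OF that, of n] by (simp add: mult.assoc)
  qed (simp add: F0)
  have b0: "norm (blaschke_seq a K n 0) = (if n \<in> K then norm (a n) else 1)" for n
    using a(1) by (auto simp: blaschke_factor_def norm_mult norm_divide)
  \<comment> \<open>Evaluation at 0 gives \<open>|f0 0| <= \<Prod> |a n|\<close> over the removed
    zeros; with \<open>1 - x <= - ln x\<close> this bounds all partial sums by
    \<open>- ln |f0 0|\<close>.\<close>
  have sm: "summable (\<lambda>n. if n \<in> K then 1 - norm (a n) else 0)"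
  proof (rule summableI_nonneg_bounded)
    fix N
    define x where "x n = norm (blaschke_seq a K n 0)" for n
    have x0: "x n > 0" for n unfolding x_def b0 using a(1) by auto
    have "(\<Sum>n<N. if n \<in> K then 1 - norm (a n) else 0) = (\<Sum>n<N. 1 - x n)"
      unfolding x_def b0 by (intro sum.cong) auto
    also have "\<dots> \<le> (\<Sum>n<N. - ln (x n))"
    proof (rule sum_mono)
      fix n show "1 - x n \<le> - ln (x n)" using ln_le_minus_one[OF x0[of n]] by simp
    qed
    also have "\<dots> = - ln (\<Prod>n<N. x n)" using x0 by (subst ln_prod) (auto simp: sum_negf less_imp_neq[symmetric])
    also have "\<dots> \<le> - ln (norm (f0 0))"
    proof -
      have "norm (f0 0) = (\<Prod>n<N. x n) * norm (F N 0)"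
        using Fprod[of 0 N] by (simp add: norm_mult x_def prod_norm)
      also have "\<dots> \<le> (\<Prod>n<N. x n) * 1" using FP[of N] x0 unfolding P_def
        by (intro mult_left_mono prod_nonneg) (auto simp: less_imp_le)
      finally have "ln (norm (f0 0)) \<le> ln (\<Prod>n<N. x n)" using f0(2) by (subst ln_le_cancel_iff) (auto intro!: prod_pos x0)
      then show ?thesis by simp
    qed
    finally show "(\<Sum>n<N. if n \<in> K then 1 - norm (a n) else 0) \<le> - ln (norm (f0 0))" .
  qed (use a(1) in \<open>auto simp: less_imp_le\<close>)
  have bdP: "\<exists>B. \<forall>h\<in>Collect P. \<forall>z\<in>C. norm (h z) \<le> B" if "compact C" "C \<subseteq> ball 0 1" for C
    using that unfolding P_def by (intro exI[of _ 1]) auto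
  have holP: "h holomorphic_on ball 0 1" if "h \<in> Collect P" for h using that by (simp add: P_def)
  have rangeP: "range F \<subseteq> Collect P" using FP by auto
  \<comment> \<open>The successive quotients are all bounded by 1, so Montel's theorem yields a
    limit along a subsequence, which serves as the zero-free factor.\<close>
  obtain s r where s: "s holomorphic_on ball 0 1" "strict_mono (r :: nat \<Rightarrow> nat)"
      "\<And>x. x \<in> ball 0 1 \<Longrightarrow> (\<lambda>n. F (r n) x) \<longlonglongrightarrow> s x"
  proof (rule Montel[OF open_ball holP bdP rangeP])
    fix g r assume *: "g holomorphic_on ball 0 1" "strict_mono (r :: nat \<Rightarrow> nat)"
      "\<And>x. x \<in> ball 0 1 \<Longrightarrow> (\<lambda>n. F (r n) x) \<longlonglongrightarrow> g x"
    show thesis by (rule that[OF *])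
  qed
  have bl: "norm (blaschke_seq a K n w) \<le> 1" if "norm w < 1" for n w
    using a(1)[of n] norm_blaschke_factor_le[of "a n" w] that by auto
  have s1: "norm (s w) \<le> 1" if "norm w < 1" for w
    using LIMSEQ_le_const2[OF tendsto_norm[OF s(3)[of w]], of 1] that FP unfolding P_def by auto
  \<comment> \<open>Removing factors of modulus at most 1 makes \<open>|F n w|\<close> increase with
    \<open>n\<close>. If its limit were zero, every \<open>F n\<close> would vanish at
    \<open>w\<close>; by minimality all \<open>|a n| <= |w|\<close>, against
    \<open>1 - |a n|\<close> tending to zero.\<close>
  have sn: "s w \<noteq> 0" if w: "norm w < 1" for w
  proof
    assume sw: "s w = 0"
    have mono: "norm (F n w) \<le> norm (F (n + k) w)" for n k
    proof (induction k)
      case (Suc k)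
      have "norm (F (n + k) w) = norm (blaschke_seq a K (n + k) w) * norm (F (Suc (n + k)) w)"
        using FS[OF w, of "n + k"] by (metis norm_mult)
      also have "\<dots> \<le> 1 * norm (F (Suc (n + k)) w)" using bl[OF w] by (intro mult_right_mono) auto
      finally show ?case using Suc by simp
    qed simp
    have "F n w = 0" for n
    proof -
      have "norm (F n w) \<le> norm (s w)"
      proof (rule LIMSEQ_le_const[OF tendsto_norm[OF s(3)]])
        show "\<exists>N. \<forall>k\<ge>N. norm (F n w) \<le> norm (F (r k) w)"
        proof (intro exI[of _ n] allI impI)
          fix k assume "n \<le> k"
          then have "n \<le> r k" using seq_suble[OF s(2), of k] by simp
          then show "norm (F n w) \<le> norm (F (r k) w)" using mono[of n "r k - n"] by simp
        qed
      qed (use w in simp)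
      then show ?thesis using sw by simp
    qed
    then have "n \<in> K" "norm (a n) \<le> norm w" for n using w a(2)[of n w] unfolding K_def by auto
    moreover have "(\<lambda>n. if n \<in> K then 1 - norm (a n) else 0) \<longlonglongrightarrow> 0" by (rule summable_LIMSEQ_zero[OF sm])
    ultimately have "1 - norm w \<le> 0" by (intro LIMSEQ_le_const[of _ 0]) auto
    then show False using w by simp
  qed
  have "f w = w ^ m * (\<Prod>n. blaschke_seq a K n w) * s w" if w: "norm w < 1" for w
  proof -
    have "(\<lambda>n. (\<Prod>k<r n. blaschke_seq a K k w) * F (r n) w) \<longlonglongrightarrow> (\<Prod>n. blaschke_seq a K n w) * s w"
      using LIMSEQ_subseq_LIMSEQ[OF blaschke_seq_holomorphic(2)[OF a(1) sm w] s(2)] s(3)[of w] w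
      by (intro tendsto_mult) (auto simp: o_def)
    then have "f0 w = (\<Prod>n. blaschke_seq a K n w) * s w"
      using Fprod[OF w] by (simp add: LIMSEQ_const_iff)
    then show ?thesis using f0(4)[OF w] by simp
  qed
  then show ?thesis using that[of K a s m] a(1) sm s(1) s1 sn by blast
qed

section \<open>The Herglotz representation\<close>

text \<open>On radius \<open>r < 1\<close> the series converges absolutely, and the real part has
  coefficients \<open>Re (G 0)\<close> at 0 and \<open>c n r ^ n / 2\<close> for
  \<open>n > 0\<close>. Doubling its Cauchy integral, as the Herglotz kernel does, recovers
  \<open>G\<close> up to \<open>i Im (G 0)\<close>.\<close>

lemma schwarz_formula:
  assumes hol: "G holomorphic_on ball 0 1" and r: "0 < r" "r < 1" and w: "norm w < 1"
  shows "(\<integral>z. (z + w) / (z - w) * of_real (Re (G (of_real r * z))) \<partial>circ) = G (of_real r * w) - \<i> * of_real (Im (G 0))"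
    and "(\<lambda>z. Re (G (of_real r * z))) \<in> borel_measurable circ"
    and "integrable circ (\<lambda>z. Re (G (of_real r * z)))"
    and "(\<integral>z. Re (G (of_real r * z)) \<partial>circ) = Re (G 0)"
proof -
  define c where "c n = (deriv ^^ n) G 0 / fact n" for n
  have c: "(\<lambda>n. c n * w ^ n) sums G w" if "norm w < 1" for w
    using holomorphic_power_series[OF hol, of w] that by (simp add: c_def)
  have c0: "c 0 = G 0" by (simp add: c_def)
  define r' where "r' = (1 + r) / 2"
  have r': "r < r'" "r' < 1" using r by (auto simp: r'_def)
  have s: "summable (\<lambda>k. norm (c k * of_real r ^ k))"
  proof (rule powser_insidea)
    show "summable (\<lambda>k. c k * of_real r' ^ k)" using c[of "of_real r'"] r' r by (simp add: sums_iff)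
  qed (use r r' in auto)
  define g where "g z = G (of_real r * z)" for z
  have g: "(\<lambda>k. (c k * of_real r ^ k) * z ^ k) sums g z" if "norm z = 1" for z
    using c[of "of_real r * z"] r that by (simp add: g_def norm_mult power_mult_distrib mult_ac)
  have gm[measurable]: "g \<in> borel_measurable circ" by (rule sums_imp_measurable_circ[OF g])
  have gb: "AE z in circ. norm (g z) \<le> (\<Sum>k. norm (c k * of_real r ^ k))"
    using AE_circ_sphere by eventually_elim (rule norm_le_of_abs_series[OF s g])
  have gi: "integrable circ g" by (rule integrable_circ_bounded[OF gm gb])
  show um: "(\<lambda>z. Re (G (of_real r * z))) \<in> borel_measurable circ"
    unfolding g_def[symmetric] by measurable
  show ui: "integrable circ (\<lambda>z. Re (G (of_real r * z)))"
    unfolding g_def[symmetric] using gi by simp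
  have ui': "integrable circ (\<lambda>z. complex_of_real (Re (G (of_real r * z))))" using ui by simp
  have fg: "fourier g n = (if n \<ge> 0 then c (nat n) * of_real r ^ nat n else 0)" for n
    by (rule fourier_abs_series[OF s g])
  have fc: "fourier (\<lambda>z. cnj (g z)) n = cnj (fourier g (- n))" for n
  proof -
    have "fourier (\<lambda>z. cnj (g z)) n = (\<integral>z. cnj (g z * z powi (- (- n))) \<partial>circ)"
      unfolding fourier_def
    proof (rule Bochner_Integration.integral_cong)
      fix z assume "z \<in> space circ"
      then have z: "norm z = 1" by simp
      have "z * cnj z = 1" using complex_norm_square[of z] z by simp
      then have "inverse z = cnj z" by (rule inverse_unique)
      then have "z powi (- n) = cnj (z powi n)"
        by (metis complex_cnj_power_int power_int_inverse power_int_minus)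
      then show "cnj (g z) * z powi (- n) = cnj (g z * z powi (- (- n)))" by simp
    qed simp
    also have "\<dots> = cnj (fourier g (- n))" unfolding fourier_def by (rule Bochner_Integration.integral_cnj)
    finally show ?thesis .
  qed
  define u where "u z = complex_of_real (Re (g z))" for z
  have fu: "fourier u n = (fourier g n + fourier (\<lambda>z. cnj (g z)) n) / 2" for n
  proof -
    have pb: "AE z in circ. norm (z powi (- n)) \<le> 1"
      using AE_circ_sphere by eventually_elim (simp add: norm_power_int)
    have i1: "integrable circ (\<lambda>z. g z * z powi (- n))"
      using integrable_circ_mult_bounded[OF gi powi_measurable_circ pb] by (simp add: mult.commute)
    have i2: "integrable circ (\<lambda>z. cnj (g z) * z powi (- n))"
      using integrable_circ_mult_bounded[OF _ powi_measurable_circ pb, of "\<lambda>z. cnj (g z)"] gi by (simp add: mult.commute)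
    have "fourier u n = (\<integral>z. (g z * z powi (- n) + cnj (g z) * z powi (- n)) / 2 \<partial>circ)"
      unfolding fourier_def u_def
    proof (rule Bochner_Integration.integral_cong)
      fix z
      have "complex_of_real (Re (g z)) = (g z + cnj (g z)) / 2" by (simp add: complex_add_cnj)
      then show "complex_of_real (Re (g z)) * z powi (- n) = (g z * z powi (- n) + cnj (g z) * z powi (- n)) / 2"
        by (simp only: distrib_right times_divide_eq_left)
    qed simp
    also have "\<dots> = (fourier g n + fourier (\<lambda>z. cnj (g z)) n) / 2"
      unfolding fourier_def integral_divide_zero Bochner_Integration.integral_add[OF i1 i2] ..
    finally show ?thesis .
  qed
  have fu0: "fourier u 0 = of_real (Re (G 0))"
    unfolding fu fc fg by (simp add: c0 complex_add_cnj)
  have fup: "fourier u (int n) = c n * of_real r ^ n / 2" if "n > 0" for n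
    unfolding fu fc fg using that by simp
  have ui2: "integrable circ u" unfolding u_def[abs_def] g_def by (rule ui')
  have "(\<lambda>n. fourier u (int n) * w ^ n) sums ext u w" by (rule ext_sums[OF ui2 w])
  then have "(\<lambda>n. 2 * (fourier u (int n) * w ^ n) - (if n = 0 then fourier u 0 else 0)) sums (2 * ext u w - fourier u 0)"
    by (intro sums_diff sums_mult sums_single)
  also have "(\<lambda>n. 2 * (fourier u (int n) * w ^ n) - (if n = 0 then fourier u 0 else 0)) = (\<lambda>n. c n * (of_real r * w) ^ n - (if n = 0 then \<i> * of_real (Im (G 0)) else 0))"
  proof
    fix n
    show "2 * (fourier u (int n) * w ^ n) - (if n = 0 then fourier u 0 else 0) = c n * (of_real r * w) ^ n - (if n = 0 then \<i> * of_real (Im (G 0)) else 0)"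
    proof (cases "n = 0")
      case True
      then show ?thesis by (simp add: fu0 c0 complex_eq_iff)
    next
      case False
      then show ?thesis by (simp add: fup power_mult_distrib)
    qed
  qed
  finally have S1: "(\<lambda>n. c n * (of_real r * w) ^ n - (if n = 0 then \<i> * of_real (Im (G 0)) else 0)) sums (2 * ext u w - fourier u 0)" .
  have "r * norm w \<le> r * 1" using r w by (intro mult_left_mono) auto
  then have "r * norm w < 1" using r by linarith
  then have "norm (of_real r * w) < 1" using r by (simp add: norm_mult)
  from sums_diff[OF c[OF this] sums_single[of 0 "\<lambda>_. \<i> * of_real (Im (G 0))"]]
  have S2: "(\<lambda>n. c n * (of_real r * w) ^ n - (if n = 0 then \<i> * of_real (Im (G 0)) else 0)) sums (G (of_real r * w) - \<i> * of_real (Im (G 0)))" .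
  from sums_unique2[OF S1 S2] herglotz_eq_ext[OF ui2 w]
  show "(\<integral>z. (z + w) / (z - w) * of_real (Re (G (of_real r * z))) \<partial>circ) = G (of_real r * w) - \<i> * of_real (Im (G 0))"
    by (simp only: u_def g_def)
  have "fourier u 0 = of_real (\<integral>z. Re (G (of_real r * z)) \<partial>circ)"
    by (simp add: fourier_def u_def g_def)
  then show "(\<integral>z. Re (G (of_real r * z)) \<partial>circ) = Re (G 0)"
    using fu0 by (metis of_real_eq_iff)
qed

section \<open>Existence of the representing measure\<close>

lemma integral_circ_uniform:
  fixes f :: "complex \<Rightarrow> 'b::{banach, second_countable_topology}"
  assumes "f \<in> borel_measurable circ"
  shows "(\<integral>z. f z \<partial>circ) = (\<integral>t. f (cis t) \<partial>uniform_measure lborel {0..<2*pi})"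
  unfolding circ_def
  by (rule integral_distr) (use assms in \<open>auto simp: measurable_cong_sets[OF sets_circ refl]\<close>)

lemma herglotz_kernel_continuous:
  assumes "norm w < 1"
  shows "isCont (\<lambda>t. (cis t + w) / (cis t - w)) t" "norm ((cis t + w) / (cis t - w)) \<le> 2 / (1 - norm w)"
proof -
  have "cis t \<noteq> w" using assms by auto
  moreover have "isCont cis t"
    using continuous_on_eq_continuous_at[of UNIV cis] by (auto intro!: continuous_intros)
  ultimately show "isCont (\<lambda>t. (cis t + w) / (cis t - w)) t" by (auto intro!: continuous_intros)
  have "norm (cis t + w) \<le> 2" using norm_triangle_ineq[of "cis t" w] assms by simp
  then show "norm ((cis t + w) / (cis t - w)) \<le> 2 / (1 - norm w)"
    using norm_diff_ge[OF assms, of "cis t"] assms by (auto simp: norm_divide intro!: frac_le)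
qed

text \<open>The measure is a weak limit of the densities \<open>Re G (\<rho> k z)\<close>. They are
  divided by their common mass \<open>m = Re (G 0)\<close> and carried to the line by the angle,
  where tight sequences of probability distributions have weakly convergent subsequences; the limit
  is pushed back by \<open>cis\<close> and multiplied by \<open>m\<close>.\<close>

theorem herglotz_representation:
  assumes hol: "G holomorphic_on ball 0 1" and pos: "\<And>w. norm w < 1 \<Longrightarrow> Re (G w) \<ge> 0"
  obtains \<mu> where "sets \<mu> = sets circ" "finite_measure \<mu>"
    "\<And>w. norm w < 1 \<Longrightarrow> G w = \<i> * of_real (Im (G 0)) + (\<integral>z. (z + w) / (z - w) \<partial>\<mu>)"
proof -
  define m where "m = Re (G 0)"
  define \<rho> where "\<rho> k = 1 - 1 / real (k + 2)" for k
  have \<rho>: "0 < \<rho> k" "\<rho> k < 1" for k by (auto simp: \<rho>_def field_simps)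
  have \<rho>1: "\<rho> \<longlonglongrightarrow> 1"
  proof -
    have "(\<lambda>k. 1 - 1 / real (k + 2)) \<longlonglongrightarrow> 1 - 0"
      by (intro tendsto_diff tendsto_const LIMSEQ_ignore_initial_segment[OF lim_1_over_n])
    then show ?thesis by (simp add: \<rho>_def[abs_def])
  qed
  have Glim: "(\<lambda>k. G (of_real (\<rho> k) * w)) \<longlonglongrightarrow> G w" if w: "norm w < 1" for w
  proof -
    have "isCont G w" using hol w holomorphic_on_imp_continuous_on
      by (metis continuous_on_interior interior_ball mem_ball_0)
    moreover have "(\<lambda>k. of_real (\<rho> k) * w) \<longlonglongrightarrow> of_real 1 * w" by (intro tendsto_intros \<rho>1)
    ultimately show ?thesis using isCont_tendsto_compose by fastforce
  qed
  define u where "u k z = Re (G (of_real (\<rho> k) * z))" for k z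
  have u0: "u k z \<ge> 0" if "norm z = 1" for k z
    unfolding u_def using that \<rho>[of k] by (intro pos) (simp add: norm_mult)
  have um[measurable]: "u k \<in> borel_measurable circ" and ui: "integrable circ (u k)" and um0: "(\<integral>z. u k z \<partial>circ) = m" for k
    using schwarz_formula(2-4)[OF hol \<rho>, of 0 k] unfolding u_def m_def by simp_all
  have uH: "(\<integral>z. (z + w) / (z - w) * of_real (u k z) \<partial>circ) = G (of_real (\<rho> k) * w) - \<i> * of_real (Im (G 0))" if "norm w < 1" for k w
    using schwarz_formula(1)[OF hol \<rho> that] by (simp add: u_def)
  show ?thesis
  \<comment> \<open>Without mass there is nothing to normalise: the nonnegative real parts vanish
    almost everywhere, \<open>G\<close> is an imaginary constant, and the null measure represents
    it.\<close>
  proof (cases "m = 0")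
    case True
    have ae: "AE z in circ. u k z = 0" for k
    proof (rule integral_nonneg_eq_0_iff_AE[THEN iffD1, OF ui])
      show "AE z in circ. 0 \<le> u k z" using AE_circ_sphere by eventually_elim (rule u0)
    qed (use um0 True in simp)
    have "(\<integral>z. (z + w) / (z - w) * of_real (u k z) \<partial>circ) = (\<integral>z. 0 \<partial>circ)" for k w
    proof (rule integral_cong_AE)
      show "AE z in circ. (z + w) / (z - w) * of_real (u k z) = 0" using ae[of k] by eventually_elim simp
    qed measurable
    then have G\<rho>: "G (of_real (\<rho> k) * w) = \<i> * of_real (Im (G 0))" if "norm w < 1" for k w
      using uH[OF that, of k] by simp
    have Gc: "G w = \<i> * of_real (Im (G 0))" if "norm w < 1" for w
    proof -
      have "(\<lambda>k::nat. \<i> * of_real (Im (G 0))) \<longlonglongrightarrow> G w" using Glim[OF that] by (simp only: G\<rho>[OF that])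
      from LIMSEQ_unique[OF this tendsto_const] show ?thesis .
    qed
    have z: "(\<integral>z. f z \<partial>null_measure circ) = 0" for f :: "complex \<Rightarrow> complex"
      by (rule integral_eq_zero_AE, rule AE_I[of _ _ "space circ"]) (use sets.top[of circ] in auto)
    show ?thesis
    proof (rule that[of "null_measure circ"])
      show "finite_measure (null_measure circ)" by (intro finite_measureI) simp
    qed (use Gc in \<open>simp_all only: z add_0_right sets_null_measure\<close>)
  next
    case False
    have m0: "m \<ge> 0" unfolding m_def using pos[of 0] by simp
    then have mp: "m > 0" using False by simp
    define U where "U = uniform_measure lborel {0..<2*pi}"
    interpret U: prob_space U unfolding U_def by (rule prob_space_uniform_measure) auto
    have sU[simp, measurable_cong]: "sets U = sets borel" by (simp add: U_def)
    have spU[simp]: "space U = UNIV" by (simp add: U_def)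
    define p where "p k t = u k (cis t) / m" for k t
    have [measurable]: "p k \<in> borel_measurable borel" for k unfolding p_def[abs_def] by measurable
    have pU: "p k \<in> borel_measurable U" for k
      using \<open>\<And>k. p k \<in> borel_measurable borel\<close> by (simp add: measurable_cong_sets[OF sU refl])
    have p0: "p k t \<ge> 0" for k t unfolding p_def using u0 mp by simp
    define \<nu> where "\<nu> k = density U (\<lambda>t. ennreal (p k t))" for k
    have s\<nu>[simp, measurable_cong]: "sets (\<nu> k) = sets borel" for k by (simp add: \<nu>_def)
    have pi: "integrable U (p k)" for k
    proof -
      have "integrable circ (u k)" by (rule ui)
      then have "integrable U (\<lambda>t. u k (cis t))" unfolding circ_def U_def
        by (subst (asm) integrable_distr_eq) (use um in \<open>auto simp: measurable_cong_sets[OF sets_circ refl]\<close>)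
      then show ?thesis unfolding p_def by simp
    qed
    have pint: "(\<integral>t. p k t \<partial>U) = 1" for k
      using um0[of k] integral_circ_uniform[OF um[of k]] mp unfolding p_def U_def by simp
    have pr: "prob_space (\<nu> k)" for k
    proof
      have "emeasure (\<nu> k) (space (\<nu> k)) = (\<integral>\<^sup>+t. ennreal (p k t) \<partial>U)"
        unfolding \<nu>_def space_density
        using pU[of k] by (subst emeasure_density) (auto intro!: nn_integral_cong simp: indicator_def)
      also have "\<dots> = ennreal (\<integral>t. p k t \<partial>U)" by (rule nn_integral_eq_integral[OF pi]) (simp add: p0)
      finally show "emeasure (\<nu> k) (space (\<nu> k)) = 1" by (simp add: pint)
    qed
    have rd: "real_distribution (\<nu> k)" for k
      using pr[of k] by (simp add: real_distribution_def real_distribution_axioms_def)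
    have tight: "tight \<nu>" unfolding tight_def
    \<comment> \<open>All angles lie in \<open>{0..<2*pi}\<close>, so a single bounded interval
      carries the full mass of every \<open>\<nu> k\<close>. Mass that accumulates at
      \<open>2*pi\<close> in the limit is harmless, since \<open>cis\<close> identifies this point
      with 0.\<close>
    proof (intro conjI allI impI rd)
      fix e :: real assume e: "e > 0"
      have "measure (\<nu> k) {-1<..2*pi} = 1" for k
      proof -
        interpret N: prob_space "\<nu> k" by (rule pr)
        have "AE t in U. t \<in> {0..<2*pi}" unfolding U_def by (rule AE_uniform_measureI) auto
        then have "AE t in \<nu> k. t \<in> {-1<..2*pi}"
          unfolding \<nu>_def by (subst AE_density) (auto elim: eventually_mono)
        then show ?thesis by (subst N.prob_eq_1) auto
      qed
      then show "\<exists>a b. a < b \<and> (\<forall>n. 1 - e < measure (\<nu> n) {a<..b})"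
      proof (intro exI conjI allI)
        show "(-1::real) < 2*pi" using pi_gt_zero by linarith
      qed (use e in simp)
    qed
    obtain q M where q: "strict_mono (q :: nat \<Rightarrow> nat)" "real_distribution M" "weak_conv_m (\<nu> \<circ> id \<circ> q) M"
      using tight_imp_convergent_subsubsequence[OF tight strict_mono_id] by blast
    interpret M: real_distribution M by fact
    define \<mu> where "\<mu> = density (distr M (restrict_space borel (sphere 0 1)) cis) (\<lambda>_. ennreal m)"
    have cisM: "cis \<in> measurable M (restrict_space borel (sphere 0 1))"
      using cis_measurable_circ by (simp cong: measurable_cong_sets)
    have "emeasure \<mu> (space \<mu>) = ennreal m"
    proof -
      define D where "D = distr M (restrict_space borel (sphere 0 1)) cis"
      interpret D: prob_space D unfolding D_def by (rule M.prob_space_distr[OF cisM])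
      show ?thesis unfolding \<mu>_def D_def[symmetric] space_density
        by (simp add: emeasure_density_const[OF sets.top] D.emeasure_space_1)
    qed
    then have fin: "finite_measure \<mu>" by (intro finite_measureI) simp
    have eq: "G w = \<i> * of_real (Im (G 0)) + (\<integral>z. (z + w) / (z - w) \<partial>\<mu>)" if w: "norm w < 1" for w
    proof -
      define H where "H z = (z + w) / (z - w)" for z
      have Hm: "H \<in> borel_measurable circ" unfolding H_def[abs_def] by measurable
      have Hm': "(\<lambda>t. H (cis t)) \<in> borel_measurable borel" using Hm by measurable
      have "(\<integral>z. H z * of_real (u k z) \<partial>circ) = m *\<^sub>R (\<integral>t. H (cis t) \<partial>\<nu> k)" for k
      proof -
        have "(\<integral>z. H z * of_real (u k z) \<partial>circ) = (\<integral>t. H (cis t) * of_real (u k (cis t)) \<partial>U)"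
          unfolding U_def by (rule integral_circ_uniform) (use Hm in measurable)
        also have "\<dots> = (\<integral>t. m *\<^sub>R (p k t *\<^sub>R H (cis t)) \<partial>U)"
          using mp by (intro Bochner_Integration.integral_cong) (auto simp: p_def scaleR_conv_of_real)
        also have "\<dots> = m *\<^sub>R (\<integral>t. p k t *\<^sub>R H (cis t) \<partial>U)"
          by (rule Bochner_Integration.integral_scaleR_right)
        also have "(\<integral>t. p k t *\<^sub>R H (cis t) \<partial>U) = (\<integral>t. H (cis t) \<partial>\<nu> k)"
          unfolding \<nu>_def by (rule integral_density[symmetric]) (use Hm' p0 in auto)
        finally show ?thesis .
      qed
      then have k1: "m *\<^sub>R (\<integral>t. H (cis t) \<partial>\<nu> k) = G (of_real (\<rho> k) * w) - \<i> * of_real (Im (G 0))" for k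
        using uH[OF w, of k] by (simp add: H_def)
      have "(\<lambda>k. \<integral>t. H (cis t) \<partial>(\<nu> \<circ> id \<circ> q) k) \<longlonglongrightarrow> (\<integral>t. H (cis t) \<partial>M)"
        by (rule weak_conv_imp_integral_bdd_continuous_conv[OF _ q(2,3), where B="2 / (1 - norm w)"])
           (use rd herglotz_kernel_continuous[OF w] in \<open>auto simp: H_def\<close>)
      then have "(\<lambda>k. m *\<^sub>R (\<integral>t. H (cis t) \<partial>\<nu> (q k))) \<longlonglongrightarrow> m *\<^sub>R (\<integral>t. H (cis t) \<partial>M)"
        by (intro tendsto_intros) (simp add: o_def)
      then have L1: "(\<lambda>k. G (of_real (\<rho> (q k)) * w) - \<i> * of_real (Im (G 0))) \<longlonglongrightarrow> m *\<^sub>R (\<integral>t. H (cis t) \<partial>M)"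
        by (simp only: k1)
      have L2: "(\<lambda>k. G (of_real (\<rho> (q k)) * w) - \<i> * of_real (Im (G 0))) \<longlonglongrightarrow> G w - \<i> * of_real (Im (G 0))"
        using LIMSEQ_subseq_LIMSEQ[OF Glim[OF w] q(1)] by (intro tendsto_diff tendsto_const) (simp add: o_def)
      have "(\<integral>z. H z \<partial>\<mu>) = (\<integral>z. m *\<^sub>R H z \<partial>distr M (restrict_space borel (sphere 0 1)) cis)"
        unfolding \<mu>_def by (rule integral_density) (use Hm m0 in \<open>auto simp: measurable_cong_sets[OF sets_circ refl]\<close>)
      also have "\<dots> = m *\<^sub>R (\<integral>t. H (cis t) \<partial>M)"
        by (subst integral_distr[OF cisM]) (use Hm in \<open>auto simp: measurable_cong_sets[OF sets_circ refl]\<close>)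
      finally show ?thesis using LIMSEQ_unique[OF L1 L2] by (simp add: H_def)
    qed
    show ?thesis
    proof (rule that[of \<mu>])
      show "sets \<mu> = sets circ" by (simp add: \<mu>_def sets_circ)
    qed (fact fin, fact eq)
  qed
qed

lemma holomorphic_log_ball:
  fixes s :: "complex \<Rightarrow> complex"
  assumes "s holomorphic_on ball 0 1" "\<And>w. norm w < 1 \<Longrightarrow> s w \<noteq> 0"
  obtains g where "g holomorphic_on ball 0 1" "\<And>w. norm w < 1 \<Longrightarrow> s w = exp (g w)"
proof -
  have "simply_connected (ball (0::complex) 1)" by (intro convex_imp_simply_connected) simp
  then have "\<exists>g. g holomorphic_on ball 0 1 \<and> (\<forall>z\<in>ball 0 1. s z = exp (g z))"
    using simply_connected_eq_holomorphic_log[of "ball 0 1"] assms by auto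
  then show ?thesis using that by auto
qed

section \<open>The canonical factorisation of inner functions\<close>

lemma sphere_sets_circ [simp]: "sphere 0 1 \<in> sets circ"
  using sets.top[of circ] by simp

text \<open>The null set carrying the largest possible mass splits off the singular part.\<close>

lemma maximal_null_set:
  assumes s: "sets \<mu> = sets M" and fin: "finite_measure \<mu>"
  obtains A where "A \<in> null_sets M" "\<And>E. E \<in> null_sets M \<Longrightarrow> E \<inter> A = {} \<Longrightarrow> emeasure \<mu> E = 0"
proof -
  interpret finite_measure \<mu> by fact
  have "null_sets M \<noteq> {}" by auto
  from ennreal_SUP_countable_SUP[OF this, of "emeasure \<mu>"]
  obtain f where f: "range f \<subseteq> emeasure \<mu> ` null_sets M" "Sup (emeasure \<mu> ` null_sets M) = (SUP i::nat. f i)" by auto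
  then have "\<forall>i. \<exists>A. A \<in> null_sets M \<and> f i = emeasure \<mu> A" by blast
  then obtain A where A: "\<And>i. A i \<in> null_sets M" "\<And>i. f i = emeasure \<mu> (A i)" by metis
  define N where "N = (\<Union>i. A i)"
  have N: "N \<in> null_sets M" unfolding N_def by (rule null_sets_UN) (rule A)
  have Ns: "N \<in> sets \<mu>" using N s by auto
  have "f i \<le> emeasure \<mu> N" for i unfolding A(2) N_def
    by (rule emeasure_mono) (use Ns N_def in auto)
  then have sup: "Sup (emeasure \<mu> ` null_sets M) \<le> emeasure \<mu> N" unfolding f(2) by (rule SUP_least)
  have "emeasure \<mu> E = 0" if E: "E \<in> null_sets M" "E \<inter> N = {}" for E
  proof -
    have Es: "E \<in> sets \<mu>" using E s by auto
    have "E \<union> N \<in> null_sets M" using E N by auto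
    then have "emeasure \<mu> (E \<union> N) \<le> emeasure \<mu> N" using sup by (meson SUP_upper order_trans)
    then have "emeasure \<mu> E + emeasure \<mu> N \<le> emeasure \<mu> N" using plus_emeasure[OF Es Ns E(2)] by simp
    then have "emeasure \<mu> N + emeasure \<mu> E \<le> emeasure \<mu> N + 0" by (simp add: add.commute)
    then show ?thesis using emeasure_finite[of N] by (simp only: ennreal_add_left_cancel_le) simp
  qed
  then show ?thesis using that[OF N] by blast
qed

lemma poisson_integrable_finite:
  assumes s: "sets \<mu> = sets circ" and fin: "finite_measure \<mu>" and w: "norm w < 1"
  shows "integrable \<mu> (poisson w)" "integrable \<mu> (\<lambda>z. (z + w) / (z - w))"
    "Re (\<integral>z. (z + w) / (z - w) \<partial>\<mu>) = (\<integral>z. poisson w z \<partial>\<mu>)"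
proof -
  interpret finite_measure \<mu> by fact
  have sp: "space \<mu> = sphere 0 1" using sets_eq_imp_space_eq[OF s] by simp
  have ae: "AE z in \<mu>. norm z = 1" using AE_space[of \<mu>] by (simp add: sp)
  show "integrable \<mu> (poisson w)"
  proof (rule integrable_const_bound[where B="2 / (1 - norm w)"])
    show "AE z in \<mu>. norm (poisson w z) \<le> 2 / (1 - norm w)"
      using ae by eventually_elim (use poisson_le[OF w] poisson_nonneg[OF w] in auto)
    show "poisson w \<in> borel_measurable \<mu>" using poisson_measurable by (simp add: measurable_cong_sets[OF s refl])
  qed
  show i: "integrable \<mu> (\<lambda>z. (z + w) / (z - w))"
  proof (rule integrable_const_bound[where B="2 / (1 - norm w)"])
    show "AE z in \<mu>. norm ((z + w) / (z - w)) \<le> 2 / (1 - norm w)"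
      using ae
    proof eventually_elim
      case (elim z)
      have "norm (z + w) \<le> 2" using norm_triangle_ineq[of z w] elim w by simp
      then show ?case using norm_diff_ge[OF w elim] w
        by (auto simp: norm_divide intro!: frac_le)
    qed
    have "(\<lambda>z. (z + w) / (z - w)) \<in> borel_measurable circ" by measurable
    then show "(\<lambda>z. (z + w) / (z - w)) \<in> borel_measurable \<mu>" by (simp add: measurable_cong_sets[OF s refl])
  qed
  have "Re (\<integral>z. (z + w) / (z - w) \<partial>\<mu>) = (\<integral>z. Re ((z + w) / (z - w)) \<partial>\<mu>)" using i by simp
  also have "\<dots> = (\<integral>z. poisson w z \<partial>\<mu>)"
    by (rule Bochner_Integration.integral_cong) (use Re_herglotz_kernel[OF w] in \<open>simp_all only: sp mem_sphere_0\<close>)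
  finally show "Re (\<integral>z. (z + w) / (z - w) \<partial>\<mu>) = (\<integral>z. poisson w z \<partial>\<mu>)" .
qed

text \<open>Off the maximal null set \<open>\<mu>\<close> is absolutely continuous, with a density
  \<open>h\<close>. The Poisson means of \<open>h\<close> lie below those of \<open>\<mu>\<close>,
  which tend to zero, yet they converge to \<open>h\<close> almost everywhere by Fatou; so
  \<open>h = 0\<close>.\<close>

lemma singular_of_radial_limit:
  assumes s: "sets \<mu> = sets circ" and fin: "finite_measure \<mu>"
    and lim: "AE x in circ. ((\<lambda>r. \<integral>z. poisson (of_real r * x) z \<partial>\<mu>) \<longlongrightarrow> 0) (at_left 1)"
  shows "singular_circ \<mu>"
proof -
  interpret finite_measure \<mu> by fact
  obtain A where A: "A \<in> null_sets circ" "\<And>E. E \<in> null_sets circ \<Longrightarrow> E \<inter> A = {} \<Longrightarrow> emeasure \<mu> E = 0"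
    using maximal_null_set[OF s fin] by blast
  have As: "A \<in> sets circ" using A by auto
  have Cs: "space circ - A \<in> sets \<mu>" unfolding s by (rule sets.compl_sets[OF As])
  define \<nu> where "\<nu> = density \<mu> (indicator (space circ - A))"
  have s\<nu>: "sets \<nu> = sets circ" by (simp add: \<nu>_def s)
  have Cm[measurable]: "(indicator (space circ - A) :: complex \<Rightarrow> ennreal) \<in> borel_measurable \<mu>" using Cs by auto
  have e\<nu>: "emeasure \<nu> E = emeasure \<mu> (E - A)" if "E \<in> sets circ" for E
  proof -
    have "emeasure \<nu> E = (\<integral>\<^sup>+z. indicator (space circ - A) z * indicator E z \<partial>\<mu>)"
      unfolding \<nu>_def using that s by (subst emeasure_density[OF Cm]) auto
    also have "\<dots> = (\<integral>\<^sup>+z. indicator (E - A) z \<partial>\<mu>)"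
      using sets.sets_into_space[OF that] by (intro nn_integral_cong) (auto simp: indicator_def)
    also have "\<dots> = emeasure \<mu> (E - A)" using that As s by simp
    finally show ?thesis .
  qed
  have "absolutely_continuous circ \<nu>"
    unfolding absolutely_continuous_def
  proof
    fix E assume E: "E \<in> null_sets circ"
    then have "E - A \<in> null_sets circ" using As by (auto intro: null_set_Diff)
    then have "emeasure \<mu> (E - A) = 0" by (rule A(2)) auto
    then show "E \<in> null_sets \<nu>" using e\<nu>[of E] E s\<nu> by auto
  qed
  from circ.Radon_Nikodym[OF this s\<nu>] obtain f where f: "f \<in> borel_measurable circ" "density circ f = \<nu>" by auto
  have ftot: "(\<integral>\<^sup>+z. f z \<partial>circ) < \<infinity>"
  proof -
    have "(\<integral>\<^sup>+z. f z \<partial>circ) = (\<integral>\<^sup>+z. f z * indicator (space circ) z \<partial>circ)"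
      by (intro nn_integral_cong) (auto simp: indicator_def)
    also have "\<dots> = emeasure \<nu> (space circ)"
      unfolding f(2)[symmetric] using f(1) by (subst emeasure_density) auto
    also have "\<dots> = emeasure \<mu> (space circ - A)" by (rule e\<nu>) (rule sets.top)
    also have "\<dots> < \<infinity>" unfolding infinity_ennreal_def less_top[symmetric] by (rule emeasure_finite)
    finally show ?thesis .
  qed
  have ffin: "AE z in circ. f z \<noteq> \<infinity>" by (rule nn_integral_PInf_AE) (use f ftot in auto)
  define h where "h z = enn2real (f z)" for z
  have hm[measurable]: "h \<in> borel_measurable circ" unfolding h_def[abs_def] using f(1) by measurable
  have fh: "AE z in circ. f z = ennreal (h z)" using ffin by eventually_elim (simp add: h_def less_top)
  have h0: "h z \<ge> 0" for z by (simp add: h_def)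
  have hi: "integrable circ h"
  proof (rule integrableI_nonneg)
    have "(\<integral>\<^sup>+z. ennreal (h z) \<partial>circ) = (\<integral>\<^sup>+z. f z \<partial>circ)"
      by (rule nn_integral_cong_AE) (use fh in eventually_elim, simp)
    then show "(\<integral>\<^sup>+z. ennreal (h z) \<partial>circ) < \<infinity>" using ftot by simp
  qed (use h0 in auto)
  have Ph: "(\<integral>z. poisson w z * h z \<partial>circ) \<le> (\<integral>z. poisson w z \<partial>\<mu>)" if w: "norm w < 1" for w
  proof -
    have pm: "poisson w \<in> borel_measurable \<mu>" using poisson_measurable by (simp add: measurable_cong_sets[OF s refl])
    have i: "integrable circ (\<lambda>z. poisson w z * h z)" using integrable_poisson[OF hi w] by simp
    have "ennreal (\<integral>z. poisson w z * h z \<partial>circ) = (\<integral>\<^sup>+z. ennreal (poisson w z * h z) \<partial>circ)"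
      by (rule nn_integral_eq_integral[OF i, symmetric]) (simp add: poisson_nonneg[OF w] h0)
    also have "\<dots> = (\<integral>\<^sup>+z. f z * ennreal (poisson w z) \<partial>circ)"
    proof (rule nn_integral_cong_AE)
      show "AE z in circ. ennreal (poisson w z * h z) = f z * ennreal (poisson w z)"
        using fh by eventually_elim (simp add: ennreal_mult'[OF h0] mult.commute[of "poisson w _"])
    qed
    also have "\<dots> = (\<integral>\<^sup>+z. ennreal (poisson w z) \<partial>\<nu>)"
      unfolding f(2)[symmetric] using f(1) by (subst nn_integral_density) auto
    also have "\<dots> = (\<integral>\<^sup>+z. indicator (space circ - A) z * ennreal (poisson w z) \<partial>\<mu>)"
      unfolding \<nu>_def using pm by (subst nn_integral_density[OF Cm]) auto
    also have "\<dots> \<le> (\<integral>\<^sup>+z. ennreal (poisson w z) \<partial>\<mu>)"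
      by (intro nn_integral_mono) (auto simp: indicator_def)
    also have "\<dots> = ennreal (\<integral>z. poisson w z \<partial>\<mu>)"
      by (rule nn_integral_eq_integral[OF poisson_integrable_finite(1)[OF s fin w]]) (simp add: poisson_nonneg[OF w])
    finally show ?thesis
      by (subst (asm) ennreal_le_iff) (auto intro!: integral_nonneg_AE simp: poisson_nonneg[OF w])
  qed
  have "AE x in circ. h x = 0"
    using lim fatou_lebesgue_points[OF hi] AE_circ_sphere
  proof eventually_elim
    case (elim x)
    have l: "((\<lambda>r. \<integral>z. poisson (of_real r * x) z * h z \<partial>circ) \<longlongrightarrow> h x) (at_left 1)"
      using poisson_integral_tendsto[OF hi elim(3) elim(2)] by simp
    from eventually_at_left_1_Ioo have "eventually (\<lambda>r. (\<integral>z. poisson (of_real r * x) z * h z \<partial>circ) \<le> (\<integral>z. poisson (of_real r * x) z \<partial>\<mu>)) (at_left 1)"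
      by eventually_elim (use elim(3) in \<open>auto intro!: Ph simp: norm_mult\<close>)
    from tendsto_le[OF _ elim(1) l this] have "h x \<le> 0" by simp
    then show ?case using h0[of x] by simp
  qed
  then have "AE z in circ. f z = 0" using fh by eventually_elim simp
  then have "(\<integral>\<^sup>+z. f z * indicator (space circ) z \<partial>circ) = (\<integral>\<^sup>+z. 0 \<partial>circ)"
    by (intro nn_integral_cong_AE) (auto elim: eventually_mono)
  then have "emeasure \<nu> (space circ) = 0"
    unfolding f(2)[symmetric] using f(1) by (subst emeasure_density) auto
  then have "emeasure \<mu> (space circ - A) = 0" using e\<nu>[OF sets.top] by simp
  then show ?thesis unfolding singular_circ_def using A(1) As by auto
qed

lemma AE_circ_not_False: "\<not> (AE x in circ. False)"
  by (simp add: circ.AE_False)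

text \<open>Besides the predicates, the zeros, the measure and the resulting formula for
  \<open>ext I\<close> are returned, because continuity across the circle is proved on the formula.
  The factor without zeros is the exponential of a Herglotz integral.\<close>

theorem canonical_factorization:
  assumes I: "inner_fun I"
  obtains B S \<mu> m a K c where "blaschke B" "singular_inner S \<mu>" "AE z in circ. I z = B z * S z"
    "\<And>n. n \<in> K \<Longrightarrow> norm (a n) < 1 \<and> a n \<noteq> 0"
    "summable (\<lambda>n. if n \<in> K then 1 - norm (a n) else 0)"
    "\<And>w. norm w < 1 \<Longrightarrow> ext B w = w ^ m * (\<Prod>n. blaschke_seq a K n w)"
    "\<And>w. norm w < 1 \<Longrightarrow> ext I w = w ^ m * (\<Prod>n. blaschke_seq a K n w) * (c * exp (- (\<integral>z. (z + w) / (z - w) \<partial>\<mu>)))"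
proof -
  have IH: "I \<in> H1" and I1: "AE z in circ. norm (I z) = 1" and Ii: "integrable circ I"
    using I Hinf_subset_H1 by (auto simp: inner_fun_def H1_def)
  have I1': "AE z in circ. norm (I z) \<le> 1" using I1 by eventually_elim simp
  have hol: "ext I holomorphic_on ball 0 1" by (rule ext_holomorphic[OF Ii])
  have bd: "norm (ext I w) \<le> 1" if "norm w < 1" for w by (rule norm_ext_le[OF IH I1' that])
  have rl: "AE x in circ. ((\<lambda>r. ext I (of_real r * x)) \<longlongrightarrow> I x) (at_left 1)" by (rule ext_radial_limit[OF IH])
  note ev = eventually_at_left_1_Ioo
  have "\<exists>w0. norm w0 < 1 \<and> ext I w0 \<noteq> 0"
  proof (rule ccontr)
    assume no: "\<not> ?thesis"
    have "AE x in circ. False"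
      using rl I1 AE_circ_sphere
    proof eventually_elim
      case (elim x)
      have "eventually (\<lambda>r. ext I (of_real r * x) = 0) (at_left 1)"
        using ev by eventually_elim (use no elim(3) in \<open>auto simp: norm_mult\<close>)
      from Lim_transform_eventually[OF elim(1) this] have "((\<lambda>r::real. 0) \<longlongrightarrow> I x) (at_left 1)" .
      then have "I x = 0" using tendsto_unique[OF _ _ tendsto_const] by (metis trivial_limit_at_left_real)
      then show False using elim(2) by simp
    qed
    then show False using AE_circ_not_False by simp
  qed
  then obtain w0 where w0: "norm w0 < 1" "ext I w0 \<noteq> 0" by auto
  obtain m a K s where D: "\<And>n. n \<in> K \<Longrightarrow> norm (a n) < 1 \<and> a n \<noteq> 0"
    "summable (\<lambda>n. if n \<in> K then 1 - norm (a n) else 0)"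
    "s holomorphic_on ball 0 1" "\<And>w. norm w < 1 \<Longrightarrow> norm (s w) \<le> 1 \<and> s w \<noteq> 0"
    "\<And>w. norm w < 1 \<Longrightarrow> ext I w = w ^ m * (\<Prod>n. blaschke_seq a K n w) * s w"
  proof (rule blaschke_decomposition[OF hol bd w0])
    fix m a K s assume *: "\<And>n. n \<in> K \<Longrightarrow> norm (a n) < 1 \<and> a n \<noteq> 0"
      "summable (\<lambda>n. if n \<in> K then 1 - norm (a n) else 0)"
      "s holomorphic_on ball 0 1" "\<And>w. norm w < 1 \<Longrightarrow> norm (s w) \<le> 1 \<and> s w \<noteq> 0"
      "\<And>w. norm w < 1 \<Longrightarrow> ext I w = w ^ m * (\<Prod>n. blaschke_seq a K n w) * s w"
    show thesis by (rule that[OF *])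
  qed
  define b where "b w = w ^ m * (\<Prod>n. blaschke_seq a K n w)" for w
  have bh: "b holomorphic_on ball 0 1"
    unfolding b_def[abs_def] by (intro holomorphic_on_mult holomorphic_on_power holomorphic_on_ident blaschke_seq_holomorphic(1)[OF D(1,2)])
  have b1: "norm (b w) \<le> 1" if "norm w < 1" for w
    unfolding b_def norm_mult norm_power
    using blaschke_seq_holomorphic(3)[OF D(1,2) that] that by (intro mult_le_one power_le_one) auto
  obtain B where B: "B \<in> Hinf" "\<And>w. norm w < 1 \<Longrightarrow> ext B w = b w" "AE x in circ. norm (B x) \<le> 1"
      "AE x in circ. ((\<lambda>r. b (of_real r * x)) \<longlongrightarrow> B x) (at_left 1)"
    using boundary_function[OF bh b1] by blast
  obtain S where S: "S \<in> Hinf" "\<And>w. norm w < 1 \<Longrightarrow> ext S w = s w" "AE x in circ. norm (S x) \<le> 1"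
      "AE x in circ. ((\<lambda>r. s (of_real r * x)) \<longlongrightarrow> S x) (at_left 1)"
    using boundary_function[OF D(3), of 1] D(4) by blast
  have IBS: "AE x in circ. I x = B x * S x"
    using rl B(4) S(4) AE_circ_sphere
  proof eventually_elim
    case (elim x)
    have "((\<lambda>r. b (of_real r * x) * s (of_real r * x)) \<longlongrightarrow> B x * S x) (at_left 1)"
      by (rule tendsto_mult[OF elim(2,3)])
    moreover have "eventually (\<lambda>r. b (of_real r * x) * s (of_real r * x) = ext I (of_real r * x)) (at_left 1)"
      using ev by eventually_elim (use elim(4) in \<open>auto simp: D(5) b_def norm_mult\<close>)
    ultimately have "((\<lambda>r. ext I (of_real r * x)) \<longlongrightarrow> B x * S x) (at_left 1)" by (rule Lim_transform_eventually)
    then show ?case using tendsto_unique[OF _ elim(1)] by simp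
  qed
  \<comment> \<open>Both boundary moduli are at most 1 and their product is 1, so neither can be
    smaller.\<close>
  have BS1: "AE x in circ. norm (B x) = 1 \<and> norm (S x) = 1"
    using IBS I1 B(3) S(3)
  proof eventually_elim
    case (elim x)
    then have p: "norm (B x) * norm (S x) = 1" by (metis norm_mult)
    have "norm (B x) * norm (S x) \<le> norm (B x) * 1" using elim(4) by (intro mult_left_mono) auto
    moreover have "norm (B x) * norm (S x) \<le> 1 * norm (S x)" using elim(3) by (intro mult_right_mono) auto
    ultimately show ?case using p elim by simp
  qed
  have Bi: "inner_fun B" using B(1) BS1 by (auto simp: inner_fun_def elim: eventually_mono)
  have Si: "inner_fun S" using S(1) BS1 by (auto simp: inner_fun_def elim: eventually_mono)
  have "blaschke B"
    unfolding blaschke_def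
  proof (intro conjI Bi exI[of _ "1::complex"] exI[of _ m] exI[of _ a] exI[of _ K] ballI)
    fix w :: complex assume "w \<in> ball 0 1"
    then have "ext B w = b w" using B(2)[of w] by simp
    then show "ext B w = 1 * w ^ m * (\<Prod>n. if n \<in> K then (of_real (norm (a n)) / a n) * (a n - w) / (1 - cnj (a n) * w) else 1)"
      by (simp only: b_def blaschke_factor_def mult_1_left)
  qed (use D(1,2) in auto)
  obtain g where g: "g holomorphic_on ball 0 1" "\<And>w. norm w < 1 \<Longrightarrow> s w = exp (g w)"
    using holomorphic_log_ball[OF D(3)] D(4) by blast
  define G where "G w = - g w" for w
  have Gh: "G holomorphic_on ball 0 1" unfolding G_def using g(1) by (intro holomorphic_intros)
  have Gp: "Re (G w) \<ge> 0" if "norm w < 1" for w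
  proof -
    have "exp (Re (g w)) \<le> 1" using D(4)[OF that] g(2)[OF that] by (simp add: norm_exp_eq_Re)
    then show ?thesis by (simp add: G_def)
  qed
  obtain \<mu> where \<mu>: "sets \<mu> = sets circ" "finite_measure \<mu>"
    "\<And>w. norm w < 1 \<Longrightarrow> G w = \<i> * of_real (Im (G 0)) + (\<integral>z. (z + w) / (z - w) \<partial>\<mu>)"
    using herglotz_representation[OF Gh Gp] by blast
  define c where "c = exp (- (\<i> * of_real (Im (G 0))))"
  have c1: "norm c = 1" by (simp add: c_def norm_exp_eq_Re)
  have sc: "s w = c * exp (- (\<integral>z. (z + w) / (z - w) \<partial>\<mu>))" if "norm w < 1" for w
  proof -
    have "s w = exp (- G w)" using g(2)[OF that] by (simp add: G_def)
    also have "- G w = - (\<i> * of_real (Im (G 0))) + - (\<integral>z. (z + w) / (z - w) \<partial>\<mu>)" using \<mu>(3)[OF that] by (metis minus_add_distrib)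
    finally show ?thesis by (simp add: c_def exp_add[symmetric] exp_minus_inverse)
  qed
  have sn: "(\<integral>z. poisson w z \<partial>\<mu>) = - ln (norm (s w))" if "norm w < 1" for w
    unfolding sc[OF that] norm_mult c1 norm_exp_eq_Re
    using poisson_integrable_finite(3)[OF \<mu>(1,2) that] by simp
  \<comment> \<open>The Poisson integral of \<open>\<mu>\<close> is \<open>- ln |s|\<close>, and
    \<open>|s|\<close> tends radially to \<open>|S| = 1\<close> almost everywhere.\<close>
  have "singular_circ \<mu>"
  proof (rule singular_of_radial_limit[OF \<mu>(1,2)])
    show "AE x in circ. ((\<lambda>r. \<integral>z. poisson (of_real r * x) z \<partial>\<mu>) \<longlongrightarrow> 0) (at_left 1)"
      using S(4) BS1 AE_circ_sphere
    proof eventually_elim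
      case (elim x)
      have "((\<lambda>r. - ln (norm (s (of_real r * x)))) \<longlongrightarrow> - ln (norm (S x))) (at_left 1)"
        using elim by (intro tendsto_minus tendsto_ln tendsto_norm) auto
      moreover have "eventually (\<lambda>r. - ln (norm (s (of_real r * x))) = (\<integral>z. poisson (of_real r * x) z \<partial>\<mu>)) (at_left 1)"
        using ev by eventually_elim (use elim(3) in \<open>auto simp: sn norm_mult\<close>)
      ultimately have "((\<lambda>r. \<integral>z. poisson (of_real r * x) z \<partial>\<mu>) \<longlongrightarrow> - ln (norm (S x))) (at_left 1)"
        by (rule Lim_transform_eventually)
      then show ?case using elim(2) by simp
    qed
  qed
  then have "singular_inner S \<mu>"
    unfolding singular_inner_def using Si \<mu>(1,2) c1 S(2) sc by auto
  then show ?thesis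
    using that[OF \<open>blaschke B\<close> _ IBS D(1,2), of \<mu> m c] B(2) D(5) sc by (simp add: b_def)
qed

section \<open>Inner functions off their singular set\<close>

text \<open>Dominated convergence: \<open>\<mu>\<close> has no mass within \<open>e\<close> of the
  boundary point, so for \<open>w\<close> within \<open>min 1 (e/2)\<close> of it numerators are at
  most 3 and denominators at least \<open>e/2\<close>, on either side of the circle.\<close>

lemma singular_integral_continuous:
  assumes s: "sets \<mu> = sets circ" and fin: "finite_measure \<mu>"
    and e: "e > 0" "emeasure \<mu> (ball \<zeta> e \<inter> sphere 0 1) = 0" and \<zeta>: "norm \<zeta> = 1"
  shows "isCont (\<lambda>w. \<integral>z. (z + w) / (z - w) \<partial>\<mu>) \<zeta>"
proof -
  interpret finite_measure \<mu> by fact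
  have sp: "space \<mu> = sphere 0 1" using sets_eq_imp_space_eq[OF s] by simp
  have "ball \<zeta> e \<inter> sphere 0 1 \<in> null_sets \<mu>" using e ball_sets_circ s by auto
  then have "AE z in \<mu>. z \<notin> ball \<zeta> e \<inter> sphere 0 1" by (rule AE_not_in)
  then have ae: "AE z in \<mu>. norm z = 1 \<and> e \<le> norm (z - \<zeta>)"
    using AE_space[of \<mu>] by eventually_elim (auto simp: sp dist_norm norm_minus_commute)
  have m: "(\<lambda>z. (z + w) / (z - w)) \<in> borel_measurable \<mu>" for w
  proof -
    have "(\<lambda>z. (z + w) / (z - w)) \<in> borel_measurable circ" by measurable
    then show ?thesis by (simp add: measurable_cong_sets[OF s refl])
  qed
  show ?thesis
    unfolding continuous_within_sequentially
  proof (intro allI impI, elim conjE)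
    fix X :: "nat \<Rightarrow> complex" assume X: "X \<longlonglongrightarrow> \<zeta>"
    define \<rho> where "\<rho> = min 1 (e/2)"
    have \<rho>: "\<rho> > 0" using e by (simp add: \<rho>_def)
    obtain N where N: "\<And>n. n \<ge> N \<Longrightarrow> norm (X n - \<zeta>) < \<rho>"
      using X \<rho> unfolding LIMSEQ_iff by blast
    have "(\<lambda>n. \<integral>z. (z + X (n + N)) / (z - X (n + N)) \<partial>\<mu>) \<longlonglongrightarrow> (\<integral>z. (z + \<zeta>) / (z - \<zeta>) \<partial>\<mu>)"
    proof (rule integral_dominated_convergence[where w="\<lambda>_. 3 / (e/2)"])
      show "AE z in \<mu>. (\<lambda>n. (z + X (n + N)) / (z - X (n + N))) \<longlonglongrightarrow> (z + \<zeta>) / (z - \<zeta>)"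
        using ae
      proof eventually_elim
        case (elim z)
        then have "z - \<zeta> \<noteq> 0" using e by auto
        then show ?case by (intro tendsto_intros LIMSEQ_ignore_initial_segment X)
      qed
      show "AE z in \<mu>. norm ((z + X (n + N)) / (z - X (n + N))) \<le> 3 / (e/2)" for n
        using ae
      proof eventually_elim
        case (elim z)
        have d: "norm (X (n + N) - \<zeta>) < \<rho>" by (rule N) simp
        have "norm (X (n + N)) \<le> 2"
          using norm_triangle_ineq2[of "X (n + N)" \<zeta>] d \<zeta> by (simp add: \<rho>_def)
        then have 1: "norm (z + X (n + N)) \<le> 3" using norm_triangle_ineq[of z "X (n + N)"] elim by simp
        have "norm (z - \<zeta>) \<le> norm (z - X (n + N)) + norm (X (n + N) - \<zeta>)"
          using norm_triangle_ineq[of "z - X (n + N)" "X (n + N) - \<zeta>"] by simp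
        then have 2: "e/2 \<le> norm (z - X (n + N))" using elim d by (simp add: \<rho>_def)
        show ?case unfolding norm_divide using 1 2 e by (intro frac_le) auto
      qed
    qed (use m in auto)
    then have "(\<lambda>n. \<integral>z. (z + X n) / (z - X n) \<partial>\<mu>) \<longlonglongrightarrow> (\<integral>z. (z + \<zeta>) / (z - \<zeta>) \<partial>\<mu>)"
      by (rule LIMSEQ_offset)
    then show "((\<lambda>w. \<integral>z. (z + w) / (z - w) \<partial>\<mu>) \<circ> X) \<longlonglongrightarrow> (\<integral>z. (z + \<zeta>) / (z - \<zeta>) \<partial>\<mu>)"
      by (simp add: o_def)
  qed
qed

text \<open>On the circle \<open>|1 - cnj (a n) \<zeta>| = |a n - \<zeta>|\<close>, so a boundary
  point away from the zeros is equally far from the reflected poles, and the product converges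
  uniformly around it.\<close>

lemma blaschke_product_continuous:
  assumes a: "\<And>n. n \<in> K \<Longrightarrow> norm (a n) < 1 \<and> a n \<noteq> 0"
    and s: "summable (\<lambda>n. if n \<in> K then 1 - norm (a n) else 0)"
    and \<zeta>: "norm \<zeta> = 1" and e: "e > 0" "\<And>n. n \<in> K \<Longrightarrow> e \<le> norm (a n - \<zeta>)"
  shows "isCont (\<lambda>w. \<Prod>n. blaschke_seq a K n w) \<zeta>"
proof -
  define \<rho> where "\<rho> = min 1 (e/2)"
  have \<rho>: "\<rho> > 0" "\<rho> \<le> 1" "\<rho> \<le> e/2" using e by (auto simp: \<rho>_def)
  have "continuous_on (cball \<zeta> \<rho>) (\<lambda>w. \<Prod>n. blaschke_seq a K n w)"
  proof (rule blaschke_seq_uniform_limit(2)[OF a s, where d="e/2"])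
    fix w assume "w \<in> cball \<zeta> \<rho>"
    then show "norm w \<le> 2" using norm_triangle_ineq2[of w \<zeta>] \<rho> \<zeta> by (simp add: dist_norm norm_minus_commute)
  next
    fix n w assume n: "n \<in> K" and w: "w \<in> cball \<zeta> \<rho>"
    have "\<zeta> * cnj \<zeta> = 1" using complex_norm_square[of \<zeta>] \<zeta> by simp
    then have "1 - cnj (a n) * \<zeta> = \<zeta> * cnj (\<zeta> - a n)" by (simp add: algebra_simps)
    then have "norm (1 - cnj (a n) * \<zeta>) = norm (a n - \<zeta>)"
      using \<zeta> by (simp add: norm_mult norm_minus_commute flip: complex_cnj_diff)
    then have 1: "e \<le> norm (1 - cnj (a n) * \<zeta>)" using e(2)[OF n] by simp
    have "norm (cnj (a n) * (w - \<zeta>)) \<le> 1 * norm (w - \<zeta>)"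
      unfolding norm_mult using a[OF n] by (intro mult_right_mono) auto
    then have 2: "norm (cnj (a n) * (w - \<zeta>)) \<le> e/2" using w \<rho> by (simp add: dist_norm norm_minus_commute)
    have eq: "1 - cnj (a n) * w = (1 - cnj (a n) * \<zeta>) - cnj (a n) * (w - \<zeta>)" by (simp add: algebra_simps)
    show "e/2 \<le> norm (1 - cnj (a n) * w)"
      unfolding eq using norm_triangle_ineq2[of "1 - cnj (a n) * \<zeta>" "cnj (a n) * (w - \<zeta>)"] 1 2 by linarith
  qed (use e in auto)
  then show ?thesis using \<rho> by (intro continuous_on_interior[of "cball \<zeta> \<rho>"]) auto
qed

text \<open>One decomposition suffices, as its singular set is contained in
  \<open>sigma_inner I\<close>. The explicit formula \<open>J\<close> makes sense on both sides of
  the circle near \<open>C\<close> and is continuous there; radial limits identify it with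
  \<open>I\<close> almost everywhere.\<close>

theorem inner_continuous_off_sigma:
  assumes I: "inner_fun I" and C: "C \<subseteq> sphere 0 1" "C \<inter> sigma_inner I = {}"
  obtains J where "continuous_on C J" "AE z in circ. z \<in> C \<longrightarrow> I z = J z"
proof -
  obtain B S \<mu> m a K c where F: "blaschke B" "singular_inner S \<mu>" "AE z in circ. I z = B z * S z"
    "\<And>n. n \<in> K \<Longrightarrow> norm (a n) < 1 \<and> a n \<noteq> 0"
    "summable (\<lambda>n. if n \<in> K then 1 - norm (a n) else 0)"
    "\<And>w. norm w < 1 \<Longrightarrow> ext B w = w ^ m * (\<Prod>n. blaschke_seq a K n w)"
    "\<And>w. norm w < 1 \<Longrightarrow> ext I w = w ^ m * (\<Prod>n. blaschke_seq a K n w) * (c * exp (- (\<integral>z. (z + w) / (z - w) \<partial>\<mu>)))"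
  proof (rule canonical_factorization[OF I])
    fix B S \<mu> m a K c assume *: "blaschke B" "singular_inner S \<mu>" "AE z in circ. I z = B z * S z"
      "\<And>n. n \<in> K \<Longrightarrow> norm (a n) < 1 \<and> a n \<noteq> 0"
      "summable (\<lambda>n. if n \<in> K then 1 - norm (a n) else 0)"
      "\<And>w. norm w < 1 \<Longrightarrow> ext B w = w ^ m * (\<Prod>n. blaschke_seq a K n w)"
      "\<And>w. norm w < 1 \<Longrightarrow> ext I w = w ^ m * (\<Prod>n. blaschke_seq a K n w) * (c * exp (- (\<integral>z. (z + w) / (z - w) \<partial>\<mu>)))"
    show thesis by (rule that[OF *])
  qed
  define J where "J w = w ^ m * (\<Prod>n. blaschke_seq a K n w) * (c * exp (- (\<integral>z. (z + w) / (z - w) \<partial>\<mu>)))" for w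
  have \<mu>: "sets \<mu> = sets circ" "finite_measure \<mu>" using F(2) by (auto simp: singular_inner_def)
  have sub: "zero_acc B \<union> measure_support \<mu> \<subseteq> sigma_inner I"
    unfolding sigma_inner_def using F(1-3) by blast
  have cont: "isCont J \<zeta>" if \<zeta>: "\<zeta> \<in> C" for \<zeta>
  proof -
    have n1: "norm \<zeta> = 1" using \<zeta> C by auto
    have ns: "\<zeta> \<notin> zero_acc B" "\<zeta> \<notin> measure_support \<mu>" using \<zeta> C(2) sub by auto
    obtain e1 where e1: "e1 > 0" "emeasure \<mu> (ball \<zeta> e1 \<inter> sphere 0 1) = 0"
      using ns(2) n1 by (auto simp: measure_support_def)
    obtain e2 where "e2 > 0" "\<forall>w\<in>{w \<in> ball 0 1. ext B w = 0}. \<not> (w \<noteq> \<zeta> \<and> dist w \<zeta> < e2)"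
      using ns(1) unfolding zero_acc_def islimpt_approachable by blast
    then have e2: "e2 > 0" "\<And>w. norm w < 1 \<Longrightarrow> ext B w = 0 \<Longrightarrow> w \<noteq> \<zeta> \<Longrightarrow> e2 \<le> dist w \<zeta>"
      by (auto simp: not_less)
    have "e2 \<le> norm (a n - \<zeta>)" if n: "n \<in> K" for n
    proof -
      have a1: "norm (a n) < 1" "a n \<noteq> \<zeta>" using F(4)[OF n] n1 by auto
      \<comment> \<open>\<open>zero_acc\<close> speaks of zeros of \<open>ext B\<close>, so each
        \<open>a n\<close> must be shown to be one: its own factor kills all partial products of
        length greater than \<open>n\<close>.\<close>
      have "(\<lambda>N. \<Prod>k<N. blaschke_seq a K k (a n)) \<longlonglongrightarrow> 0"
      proof (rule tendsto_eventually)
        have "(\<Prod>k<N. blaschke_seq a K k (a n)) = 0" if "N \<ge> Suc n" for N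
          using that n by (intro prod_zero) (auto simp: blaschke_factor_def intro!: bexI[of _ n])
        then show "\<forall>\<^sub>F N in sequentially. (\<Prod>k<N. blaschke_seq a K k (a n)) = 0"
          unfolding eventually_sequentially by blast
      qed
      then have "(\<Prod>k. blaschke_seq a K k (a n)) = 0"
        using LIMSEQ_unique[OF blaschke_seq_holomorphic(2)[OF F(4,5) a1(1)]] by blast
      then have "ext B (a n) = 0" using F(6)[OF a1(1)] by simp
      then show ?thesis using e2(2)[OF a1(1) _ a1(2)] by (simp add: dist_norm)
    qed
    from blaschke_product_continuous[OF F(4,5) n1 e2(1) this] singular_integral_continuous[OF \<mu> e1 n1]
    show ?thesis unfolding J_def by (intro continuous_intros)
  qed
  have "AE z in circ. z \<in> C \<longrightarrow> I z = J z"
  proof -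
    have IH: "I \<in> H1" using I Hinf_subset_H1 by (auto simp: inner_fun_def)
    from ext_radial_limit[OF IH] AE_circ_sphere show ?thesis
    proof eventually_elim
      case (elim x)
      show ?case
      proof
        assume x: "x \<in> C"
        have "((\<lambda>r. of_real r * x) \<longlongrightarrow> of_real 1 * x) (at_left 1)" by (intro tendsto_intros)
        then have "((\<lambda>r. J (of_real r * x)) \<longlongrightarrow> J x) (at_left 1)"
          using isCont_tendsto_compose[OF cont[OF x]] by simp
        moreover from eventually_at_left_1_Ioo have "eventually (\<lambda>r. J (of_real r * x) = ext I (of_real r * x)) (at_left 1)"
          by eventually_elim (use elim(2) in \<open>auto simp: J_def F(7) norm_mult\<close>)
        ultimately have "((\<lambda>r. ext I (of_real r * x)) \<longlongrightarrow> J x) (at_left 1)" by (rule Lim_transform_eventually)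
        then show "I x = J x" using tendsto_unique[OF _ elim(1)] by simp
      qed
    qed
  qed
  then show ?thesis using that[of J] cont by (simp add: continuous_at_imp_continuous_on)
qed

text \<open>On the circle \<open>cnj z = 1 / z\<close>, so \<open>Re z\<close> and
  \<open>Im z\<close> are rational in \<open>z\<close> with denominator \<open>z\<close> up to
  constants, and a power of \<open>z\<close> clears it. Polynomials from Stone-Weierstrass thus
  become entire functions divided by \<open>z ^ N\<close>.\<close>

lemma real_polynomial_on_circle:
  fixes f :: "complex \<Rightarrow> real"
  assumes "real_polynomial_function f"
  shows "\<exists>N p. p holomorphic_on UNIV \<and> (\<forall>z. norm z = 1 \<longrightarrow> of_real (f z) * z ^ N = p z)"
  using assms
proof (induction rule: real_polynomial_function.induct)
  case (linear f)
  define p where "p z = of_real (f 1) * ((z\<^sup>2 + 1) / 2) + of_real (f \<i>) * ((z\<^sup>2 - 1) / (2 * \<i>))" for z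
  have "of_real (f z) * z ^ 1 = p z" if z: "norm z = 1" for z
  proof -
    have "z * cnj z = 1" using complex_norm_square[of z] z by simp
    then have 1: "of_real (Re z) * z = (z\<^sup>2 + 1) / 2" "of_real (Im z) * z = (z\<^sup>2 - 1) / (2 * \<i>)"
    proof -
      assume zz: "z * cnj z = 1"
      have "of_real (Re z) = (z + cnj z) / 2" by (simp add: complex_add_cnj)
      then have "of_real (Re z) * z = (z * z + z * cnj z) / 2" by (simp add: field_simps)
      then show "of_real (Re z) * z = (z\<^sup>2 + 1) / 2" using zz by (simp add: power2_eq_square)
      have "of_real (Im z) = (z - cnj z) / (2 * \<i>)"
        by (subst nonzero_eq_divide_eq) (simp_all add: complex_eq_iff)
      then have "of_real (Im z) * z = (z * z - z * cnj z) / (2 * \<i>)"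
        by (simp only: times_divide_eq_left) (simp add: algebra_simps)
      then show "of_real (Im z) * z = (z\<^sup>2 - 1) / (2 * \<i>)" using zz by (simp add: power2_eq_square)
    qed
    have eq: "Re z *\<^sub>R 1 + Im z *\<^sub>R \<i> = z" by (simp add: complex_eq_iff)
    have lf: "linear f" using linear by (rule bounded_linear.linear)
    have "f z = Re z * f 1 + Im z * f \<i>"
      using linear_add[OF lf, of "Re z *\<^sub>R 1" "Im z *\<^sub>R \<i>"] linear_scale[OF lf, of "Re z" 1] linear_scale[OF lf, of "Im z" "\<i>"]
      by (simp only: eq real_scaleR_def)
    then have "of_real (f z) * z ^ 1 = of_real (f 1) * (of_real (Re z) * z) + of_real (f \<i>) * (of_real (Im z) * z)"
      by (simp add: algebra_simps)
    then show ?thesis unfolding 1 p_def .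
  qed
  moreover have "p holomorphic_on UNIV" unfolding p_def[abs_def] by (intro holomorphic_intros) auto
  ultimately show ?case by blast
next
  case (const c)
  show ?case by (intro exI[of _ 0] exI[of _ "\<lambda>_. of_real c"]) (auto intro!: holomorphic_intros)
next
  case (add f g)
  then obtain N p M q where pq: "p holomorphic_on UNIV" "q holomorphic_on UNIV"
    "\<And>z. norm z = 1 \<Longrightarrow> of_real (f z) * z ^ N = p z" "\<And>z. norm z = 1 \<Longrightarrow> of_real (g z) * z ^ M = q z" by blast
  have "of_real (f z + g z) * z ^ (N + M) = p z * z ^ M + q z * z ^ N" if "norm z = 1" for z
    unfolding pq(3)[OF that, symmetric] pq(4)[OF that, symmetric] by (simp add: power_add algebra_simps)
  moreover have "(\<lambda>z. p z * z ^ M + q z * z ^ N) holomorphic_on UNIV" using pq(1,2) by (intro holomorphic_intros)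
  ultimately show ?case by blast
next
  case (mult f g)
  then obtain N p M q where pq: "p holomorphic_on UNIV" "q holomorphic_on UNIV"
    "\<And>z. norm z = 1 \<Longrightarrow> of_real (f z) * z ^ N = p z" "\<And>z. norm z = 1 \<Longrightarrow> of_real (g z) * z ^ M = q z" by blast
  have "of_real (f z * g z) * z ^ (N + M) = p z * q z" if "norm z = 1" for z
    unfolding pq(3)[OF that, symmetric] pq(4)[OF that, symmetric] by (simp add: power_add algebra_simps)
  moreover have "(\<lambda>z. p z * q z) holomorphic_on UNIV" using pq(1,2) by (intro holomorphic_intros)
  ultimately show ?case by blast
qed

lemma trigonometric_approximation:
  fixes g :: "complex \<Rightarrow> complex"
  assumes K: "compact K" "K \<subseteq> sphere 0 1" and g: "continuous_on K g" and e: "e > 0"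
  obtains N p where "p holomorphic_on UNIV" "\<And>z. z \<in> K \<Longrightarrow> norm (g z * z ^ N - p z) < e"
proof -
  obtain q where q: "polynomial_function q" "\<And>z. z \<in> K \<Longrightarrow> norm (g z - q z) < e"
    using Stone_Weierstrass_polynomial_function[OF K(1) g e] by blast
  have "real_polynomial_function (Re \<circ> q)" "real_polynomial_function (Im \<circ> q)"
    using q(1) bounded_linear_Re bounded_linear_Im unfolding polynomial_function_def by blast+
  from this[THEN real_polynomial_on_circle] obtain N p M r where
    pr: "p holomorphic_on UNIV" "r holomorphic_on UNIV"
    "\<And>z. norm z = 1 \<Longrightarrow> of_real (Re (q z)) * z ^ N = p z" "\<And>z. norm z = 1 \<Longrightarrow> of_real (Im (q z)) * z ^ M = r z"
    by auto
  show ?thesis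
  proof (rule that[of "\<lambda>z. p z * z ^ M + \<i> * (r z * z ^ N)" "N + M"])
    show "(\<lambda>z. p z * z ^ M + \<i> * (r z * z ^ N)) holomorphic_on UNIV" using pr(1,2) by (intro holomorphic_intros)
    fix z assume z: "z \<in> K"
    then have z1: "norm z = 1" using K by auto
    have "p z * z ^ M + \<i> * (r z * z ^ N) = (of_real (Re (q z)) + \<i> * of_real (Im (q z))) * z ^ (N + M)"
      using pr(3,4)[OF z1, symmetric] by (simp add: power_add algebra_simps)
    also have "\<dots> = q z * z ^ (N + M)" using complex_eq[of "q z"] by simp
    finally have "g z * z ^ (N + M) - (p z * z ^ M + \<i> * (r z * z ^ N)) = (g z - q z) * z ^ (N + M)"
      by (simp add: algebra_simps)
    then show "norm (g z * z ^ (N + M) - (p z * z ^ M + \<i> * (r z * z ^ N))) < e"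
      using q(2)[OF z] z1 by (simp add: norm_mult norm_power)
  qed
qed

section \<open>The theorem\<close>

text \<open>On the circle \<open>- \<zeta> z / (\<zeta> - z)\<^sup>2 = 1 / |\<zeta> - z|\<^sup>2\<close>.  Hence a power of \<open>- \<zeta> / ((1 + \<eta>) \<zeta> - z)\<^sup>2\<close> supplies the
  argument of \<open>1 / z ^ N\<close> away from \<open>\<zeta>\<close> and stays analytic on the closed disc.\<close>

lemma positive_multiple_approximation:
  fixes g :: "complex \<Rightarrow> complex"
  assumes K: "compact K" "K \<subseteq> sphere 0 1" and \<zeta>: "norm \<zeta> = 1" "\<zeta> \<notin> K"
    and g: "continuous_on K g" and e: "e > 0"
  obtains h \<rho> \<kappa> where "h holomorphic_on ball 0 1" "continuous_on (cball 0 1) h" "\<kappa> > 0"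
    "\<And>z. z \<in> K \<Longrightarrow> \<kappa> \<le> \<rho> z" "\<And>z. z \<in> K \<Longrightarrow> norm (h z - of_real (\<rho> z) * g z) \<le> e * \<rho> z"
proof -
  obtain N p where p: "p holomorphic_on UNIV" "\<And>z. z \<in> K \<Longrightarrow> norm (g z * z ^ N - p z) < e / 3"
  proof -
    have "e / 3 > 0" using e by simp
    from trigonometric_approximation[OF K g this] show ?thesis using that by blast
  qed
  have "bounded (g ` K)" using K(1) g by (intro compact_imp_bounded compact_continuous_image)
  then obtain G where G: "G > 0" "\<And>z. z \<in> K \<Longrightarrow> norm (g z) \<le> G" unfolding bounded_pos by auto
  \<comment> \<open>The final error splits into \<open>2 e / 3\<close> from the polynomial
    approximation, whose factor of size at most \<open>2 \<rho> z\<close> uses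
    \<open>e2 <= 1\<close>, and \<open>e2 * G <= e / 3\<close> from moving the pole.\<close>
  define e2 where "e2 = min 1 (e / (3 * G))"
  have e2: "e2 > 0" "e2 \<le> 1" "e2 * G \<le> e / 3" using e G(1) by (auto simp: e2_def min_def field_simps)
  define E where "E \<eta> z = - \<zeta> / (of_real (1 + \<eta>) * \<zeta> - z)\<^sup>2" for \<eta> z
  define \<rho> where "\<rho> z = (1 / (norm (\<zeta> - z))\<^sup>2) ^ N" for z
  \<comment> \<open>Two points of the circle are at most 2 apart, so each factor of
    \<open>\<rho>\<close> is at least \<open>1/4\<close>.\<close>
  define \<kappa> :: real where "\<kappa> = (1/4) ^ N"
  have nz: "of_real (1 + \<eta>) * \<zeta> - z \<noteq> 0" if "\<eta> \<ge> 0" "z \<in> K" for \<eta> z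
  proof
    assume 0: "of_real (1 + \<eta>) * \<zeta> - z = 0"
    then have "norm (of_real (1 + \<eta>) * \<zeta>) = norm z" by simp
    then have "1 + \<eta> = 1" using that K(2) \<zeta>(1) by (auto simp: norm_mult simp del: of_real_add)
    then show False using 0 that \<zeta>(2) by auto
  qed
  have E0: "(z * E 0 z) ^ N = of_real (\<rho> z)" if z: "z \<in> K" for z
  proof -
    have z1: "norm z = 1" using z K by auto
    have zz: "z * cnj z = 1" "\<zeta> * cnj \<zeta> = 1" using complex_norm_square[of z] complex_norm_square[of \<zeta>] z1 \<zeta>(1) by auto
    have d: "\<zeta> - z \<noteq> 0" using z \<zeta>(2) by auto
    have "of_real ((norm (\<zeta> - z))\<^sup>2) * (z * \<zeta>) = (\<zeta> - z) * cnj (\<zeta> - z) * (z * \<zeta>)" by (simp only: complex_norm_square)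
    also have "\<dots> = (\<zeta> - z) * ((\<zeta> * cnj \<zeta>) * z - (z * cnj z) * \<zeta>)" by (simp add: algebra_simps)
    also have "\<dots> = - (\<zeta> - z)\<^sup>2" unfolding zz by (simp add: power2_eq_square algebra_simps)
    finally have "of_real ((norm (\<zeta> - z))\<^sup>2) * (z * \<zeta>) = - (\<zeta> - z)\<^sup>2" .
    then have "z * E 0 z = of_real (1 / (norm (\<zeta> - z))\<^sup>2)"
      using d unfolding E_def by (simp add: divide_simps) (simp add: algebra_simps)
    then show ?thesis by (simp add: \<rho>_def)
  qed
  have \<rho>\<kappa>: "\<kappa> \<le> \<rho> z" if z: "z \<in> K" for z
  proof -
    have "norm (\<zeta> - z) \<le> 2" using norm_triangle_ineq4[of \<zeta> z] z K \<zeta> by auto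
    then have "(norm (\<zeta> - z))\<^sup>2 \<le> 2\<^sup>2" by (intro power_mono) auto
    moreover have "(norm (\<zeta> - z))\<^sup>2 > 0" using z \<zeta>(2) by auto
    ultimately have "1/4 \<le> 1 / (norm (\<zeta> - z))\<^sup>2" by (intro divide_left_mono) auto
    then show ?thesis unfolding \<rho>_def \<kappa>_def by (intro power_mono) auto
  qed
  have \<kappa>: "\<kappa> > 0" by (simp add: \<kappa>_def)
  \<comment> \<open>The displacement \<open>\<eta>\<close> of the pole is included as a variable:
    uniform continuity on the compact product yields one \<open>\<eta> > 0\<close> that works for
    all \<open>z\<close> in \<open>K\<close>.\<close>
  have "continuous_on ({0..1} \<times> K) (\<lambda>x. (snd x * E (fst x) (snd x)) ^ N)"
    unfolding E_def using nz by (intro continuous_intros) auto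
  then have "uniformly_continuous_on ({0..1} \<times> K) (\<lambda>x. (snd x * E (fst x) (snd x)) ^ N)"
    using K(1) by (intro compact_uniformly_continuous compact_Times) auto
  then obtain d where d: "d > 0" "\<And>x y. x \<in> {0..1} \<times> K \<Longrightarrow> y \<in> {0..1} \<times> K \<Longrightarrow> dist y x < d \<Longrightarrow>
      dist ((snd y * E (fst y) (snd y)) ^ N) ((snd x * E (fst x) (snd x)) ^ N) < e2 * \<kappa>"
    unfolding uniformly_continuous_on_def using e2(1) \<kappa> by (metis mult_pos_pos)
  define \<eta> where "\<eta> = min 1 (d/2)"
  have \<eta>: "0 < \<eta>" "\<eta> \<le> 1" "\<eta> < d" using d by (auto simp: \<eta>_def)
  have E\<eta>: "norm ((z * E \<eta> z) ^ N - of_real (\<rho> z)) \<le> e2 * \<rho> z" if z: "z \<in> K" for z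
  proof -
    have "dist (\<eta>, z) (0, z) = \<bar>\<eta>\<bar>" by (simp add: dist_Pair_Pair dist_real_def)
    then have "dist ((z * E \<eta> z) ^ N) ((z * E 0 z) ^ N) < e2 * \<kappa>"
      using d(2)[of "(0, z)" "(\<eta>, z)"] z \<eta> by auto
    also have "e2 * \<kappa> \<le> e2 * \<rho> z" using \<rho>\<kappa>[OF z] e2 by (intro mult_left_mono) auto
    finally show ?thesis unfolding E0[OF z] by (simp add: dist_norm)
  qed
  define h where "h z = p z * E \<eta> z ^ N" for z
  have nzd: "of_real (1 + \<eta>) * \<zeta> - z \<noteq> 0" if "norm z \<le> 1" for z
  proof
    assume "of_real (1 + \<eta>) * \<zeta> - z = 0"
    then have "norm (of_real (1 + \<eta>) * \<zeta>) = norm z" by simp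
    then show False using that \<eta> \<zeta>(1) by (auto simp: norm_mult simp del: of_real_add)
  qed
  have h1: "h holomorphic_on ball 0 1"
    unfolding h_def[abs_def] E_def using nzd
    by (intro holomorphic_intros holomorphic_on_subset[OF p(1)]) auto
  have h2: "continuous_on (cball 0 1) h"
    unfolding h_def[abs_def] E_def using nzd
    by (intro continuous_intros holomorphic_on_imp_continuous_on holomorphic_on_subset[OF p(1)]) auto
  have h3: "norm (h z - of_real (\<rho> z) * g z) \<le> e * \<rho> z" if z: "z \<in> K" for z
  proof -
    have z1: "norm z = 1" using z K by auto
    then have z0: "z \<noteq> 0" by auto
    define A where "A = p z / z ^ N"
    define T where "T = (z * E \<eta> z) ^ N - of_real (\<rho> z)"
    have r0: "\<rho> z > 0" using \<rho>\<kappa>[OF z] \<kappa> by simp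
    have T: "norm T \<le> e2 * \<rho> z" unfolding T_def by (rule E\<eta>[OF z])
    have "A - g z = - (g z * z ^ N - p z) / z ^ N" using z0 by (simp add: A_def field_simps)
    then have "norm (A - g z) = norm (g z * z ^ N - p z)" using z1 by (simp add: norm_divide norm_power norm_minus_commute)
    then have A: "norm (A - g z) \<le> e / 3" using p(2)[OF z] by simp
    have "h z = A * (z * E \<eta> z) ^ N" using z0 by (simp add: h_def A_def power_mult_distrib)
    then have "h z - of_real (\<rho> z) * g z = (A - g z) * (of_real (\<rho> z) + T) + g z * T"
      by (simp add: T_def algebra_simps)
    then have "norm (h z - of_real (\<rho> z) * g z) \<le> norm (A - g z) * norm (of_real (\<rho> z) + T) + norm (g z) * norm T"
      by (metis norm_mult norm_triangle_ineq)
    also have "\<dots> \<le> (e / 3) * (2 * \<rho> z) + G * (e2 * \<rho> z)"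
    proof (intro add_mono mult_mono A T G(2) z)
      have "norm (of_real (\<rho> z) + T) \<le> \<rho> z + e2 * \<rho> z"
        using norm_triangle_ineq[of "of_real (\<rho> z)" T] T r0 by simp
      also have "\<dots> \<le> 2 * \<rho> z" using e2(2) r0 mult_right_mono[of e2 1 "\<rho> z"] by simp
      finally show "norm (of_real (\<rho> z) + T) \<le> 2 * \<rho> z" .
    qed (use e G r0 in auto)
    also have "G * (e2 * \<rho> z) = (e2 * G) * \<rho> z" by simp
    also have "(e / 3) * (2 * \<rho> z) + (e2 * G) * \<rho> z \<le> (e / 3) * (2 * \<rho> z) + (e / 3) * \<rho> z"
      using e2(3) r0 by (intro add_left_mono mult_right_mono) auto
    also have "\<dots> = e * \<rho> z" by (simp add: field_simps)
    finally show ?thesis .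
  qed
  show ?thesis by (rule that[OF h1 h2 \<kappa> \<rho>\<kappa> h3])
qed

text \<open>The Herglotz integral of \<open>ln |\<Phi>|\<close> is \<open>U + V\<close>, with
  \<open>U\<close> from \<open>u\<close> and \<open>V\<close> from \<open>v\<close>. Since
  \<open>u\<close> is bounded, \<open>G = exp (- U)\<close> is bounded above and below, and
  \<open>ext \<Phi> * G / c = exp V\<close>. The limit of \<open>V\<close> has real part
  \<open>v\<close> by Fatou and imaginary part \<open>conj_fun v\<close>.\<close>

lemma outer_argument:
  assumes \<Phi>: "outer_fun \<Phi>" and u: "integrable circ u" "AE z in circ. \<bar>u z\<bar> \<le> C" and v: "integrable circ v"
    and w: "AE z in circ. norm (\<Phi> z) = exp (u z + v z)"
  obtains c G g where "norm c = 1" "G holomorphic_on ball 0 1" "\<And>w. norm w < 1 \<Longrightarrow> norm (G w) \<le> exp C"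
    "AE x in circ. ((\<lambda>r. G (of_real r * x)) \<longlongrightarrow> g x) (at_left 1)"
    "AE x in circ. \<Phi> x * g x = c * of_real (exp (v x)) * cis (conj_fun v x)"
proof -
  have \<Phi>1: "\<Phi> \<in> H1" using \<Phi> by (simp add: outer_fun_def)
  obtain c where c: "norm c = 1" "\<And>w. norm w < 1 \<Longrightarrow>
      ext \<Phi> w = c * exp (\<integral>z. ((z + w) / (z - w)) * of_real (ln (norm (\<Phi> z))) \<partial>circ)"
    using \<Phi> by (auto simp: outer_fun_def)
  define U where "U w = (\<integral>z. (z + w) / (z - w) * complex_of_real (u z) \<partial>circ)" for w
  define V where "V w = (\<integral>z. (z + w) / (z - w) * complex_of_real (v z) \<partial>circ)" for w
  have Uh: "U holomorphic_on ball 0 1" unfolding U_def by (rule herglotz_holomorphic) (use u in simp)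
  have Vh: "V holomorphic_on ball 0 1" unfolding V_def by (rule herglotz_holomorphic) (use v in simp)
  have UV: "(\<integral>z. ((z + w) / (z - w)) * of_real (ln (norm (\<Phi> z))) \<partial>circ) = U w + V w" if w': "norm w < 1" for w
  proof -
    have "(\<integral>z. ((z + w) / (z - w)) * of_real (ln (norm (\<Phi> z))) \<partial>circ)
        = (\<integral>z. (z + w) / (z - w) * complex_of_real (u z) + (z + w) / (z - w) * complex_of_real (v z) \<partial>circ)"
    proof (rule integral_cong_AE)
      show "AE z in circ. ((z + w) / (z - w)) * of_real (ln (norm (\<Phi> z))) = (z + w) / (z - w) * complex_of_real (u z) + (z + w) / (z - w) * complex_of_real (v z)"
        using w by eventually_elim (simp only: ln_exp of_real_add distrib_left)
      have [measurable]: "\<Phi> \<in> borel_measurable circ" "u \<in> borel_measurable circ" "v \<in> borel_measurable circ"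
        using \<Phi>1 u v by (auto simp: H1_def)
      show "(\<lambda>z. ((z + w) / (z - w)) * complex_of_real (ln (norm (\<Phi> z)))) \<in> borel_measurable circ" by measurable
      show "(\<lambda>z. (z + w) / (z - w) * complex_of_real (u z) + (z + w) / (z - w) * complex_of_real (v z)) \<in> borel_measurable circ" by measurable
    qed
    also have "\<dots> = U w + V w" unfolding U_def V_def
      by (intro Bochner_Integration.integral_add integrable_herglotz_kernel(1) w') (use u v in auto)
    finally show ?thesis .
  qed
  have ReU: "\<bar>Re (U w)\<bar> \<le> C" if w': "norm w < 1" for w
  proof -
    have "Re (U w) = (\<integral>z. poisson w z * u z \<partial>circ)" unfolding U_def by (rule Re_herglotz[OF u(1) w'])
    also have "\<bar>\<dots>\<bar> \<le> (\<integral>z. \<bar>poisson w z * u z\<bar> \<partial>circ)" by (rule integral_abs_bound)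
    also have "\<dots> \<le> (\<integral>z. poisson w z * C \<partial>circ)"
    proof (rule integral_mono_AE)
      show "AE z in circ. \<bar>poisson w z * u z\<bar> \<le> poisson w z * C"
        using u(2) by eventually_elim (auto simp: abs_mult poisson_nonneg[OF w'] intro!: mult_left_mono)
    qed (use integrable_poisson[OF u(1) w'] integrable_poisson[OF _ w', of "\<lambda>_. C"] in auto)
    also have "\<dots> = C" using integral_poisson[OF w'] by simp
    finally show ?thesis .
  qed
  define G where "G w = exp (- U w)" for w
  have Gh: "G holomorphic_on ball 0 1" unfolding G_def[abs_def] using Uh by (intro holomorphic_intros)
  have Gb: "norm (G w) \<le> exp C" "exp (- C) \<le> norm (G w)" if "norm w < 1" for w
    using ReU[OF that] by (auto simp: G_def norm_exp_eq_Re)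
  obtain g where g: "g \<in> Hinf" "\<And>w. norm w < 1 \<Longrightarrow> ext g w = G w" "AE x in circ. norm (g x) \<le> exp C"
      "AE x in circ. ((\<lambda>r. G (of_real r * x)) \<longlongrightarrow> g x) (at_left 1)"
    using boundary_function[OF Gh Gb(1)] by blast
  note ev = eventually_at_left_1_Ioo
  have c0: "c \<noteq> 0" using c(1) by auto
  have "AE x in circ. \<Phi> x * g x = c * of_real (exp (v x)) * cis (conj_fun v x)"
    using ext_radial_limit[OF \<Phi>1] g(4) fatou_lebesgue_points[OF v] AE_circ_sphere w
  proof eventually_elim
    case (elim x)
    have in1: "norm (of_real r * x) < 1" if "r \<in> {0<..<1}" for r using that elim(4) by (simp add: norm_mult)
    have "((\<lambda>r. norm (G (of_real r * x))) \<longlongrightarrow> norm (g x)) (at_left 1)" by (rule tendsto_norm[OF elim(2)])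
    moreover have "eventually (\<lambda>r. exp (- C) \<le> norm (G (of_real r * x))) (at_left 1)"
      using ev by eventually_elim (intro Gb in1)
    \<comment> \<open>The lower bound survives the radial limit. A nonzero limit of
      \<open>exp V\<close> is essential, as otherwise \<open>V\<close> itself could diverge.\<close>
    ultimately have "exp (- C) \<le> norm (g x)" by (intro tendsto_lowerbound[of _ _ "at_left (1::real)"]) auto
    then have "g x \<noteq> 0" using exp_gt_zero[of "- C"] by (metis norm_zero not_less)
    moreover have "\<Phi> x \<noteq> 0" using elim(5) by (metis exp_not_eq_zero norm_zero)
    ultimately have nz: "\<Phi> x * g x / c \<noteq> 0" using c0 by simp
    have "((\<lambda>r. ext \<Phi> (of_real r * x) * G (of_real r * x) / c) \<longlongrightarrow> \<Phi> x * g x / c) (at_left 1)"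
      by (intro tendsto_intros elim c0)
    moreover have "eventually (\<lambda>r. ext \<Phi> (of_real r * x) * G (of_real r * x) / c = exp (V (of_real r * x))) (at_left 1)"
      using ev
    proof eventually_elim
      case (elim r)
      have "ext \<Phi> (of_real r * x) = c * exp (U (of_real r * x) + V (of_real r * x))"
        using c(2)[OF in1[OF elim]] UV[OF in1[OF elim]] by simp
      then show ?case using c0 by (simp add: G_def exp_add exp_minus)
    qed
    ultimately have lim: "((\<lambda>r. exp (V (of_real r * x))) \<longlongrightarrow> \<Phi> x * g x / c) (at_left 1)"
      by (rule Lim_transform_eventually)
    have "continuous_on {0<..<1} (\<lambda>r. V (of_real r * x))"
      by (rule continuous_on_compose2[OF holomorphic_on_imp_continuous_on[OF Vh]])
         (use in1 in \<open>auto intro!: continuous_intros\<close>)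
    from exp_limit_imp_limit[OF this lim nz] obtain l where l: "((\<lambda>r. V (of_real r * x)) \<longlongrightarrow> l) (at_left 1)" by blast
    have el: "exp l = \<Phi> x * g x / c"
      using tendsto_unique[OF _ tendsto_exp[OF l] lim] by simp
    have im: "conj_fun v x = Im l"
      by (rule conj_fun_eq_radial_limit[OF v elim(4) elim(3)]) (use l in \<open>simp add: V_def\<close>)
    have "((\<lambda>r. \<integral>z. poisson (of_real r * x) z * v z \<partial>circ) \<longlongrightarrow> v x) (at_left 1)"
      using poisson_integral_tendsto[OF v elim(4) elim(3)] by simp
    moreover have "eventually (\<lambda>r. (\<integral>z. poisson (of_real r * x) z * v z \<partial>circ) = Re (V (of_real r * x))) (at_left 1)"
      using ev by eventually_elim (unfold V_def, rule Re_herglotz[OF v in1, symmetric])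
    ultimately have "((\<lambda>r. Re (V (of_real r * x))) \<longlongrightarrow> v x) (at_left 1)" by (rule Lim_transform_eventually)
    then have re: "Re l = v x" using tendsto_unique[OF _ tendsto_Re[OF l]] by simp
    have "exp l = of_real (exp (v x)) * cis (conj_fun v x)"
      unfolding exp_eq_polar re im by (simp add: exp_of_real)
    then show ?case using el c0 by (simp add: field_simps)
  qed
  then show ?thesis using that[OF c(1) Gh Gb(1) g(4)] by blast
qed

section \<open>The essential supremum and failure of saturation\<close>

lemma linf_norm_nonneg:
  assumes "AE z in circ. norm (f z) \<le> C"
  shows "0 \<le> linf_norm f"
proof -
  have "AE z in circ. norm (f z) \<le> max C 0" using assms by eventually_elim simp
  then have "{C. 0 \<le> C \<and> (AE z in circ. norm (f z) \<le> C)} \<noteq> {}" by (auto intro!: exI[of _ "max C 0"])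
  then show ?thesis unfolding linf_norm_def by (rule cInf_greatest) auto
qed

lemma linf_norm_le:
  assumes "AE z in circ. norm (f z) \<le> C" "0 \<le> C"
  shows "linf_norm f \<le> C"
  unfolding linf_norm_def by (rule cInf_lower) (use assms in \<open>auto intro!: bdd_belowI[of _ 0]\<close>)

text \<open>The infimum is itself an essential bound: the exceptional sets of countably many bounds
  decreasing to it have a null union.\<close>

lemma AE_le_linf_norm:
  assumes "AE z in circ. norm (f z) \<le> C"
  shows "AE z in circ. norm (f z) \<le> linf_norm f"
proof -
  define X where "X = {C. 0 \<le> C \<and> (AE z in circ. norm (f z) \<le> C)}"
  have "AE z in circ. norm (f z) \<le> max C 0" using assms by eventually_elim simp
  then have X: "X \<noteq> {}" by (auto simp: X_def intro!: exI[of _ "max C 0"])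
  have "AE z in circ. norm (f z) \<le> linf_norm f + 1 / real (Suc n)" for n
  proof -
    have "Inf X < linf_norm f + 1 / real (Suc n)" by (simp add: linf_norm_def X_def)
    then obtain C' where "C' \<in> X" "C' < linf_norm f + 1 / real (Suc n)" using cInf_lessD[OF X] by blast
    then show ?thesis unfolding X_def by (auto elim: eventually_mono)
  qed
  then have "AE z in circ. \<forall>n. norm (f z) \<le> linf_norm f + 1 / real (Suc n)" by (simp add: AE_all_countable)
  then show ?thesis
  proof eventually_elim
    case (elim z)
    have "(\<lambda>n. linf_norm f + 1 / real (Suc n)) \<longlonglongrightarrow> linf_norm f + 0"
      by (intro tendsto_intros LIMSEQ_Suc[OF lim_1_over_n])
    then show ?case using elim by (intro LIMSEQ_le_const[where X="\<lambda>n. linf_norm f + 1 / real (Suc n)"]) auto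
  qed
qed

lemma linf_norm_cong_norm:
  assumes "AE z in circ. norm (f z) = norm (g z)"
  shows "linf_norm f = linf_norm g"
proof -
  have "(AE z in circ. norm (f z) \<le> C) \<longleftrightarrow> (AE z in circ. norm (g z) \<le> C)" for C
  proof
    show "AE z in circ. norm (g z) \<le> C" if "AE z in circ. norm (f z) \<le> C"
      using assms that by eventually_elim simp
    show "AE z in circ. norm (f z) \<le> C" if "AE z in circ. norm (g z) \<le> C"
      using assms that by eventually_elim simp
  qed
  then show ?thesis by (simp add: linf_norm_def)
qed

lemma not_saturated_of_direction:
  assumes \<phi>: "\<phi> \<in> Hinf" and \<delta>: "0 < \<delta>" "\<delta> < 1" and L: "0 < linf_norm \<phi>"
    and f: "f \<in> Hinf0" and k: "0 < k"
    and dir: "AE z in circ. linf_norm \<phi> * \<delta> \<le> norm (\<phi> z) \<longrightarrow> k \<le> Re (\<phi> z * f z)"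
  shows "\<not> saturated \<phi>"
proof -
  define L where "L = linf_norm \<phi>"
  have Lp: "L > 0" using L by (simp add: L_def)
  obtain C where C: "AE z in circ. norm (\<phi> z) \<le> C" using \<phi> by (auto simp: Hinf_def Linf_def)
  have \<phi>L: "AE z in circ. norm (\<phi> z) \<le> L" unfolding L_def by (rule AE_le_linf_norm[OF C])
  obtain M0 where M0: "AE z in circ. norm (f z) \<le> M0" using f by (auto simp: Hinf0_def Hinf_def Linf_def)
  define M where "M = max M0 1"
  have M: "AE z in circ. norm (f z) \<le> M" "M > 0"
    using M0 by (auto simp: M_def elim: eventually_mono)
  \<comment> \<open>The first entry makes the quadratic term \<open>t^2 |f|^2\<close> at most
    \<open>t k\<close>, half of the linear gain; the second keeps the perturbation of the small
    values below half of the gap \<open>L (1 - \<delta>)\<close>.\<close>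
  define t where "t = min (k / M\<^sup>2) (L * (1 - \<delta>) / (2 * M))"
  have t0: "t > 0" using k M Lp \<delta> by (simp add: t_def)
  have t1: "t * M\<^sup>2 \<le> k"
  proof -
    have "t * M\<^sup>2 \<le> k / M\<^sup>2 * M\<^sup>2" by (intro mult_right_mono) (auto simp: t_def)
    then show ?thesis using M(2) by simp
  qed
  have t2: "t * M \<le> L * (1 - \<delta>) / 2"
  proof -
    have "t * M \<le> L * (1 - \<delta>) / (2 * M) * M" using M(2) by (intro mult_right_mono) (auto simp: t_def)
    then show ?thesis using M(2) by simp
  qed
  define F where "F z = of_real t * f z" for z
  have fi: "integrable circ f" using f Hinf_subset_H1 by (auto simp: Hinf0_def H1_def)
  have fF: "fourier F n = of_real t * fourier f n" for n
    unfolding fourier_def F_def mult.assoc by (rule integral_mult_right_zero)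
  have Fm: "F \<in> borel_measurable circ" unfolding F_def[abs_def] using borel_measurable_integrable[OF fi] by measurable
  have "AE z in circ. norm (F z) \<le> t * M"
    using M(1) by eventually_elim (use t0 in \<open>simp add: F_def norm_mult\<close>)
  then have F0: "F \<in> Hinf0"
    using f Fm fF unfolding Hinf0_def Hinf_def Linf_def by auto
  define b where "b = max (sqrt (max 0 (L\<^sup>2 - t * k))) (L * (1 + \<delta>) / 2)"
  have "sqrt (max 0 (L\<^sup>2 - t * k)) < L"
  proof -
    have "max 0 (L\<^sup>2 - t * k) < L\<^sup>2" using Lp t0 k by simp
    then have "sqrt (max 0 (L\<^sup>2 - t * k)) < sqrt (L\<^sup>2)" by (rule real_sqrt_less_mono)
    then show ?thesis using Lp by simp
  qed
  moreover have "L * (1 + \<delta>) / 2 < L" using Lp \<delta> by (simp add: field_simps)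
  ultimately have bL: "b < L" by (simp add: b_def)
  have b0: "b \<ge> 0" unfolding b_def by (simp add: le_max_iff_disj)
  have "AE z in circ. norm (\<phi> z - cnj (F z)) \<le> b"
    using dir \<phi>L M(1)
  proof eventually_elim
    case (elim z)
    show ?case
    proof (cases "L * \<delta> \<le> norm (\<phi> z)")
      case True
      then have kz: "k \<le> Re (\<phi> z * f z)" using elim(1) by (simp add: L_def)
      have "(norm (\<phi> z - cnj (F z)))\<^sup>2 = (norm (\<phi> z))\<^sup>2 - 2 * t * Re (\<phi> z * f z) + t\<^sup>2 * (norm (f z))\<^sup>2"
        unfolding cmod_power2 F_def by (simp add: power2_eq_square algebra_simps)
      also have "\<dots> \<le> L\<^sup>2 - 2 * t * k + t * k"
      proof (intro add_mono diff_mono)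
        show "(norm (\<phi> z))\<^sup>2 \<le> L\<^sup>2" using elim(2) by (intro power_mono) auto
        show "2 * t * k \<le> 2 * t * Re (\<phi> z * f z)" using kz t0 by (intro mult_left_mono) auto
        have "t\<^sup>2 * (norm (f z))\<^sup>2 \<le> t\<^sup>2 * M\<^sup>2" using elim(3) by (intro mult_left_mono power_mono) auto
        also have "\<dots> = t * (t * M\<^sup>2)" by (simp add: power2_eq_square)
        also have "\<dots> \<le> t * k" using t1 t0 by (intro mult_left_mono) auto
        finally show "t\<^sup>2 * (norm (f z))\<^sup>2 \<le> t * k" .
      qed
      also have "\<dots> \<le> max 0 (L\<^sup>2 - t * k)" by (simp add: mult.commute[of k])
      finally have "norm (\<phi> z - cnj (F z)) \<le> sqrt (max 0 (L\<^sup>2 - t * k))" by (rule real_le_rsqrt)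
      then show ?thesis by (simp add: b_def)
    next
      case False
      have "norm (\<phi> z - cnj (F z)) \<le> norm (\<phi> z) + norm (F z)" using norm_triangle_ineq4[of "\<phi> z" "cnj (F z)"] by simp
      also have "norm (F z) = t * norm (f z)" using t0 by (simp add: F_def norm_mult)
      also have "norm (\<phi> z) + t * norm (f z) \<le> L * \<delta> + t * M" using False elim(3) t0 by (intro add_mono mult_left_mono) auto
      also have "\<dots> \<le> L * \<delta> + L * (1 - \<delta>) / 2" using t2 by simp
      also have "\<dots> = L * (1 + \<delta>) / 2" by (simp add: field_simps)
      finally show ?thesis by (simp add: b_def)
    qed
  qed
  then have "linf_norm (\<lambda>z. \<phi> z - cnj (F z)) \<le> b" using b0 by (rule linf_norm_le)
  \<comment> \<open>\<open>Inf\<close> on the reals is a lower bound only for sets bounded below;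
    here 0 is a lower bound because every competitor is essentially bounded.\<close>
  moreover have "Inf {linf_norm (\<lambda>z. \<phi> z - cnj (f z)) | f. f \<in> Hinf0} \<le> linf_norm (\<lambda>z. \<phi> z - cnj (F z))"
  proof (rule cInf_lower)
    show "bdd_below {linf_norm (\<lambda>z. \<phi> z - cnj (f z)) | f. f \<in> Hinf0}"
    proof (rule bdd_belowI[of _ 0], clarify)
      fix g assume "g \<in> Hinf0"
      then obtain D where D: "AE z in circ. norm (g z) \<le> D" by (auto simp: Hinf0_def Hinf_def Linf_def)
      have "AE z in circ. norm (\<phi> z - cnj (g z)) \<le> C + D"
        using C D
      proof eventually_elim
        case (elim z)
        then show ?case using norm_triangle_ineq4[of "\<phi> z" "cnj (g z)"] by simp
      qed
      then show "0 \<le> linf_norm (\<lambda>z. \<phi> z - cnj (g z))" by (rule linf_norm_nonneg)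
    qed
  qed (use F0 in auto)
  ultimately show ?thesis using bL unfolding saturated_def L_def by linarith
qed

theorem theorem5:
  fixes \<phi> \<Phi> I :: "complex \<Rightarrow> complex" and \<delta> :: real
  assumes "\<phi> \<in> Hinf"
    and "inner_fun I"
    and "outer_fun \<Phi>"
    and "AE z in circ. \<phi> z = \<Phi> z * I z"
    and "0 < \<delta>" and "\<delta> < 1"
    and "apical_HS (\<lambda>z. norm (\<phi> z)) \<delta>"
    and "top_of_set (sphere 0 1) interior_of Lminus \<Phi> \<delta> \<noteq> {}"
    and "sigma_inner I \<subseteq> top_of_set (sphere 0 1) interior_of Lminus \<Phi> \<delta>"
  shows "\<not> saturated \<phi>"
proof -
  define Q where "Q = top_of_set (sphere 0 1) interior_of Lminus \<Phi> \<delta>"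
  define K where "K = sphere 0 1 - Q"
  define L where "L = linf_norm \<phi>"
  have I1: "AE z in circ. norm (I z) = 1" using assms(2) by (simp add: inner_fun_def)
  have n\<Phi>: "AE z in circ. norm (\<Phi> z) = norm (\<phi> z)"
    using assms(4) I1 by eventually_elim (simp add: norm_mult)
  have L\<Phi>: "linf_norm \<Phi> = L" unfolding L_def by (rule linf_norm_cong_norm[OF n\<Phi>])
  have Ln: "linf_norm (\<lambda>z. norm (\<phi> z)) = L" unfolding L_def by (rule linf_norm_cong_norm) simp
  obtain u v c0 where uv: "u \<in> Linf" "integrable circ v" "AE z in circ. norm (\<phi> z) = exp (u z + v z)"
      "c0 < pi / 2" "AE z in circ. z \<in> Lplus (\<lambda>z. norm (\<phi> z)) \<delta> \<longrightarrow> \<bar>conj_fun v z\<bar> \<le> c0"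
    using assms(7) by (auto simp: apical_HS_def)
  obtain C where C: "AE z in circ. \<bar>u z\<bar> \<le> C" using uv(1) by (auto simp: Linf_def)
  have ui: "integrable circ u" using uv(1) C by (intro integrable_circ_bounded[where C=C]) (auto simp: Linf_def)
  obtain C\<phi> where C\<phi>: "AE z in circ. norm (\<phi> z) \<le> C\<phi>" using assms(1) by (auto simp: Hinf_def Linf_def)
  \<comment> \<open>The weight \<open>exp (u + v)\<close> is strictly positive, so
    \<open>\<phi>\<close> cannot vanish almost everywhere.\<close>
  have Lp: "L > 0"
  proof (rule ccontr)
    assume L0: "\<not> L > 0"
    have "AE z in circ. norm (\<phi> z) \<le> L" unfolding L_def by (rule AE_le_linf_norm[OF C\<phi>])
    then have "AE z in circ. False" using uv(3)
    proof eventually_elim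
      case (elim z)
      then show False using L0 exp_gt_zero[of "u z + v z"] by linarith
    qed
    then show False using AE_circ_not_False by simp
  qed
  have w: "AE z in circ. norm (\<Phi> z) = exp (u z + v z)" using n\<Phi> uv(3) by eventually_elim simp
  obtain c G g where cGg: "norm c = 1" "G holomorphic_on ball 0 1" "\<And>w. norm w < 1 \<Longrightarrow> norm (G w) \<le> exp C"
    "AE x in circ. ((\<lambda>r. G (of_real r * x)) \<longlongrightarrow> g x) (at_left 1)"
    "AE x in circ. \<Phi> x * g x = c * of_real (exp (v x)) * cis (conj_fun v x)"
    using outer_argument[OF assms(3) ui C uv(2) w] by blast
  have Oopen: "openin (top_of_set (sphere 0 1)) Q" unfolding Q_def by (rule openin_interior_of)
  have OL: "Q \<subseteq> Lminus \<Phi> \<delta>" unfolding Q_def by (rule interior_of_subset)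
  have "closedin (top_of_set (sphere 0 1)) K" unfolding K_def using closedin_diff[OF closedin_topspace Oopen] by simp
  then have Kc: "compact K" by (rule closedin_compact[OF compact_sphere])
  have Ks: "K \<subseteq> sphere 0 1" by (auto simp: K_def)
  obtain \<zeta> where "\<zeta> \<in> Q" using assms(8) unfolding Q_def[symmetric] by blast
  then have \<zeta>: "norm \<zeta> = 1" "\<zeta> \<notin> K" using OL by (auto simp: K_def Lminus_def)
  have "K \<inter> sigma_inner I = {}" using assms(9) unfolding Q_def[symmetric] K_def by blast
  from inner_continuous_off_sigma[OF assms(2) Ks this]
  obtain J where J: "continuous_on K J" "AE z in circ. z \<in> K \<longrightarrow> I z = J z" by blast
  \<comment> \<open>Replacing the bound by a nonnegative one places it in the range where
    \<open>cos\<close> is decreasing.\<close>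
  define c1 where "c1 = max c0 0"
  have c1: "0 \<le> c1" "c1 < pi / 2" using uv(4) pi_gt_zero unfolding c1_def by (simp, unfold max_def, auto)
  then have cp: "cos c1 > 0" by (intro cos_gt_zero_pi) auto
  have gc: "continuous_on K (\<lambda>z. cnj (z * J z))" using J(1) by (intro continuous_intros)
  have ce: "cos c1 / 2 > 0" using cp by simp
  obtain h \<rho> \<kappa> where h: "h holomorphic_on ball 0 1" "continuous_on (cball 0 1) h" "\<kappa> > 0"
    "\<And>z. z \<in> K \<Longrightarrow> \<kappa> \<le> \<rho> z" "\<And>z. z \<in> K \<Longrightarrow> norm (h z - of_real (\<rho> z) * cnj (z * J z)) \<le> cos c1 / 2 * \<rho> z"
  proof (rule positive_multiple_approximation[OF Kc Ks \<zeta> gc ce])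
    fix h \<rho> \<kappa> assume *: "h holomorphic_on ball 0 1" "continuous_on (cball 0 1) h" "\<kappa> > 0"
      "\<And>z. z \<in> K \<Longrightarrow> \<kappa> \<le> \<rho> z" "\<And>z. z \<in> K \<Longrightarrow> norm (h z - of_real (\<rho> z) * cnj (z * J z)) \<le> cos c1 / 2 * \<rho> z"
    show thesis by (rule that[OF *])
  qed
  have "bounded (h ` cball 0 1)" using h(2) by (intro compact_imp_bounded compact_continuous_image) auto
  then obtain H where H: "H > 0" "\<And>z. norm z \<le> 1 \<Longrightarrow> norm (h z) \<le> H" unfolding bounded_pos by auto
  \<comment> \<open>The factor \<open>w\<close> gives the zero at the origin, \<open>G\<close>
    removes \<open>exp u\<close>, \<open>h\<close> straightens out \<open>z I\<close>, and
    \<open>cnj c\<close> cancels the unimodular constant of the outer function.\<close>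
  define F where "F w = cnj c * w * G w * h w" for w
  have Fh: "F holomorphic_on ball 0 1" unfolding F_def[abs_def] using cGg(2) h(1) by (intro holomorphic_intros)
  have Fb: "norm (F w) \<le> exp C * H" if "norm w < 1" for w
  proof -
    have "norm (F w) = norm w * (norm (G w) * norm (h w))" using cGg(1) by (simp add: F_def norm_mult)
    also have "\<dots> \<le> 1 * (exp C * H)" using that cGg(3)[OF that] H(2)[of w] by (intro mult_mono) auto
    finally show ?thesis by simp
  qed
  obtain f where f: "f \<in> Hinf" "\<And>w. norm w < 1 \<Longrightarrow> ext f w = F w"
      "AE x in circ. ((\<lambda>r. F (of_real r * x)) \<longlongrightarrow> f x) (at_left 1)"
    using boundary_function[OF Fh Fb] by blast
  have "fourier f 0 = 0" using f(2)[of 0] by (simp add: ext_0 F_def)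
  then have f0: "f \<in> Hinf0" using f(1) by (simp add: Hinf0_def)
  note ev = eventually_at_left_1_Ioo
  have fx: "AE x in circ. f x = cnj c * x * g x * h x"
    using f(3) cGg(4) AE_circ_sphere
  proof eventually_elim
    case (elim x)
    have "((\<lambda>r. of_real r * x) \<longlongrightarrow> of_real 1 * x) (at_left 1)" by (intro tendsto_intros)
    then have lx: "((\<lambda>r. of_real r * x) \<longlongrightarrow> x) (at_left 1)" by simp
    have "((\<lambda>r. h (of_real r * x)) \<longlongrightarrow> h x) (at_left 1)"
    proof (rule continuous_on_tendsto_compose[OF h(2) lx])
      show "x \<in> cball 0 1" using elim(3) by simp
      show "\<forall>\<^sub>F r in at_left 1. of_real r * x \<in> cball 0 1"
        using ev by eventually_elim (use elim(3) in \<open>auto simp: norm_mult\<close>)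
    qed
    then have "((\<lambda>r. F (of_real r * x)) \<longlongrightarrow> cnj c * x * g x * h x) (at_left 1)"
      unfolding F_def by (intro tendsto_intros lx elim)
    then show ?case using tendsto_unique[OF _ elim(1)] by simp
  qed
  \<comment> \<open>A product of lower bounds:
    \<open>exp v = |\<phi>| exp (- u) >= L \<delta> exp (- C)\<close>, the weight
    \<open>\<rho> >= \<kappa>\<close>, and \<open>cos c1\<close> less the half spent on the
    approximation error.\<close>
  define k where "k = L * \<delta> * exp (- C) * (\<kappa> * (cos c1 / 2))"
  have k0: "k > 0" using Lp assms(5) h(3) cp by (simp add: k_def)
  have "AE z in circ. linf_norm \<phi> * \<delta> \<le> norm (\<phi> z) \<longrightarrow> k \<le> Re (\<phi> z * f z)"
    using fx cGg(5) assms(4) J(2) I1 uv(3,5) n\<Phi> C AE_circ_sphere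
  proof eventually_elim
    case (elim z)
    show ?case
    proof
      assume big: "linf_norm \<phi> * \<delta> \<le> norm (\<phi> z)"
      have "z \<in> Lplus (\<lambda>z. norm (\<phi> z)) \<delta>" using big elim(10) Ln by (simp add: Lplus_def L_def)
      then have cv: "\<bar>conj_fun v z\<bar> \<le> c1" using elim(7) by (auto simp: c1_def)
      \<comment> \<open>Since \<open>|\<Phi>| = |\<phi>|\<close> almost everywhere and the norms
        agree, large values of \<open>\<phi>\<close> occur only on \<open>K\<close>, where
        \<open>h\<close> and \<open>J\<close> are controlled.\<close>
      have "z \<notin> Lminus \<Phi> \<delta>" using big elim(8) L\<Phi> by (simp add: Lminus_def L_def)
      then have zK: "z \<in> K" using OL elim(10) by (auto simp: K_def)
      then have IJ: "I z = J z" using elim(4) by simp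
      have J1: "(z * J z) * cnj (z * J z) = 1"
        using complex_norm_square[of "z * J z"] elim(5,10) IJ by (simp add: norm_mult)
      define R where "R = \<rho> z"
      have R: "\<kappa> \<le> R" "R > 0" using h(4)[OF zK] h(3) by (auto simp: R_def)
      define T where "T = (z * J z) * (h z - of_real R * cnj (z * J z))"
      have T: "norm T \<le> cos c1 / 2 * R"
        using h(5)[OF zK] elim(5,10) IJ by (simp add: T_def R_def norm_mult)
      have zh: "z * I z * h z = of_real R + T"
        unfolding T_def using J1 IJ by (simp add: algebra_simps)
      have "c * cnj c = 1" using complex_norm_square[of c] cGg(1) by simp
      have "\<phi> z * f z = cnj c * (\<Phi> z * g z) * (z * I z * h z)"
        using elim(1,3) by (simp add: mult_ac)
      also have "\<dots> = (c * cnj c) * (of_real (exp (v z)) * (cis (conj_fun v z) * (of_real R + T)))"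
        unfolding elim(2) zh by (simp add: mult_ac)
      finally have "\<phi> z * f z = of_real (exp (v z)) * (cis (conj_fun v z) * (of_real R + T))"
        using \<open>c * cnj c = 1\<close> by simp
      then have A1: "Re (\<phi> z * f z) = exp (v z) * (R * cos (conj_fun v z) + Re (cis (conj_fun v z) * T))"
        by (simp add: algebra_simps)
      have A2: "R * (cos c1 / 2) \<le> R * cos (conj_fun v z) + Re (cis (conj_fun v z) * T)"
      proof -
        have "cos c1 \<le> cos \<bar>conj_fun v z\<bar>" using cv c1 by (intro cos_monotone_0_pi_le) auto
        then have "R * cos c1 \<le> R * cos (conj_fun v z)" using R by (intro mult_left_mono) auto
        moreover have "\<bar>Re (cis (conj_fun v z) * T)\<bar> \<le> norm T"
          using abs_Re_le_cmod[of "cis (conj_fun v z) * T"] by (simp add: norm_mult del: times_complex.sel)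
        ultimately show ?thesis using T by (simp add: field_simps)
      qed
      have A3: "exp (v z) \<ge> L * \<delta> * exp (- C)"
      proof -
        have "exp (v z) = norm (\<phi> z) * exp (- u z)" using elim(6) by (simp add: exp_add exp_minus field_simps)
        moreover have "L * \<delta> * exp (- C) \<le> norm (\<phi> z) * exp (- u z)"
          using big elim(9) Lp assms(5) by (intro mult_mono) (auto simp: L_def)
        ultimately show ?thesis by simp
      qed
      have A4: "\<kappa> * (cos c1 / 2) \<le> R * (cos c1 / 2)" using R cp by (intro mult_right_mono) auto
      show "k \<le> Re (\<phi> z * f z)"
        unfolding k_def A1
      proof (rule mult_mono[OF A3 order_trans[OF A4 A2]])
        show "0 \<le> \<kappa> * (cos c1 / 2)" using h(3) cp by simp
      qed simp
    qed
  qed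
  then show ?thesis
    using not_saturated_of_direction[OF assms(1,5,6) _ f0 k0] Lp by (simp add: L_def)
qed

end
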